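(* (i) Let $\nu\in\mathbb{C}\setminus\left(\{1-2n: n\in\mathbb{N}\}\cup\{2n:n\in\mathbb{N}\}\right)$. Then \[ \frac{\cot\left(\frac{\pi\nu}{2}\right)\Gamma\left(\frac{1+\nu}{2}\right)^{2}}{\pi\,\Gamma\left(\frac{2+\nu}{2}\right)^{2}}=\sum_{m\geq0}\left[\frac{1}{4^{m}}\binom{2m}{m}\right]^{3}\left(-1\right)^{m+1}\frac{\Gamma\left(m-\nu\right)\Gamma\left(m+\nu+1\right)\left(4m+1\right)}{\Gamma\left(m-\nu+\frac{1}{2}\right)\Gamma\left(m+\nu+\frac{3}{2}\right)}, \] where indeterminate forms are to be interpreted as limits. (ii) For $x\in[0,1]$, \[ K\left(x\right)K\left(1-x\right)=\frac{\pi^{3}}{8}\sum_{m\geq0}\left[\frac{1}{4^{m}}\binom{2m}{m}\right]^{4}\left(4m+1\right)P_{2m}\left(2x-1\right). \]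
   Context: $\Gamma$ is Euler's Gamma function, $\mathbb{N}$ denotes the natural numbers, $P_n$ is the Legendre polynomial of degree $n$, and $K$ is the complete elliptic integral of the first kind with the convention $K(x)=\int_{0}^{\pi/2}\frac{du}{\sqrt{1-x\sin^{2}u}}$. *)

theory Defs
  imports "HOL-Analysis.Analysis" "HOL-Computational_Algebra.Polynomial"
begin

text \<open>Rodrigues' formula.\<close>
definition legendre :: "nat \<Rightarrow> real poly" where
  "legendre n = smult (1 / (2 ^ n * fact n)) ((pderiv ^^ n) ([:-1, 0, 1:] ^ n))"

text \<open>
  The argument is the parameter \<open>x = k\<^sup>2\<close>, not the modulus \<open>k\<close>. The integral is taken in
  \<open>[0, \<infinity>]\<close>, so that \<open>ellK 1 = \<infinity>\<close>; only arguments \<open>x \<le> 1\<close> are meaningful. At \<open>x = 1\<close> the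
  integrand is given the value 0 at the single point \<open>u = \<pi>/2\<close>, which does not affect the integral.
\<close>
definition ellK :: "real \<Rightarrow> ennreal" where
  "ellK x = (\<integral>\<^sup>+ u\<in>{0..pi/2}. ennreal (1 / sqrt (1 - x * (sin u)\<^sup>2)) \<partial>lborel)"

definition ncbinom :: "nat \<Rightarrow> real" where
  "ncbinom m = 1 / 4 ^ m * real ((2 * m) choose m)"

definition cot_Gamma :: "complex \<Rightarrow> complex" where
  "cot_Gamma \<nu> =
     cot (of_real pi * \<nu> / 2) * (Gamma ((1 + \<nu>) / 2))\<^sup>2 / (of_real pi * (Gamma ((2 + \<nu>) / 2))\<^sup>2)"

text \<open>
  At a pole of a Gamma factor in the denominator (\<open>\<nu>\<close> a half-integer) the library conventions
  \<open>Gamma z = 0\<close> at poles and \<open>a / 0 = 0\<close> give the term 0, which is the correct value since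
  \<open>1/\<Gamma>\<close> is entire and vanishes there. At a pole of a Gamma factor in the numerator (\<open>\<nu>\<close> an
  integer) the value given by the same conventions is meaningless.
\<close>
definition Gamma_term :: "complex \<Rightarrow> nat \<Rightarrow> complex" where
  "Gamma_term \<nu> m =
     of_real (ncbinom m) ^ 3 * (-1) ^ (m + 1) *
     (Gamma (of_nat m - \<nu>) * Gamma (of_nat m + \<nu> + 1) * (4 * of_nat m + 1) /
      (Gamma (of_nat m - \<nu> + 1/2) * Gamma (of_nat m + \<nu> + 3/2)))"

end

theory Submission
  imports Defs "HOL-Real_Asymp.Real_Asymp" "HOL-Complex_Analysis.Complex_Analysis"
begin

text \<open>
  Fix \<open>0 < a < 1\<close>, put \<open>q = a (1 - a)\<close>, and let \<open>u(x) = F(a, 1 - a; 1; x)\<close>, that is, the Legendre function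
  of degree \<open>\<nu> = - a\<close> at \<open>1 - 2 x\<close>. Both parts come from the Legendre expansion of the product
  \<open>W(x) = u(x) u(1 - x)\<close>. Since \<open>u(x)\<close> and \<open>u(1 - x)\<close> solve the same second order equation, \<open>W\<close> solves a
  third order one, which turns into the two-term recurrence
  \<open>(n + 1)\<^sup>2 (n (n + 2) + 4 q) w\<^sub>n\<^sub>+\<^sub>1 = n\<^sup>2 (n\<^sup>2 - 1 + 4 q) w\<^sub>n\<^sub>-\<^sub>1\<close>
  for the coefficients \<open>w\<^sub>n = \<integral> W(x) P\<^sub>n(2 x - 1) dx\<close> over \<open>[0, 1]\<close>. Expanding \<open>u\<close> reduces \<open>w\<^sub>0\<close> to the partial
  fractions of the cotangent. The resulting Legendre series converges uniformly after multiplication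
  with \<open>x (1 - x)\<close>, by Sonin's bound, and equals \<open>W\<close> because its moments do.

  The case \<open>a = 1/2\<close>, where \<open>u = 2 K / \<pi>\<close>, is part (ii). The value at \<open>x = 1/2\<close> is part (i) for real \<open>\<nu>\<close> between
  \<open>- 1/2\<close> and \<open>0\<close>; the general case follows by analytic continuation to the complement of the integers.
\<close>

section \<open>Legendre polynomials\<close>

text \<open>The obstacle is the logarithmic singularity of \<open>u\<close> at 1: integrating the
  differential equation for \<open>W\<close> by parts would require boundary asymptotics. The work
  is therefore done on power series. For real a in (0, 1) the moments of \<open>u (1 - x)\<close>
  and of \<open>W\<close> are positive series, so sums and integrals may be exchanged by monotone
  convergence, and each integration by parts becomes a telescoping sum whose boundary term is
  controlled by the limit \<open>\<beta>\<close> of \<open>k * b k\<close>. The double sums stay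
  tractable because of the invariant \<open>b_M\<close>, which makes \<open>b k * M k\<close> an
  explicit rational function of k. The coefficients \<open>s m\<close> of the Legendre series decay
  only like 1/m, and at the endpoints every Legendre polynomial has absolute value 1, so absolute
  convergence fails there. After weighting, Sonin's bound contributes a further m^(-1/2), which
  gives a summable majorant of order m^(-3/2). In part (i), two of the three binomial factors come
  from the recurrence and the third from the value of the Legendre polynomial at 0; the Gamma
  quotient is what remains, the product \<open>\<rho>\<close>.\<close>

lemma pderiv_funpow_X_mult:
  fixes f :: "real poly"
  shows "(pderiv ^^ Suc n) ([:0,1:] * f) = [:0,1:] * (pderiv ^^ Suc n) f + smult (real (Suc n)) ((pderiv ^^ n) f)"
proof (induction n)
  case (Suc n)
  have "(pderiv ^^ Suc (Suc n)) ([:0,1:] * f) = pderiv ((pderiv ^^ Suc n) ([:0,1:] * f))" by simp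
  also have "\<dots> = [:0,1:] * (pderiv ^^ Suc (Suc n)) f + smult (real (Suc (Suc n))) ((pderiv ^^ Suc n) f)"
    unfolding Suc.IH poly_eq_poly_eq_iff[symmetric]
    by (auto simp: fun_eq_iff pderiv_mult pderiv_pCons pderiv_add pderiv_smult algebra_simps)
  finally show ?case .
qed (simp add: pderiv_mult pderiv_pCons)

text \<open>Leibniz's rule stops after three terms, since the third derivative of the quadratic
  factor is zero.\<close>

lemma pderiv_funpow_quadratic_mult_pderiv:
  fixes f :: "real poly"
  shows "(pderiv ^^ Suc m) ([:-1,0,1:] * pderiv f) =
    [:-1,0,1:] * (pderiv ^^ Suc (Suc m)) f + smult (2 * real (Suc m)) ([:0,1:] * (pderiv ^^ Suc m) f)
    + smult (real (Suc m) * real m) ((pderiv ^^ m) f)"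
proof (induction m)
  case 0
  show ?case unfolding poly_eq_poly_eq_iff[symmetric]
    by (auto simp: fun_eq_iff pderiv_mult pderiv_pCons pderiv_diff algebra_simps)
next
  case (Suc m)
  have d: "pderiv [:-1,0,1::real:] = smult 2 [:0,1:]" "pderiv [:0,1::real:] = 1" by (simp_all add: pderiv_pCons)
  have "(pderiv ^^ Suc (Suc m)) ([:-1,0,1:] * pderiv f) = pderiv ((pderiv ^^ Suc m) ([:-1,0,1:] * pderiv f))" by simp
  also have "\<dots> = [:-1,0,1:] * (pderiv ^^ Suc (Suc (Suc m))) f + smult 2 ([:0,1:] * (pderiv ^^ Suc (Suc m)) f)
     + smult (2 * real (Suc m)) ([:0,1:] * (pderiv ^^ Suc (Suc m)) f) + smult (2 * real (Suc m)) ((pderiv ^^ Suc m) f)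
    + smult (real (Suc m) * real m) ((pderiv ^^ Suc m) f)"
    unfolding Suc.IH pderiv_add pderiv_mult pderiv_smult d smult_add_right by (simp add: mult.commute)
  also have "\<dots> = [:-1,0,1:] * (pderiv ^^ Suc (Suc (Suc m))) f + smult (2 + 2 * real (Suc m)) ([:0,1:] * (pderiv ^^ Suc (Suc m)) f)
     + smult (2 * real (Suc m) + real (Suc m) * real m) ((pderiv ^^ Suc m) f)"
    by (simp only: smult_add_left add.assoc)
  finally show ?case by (simp add: algebra_simps)
qed

lemma legendre_0 [simp]: "legendre 0 = 1"
  by (simp add: legendre_def)

lemma pderiv_quadratic_power: "pderiv ([:-1,0,1::real:] ^ Suc n) = smult (2 * real (Suc n)) ([:0,1:] * [:-1,0,1:] ^ n)"
  unfolding poly_eq_poly_eq_iff[symmetric]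
  by (auto simp: fun_eq_iff pderiv_power_Suc pderiv_pCons algebra_simps simp del: power_Suc)

lemma pderiv_funpow_smult: "(pderiv ^^ n) (smult c p) = smult c ((pderiv ^^ n) (p :: real poly))"
  by (induction n) (simp_all add: pderiv_smult)

text \<open>One derivative is spent on the power, the others pass the factor X. The leftover lower
  derivative is an antiderivative of a multiple of \<open>legendre (Suc m)\<close>; the next two
  recurrences eliminate it.\<close>

lemma legendre_Suc_Rodrigues:
  "legendre (Suc (Suc m)) = [:0,1:] * legendre (Suc m) +
     smult (real (Suc m) / (2 ^ Suc m * fact (Suc m))) ((pderiv ^^ m) ([:-1,0,1:] ^ Suc m))"
proof -
  let ?s = "[:-1,0,1::real:]"
  have "(pderiv ^^ Suc (Suc m)) (?s ^ Suc (Suc m)) = (pderiv ^^ Suc m) (pderiv (?s ^ Suc (Suc m)))"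
    by (simp only: funpow_Suc_right o_def)
  also have "\<dots> = smult (2 * real (Suc (Suc m))) ([:0,1:] * (pderiv ^^ Suc m) (?s ^ Suc m) + smult (real (Suc m)) ((pderiv ^^ m) (?s ^ Suc m)))"
    unfolding pderiv_quadratic_power pderiv_funpow_smult pderiv_funpow_X_mult ..
  finally have e: "(pderiv ^^ Suc (Suc m)) (?s ^ Suc (Suc m)) = \<dots>" .
  define K :: real where "K = 2 ^ Suc m * fact (Suc m)"
  have K: "K \<noteq> 0" "2 ^ Suc (Suc m) * fact (Suc (Suc m)) = K * (2 * real (Suc (Suc m)))" by (simp_all add: K_def)
  show ?thesis
    unfolding legendre_def e K(2) K_def[symmetric]
    by (simp add: smult_add_right mult.commute K(1) del: of_nat_Suc power_Suc funpow.simps)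
qed

lemma legendre_1 [simp]: "legendre (Suc 0) = [:0,1:]"
  by (simp add: legendre_def pderiv_pCons)

text \<open>Differentiate (X^2 - 1) f' = 2 n X f n times, where f = (X^2 - 1)^n. Both sides leave a
  multiple of the same lower derivative, which \<open>legendre_Suc_Rodrigues\<close> turns back into
  Legendre polynomials.\<close>

lemma legendre_deriv_recurrence_poly:
  "[:1,0,-1:] * pderiv (legendre n) = smult (real (Suc n)) ([:0,1:] * legendre n - legendre (Suc n))"
proof (cases n)
  case 0
  then show ?thesis by simp
next
  case (Suc m)
  let ?s = "[:-1,0,1::real:]"
  have "?s * pderiv (?s ^ Suc m) = smult (2 * real (Suc m)) ([:0,1:] * ?s ^ Suc m)"
    unfolding pderiv_quadratic_power by (simp add: mult.left_commute)
  then have "(pderiv ^^ Suc m) (?s * pderiv (?s ^ Suc m)) = (pderiv ^^ Suc m) (smult (2 * real (Suc m)) ([:0,1:] * ?s ^ Suc m))"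
    by simp
  then have "?s * (pderiv ^^ Suc (Suc m)) (?s ^ Suc m) + smult (2 * real (Suc m)) ([:0,1:] * (pderiv ^^ Suc m) (?s ^ Suc m))
    + smult (real (Suc m) * real m) ((pderiv ^^ m) (?s ^ Suc m)) =
    smult (2 * real (Suc m)) ([:0,1:] * (pderiv ^^ Suc m) (?s ^ Suc m) + smult (real (Suc m)) ((pderiv ^^ m) (?s ^ Suc m)))"
    unfolding pderiv_funpow_quadratic_mult_pderiv pderiv_funpow_smult pderiv_funpow_X_mult .
  then have "?s * (pderiv ^^ Suc (Suc m)) (?s ^ Suc m) =
     smult (2 * real (Suc m) * real (Suc m)) ((pderiv ^^ m) (?s ^ Suc m)) - smult (real (Suc m) * real m) ((pderiv ^^ m) (?s ^ Suc m))"
    by (simp only: smult_add_right smult_smult add.assoc mult.assoc add.left_commute diff_eq_eq eq_diff_eq add.commute add_left_cancel)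
  also have "\<dots> = smult (real (Suc m) * real (Suc (Suc m))) ((pderiv ^^ m) (?s ^ Suc m))"
    unfolding smult_diff_left[symmetric] by (simp add: algebra_simps del: power_Suc)
  finally have *: "?s * (pderiv ^^ Suc (Suc m)) (?s ^ Suc m) = smult (real (Suc m) * real (Suc (Suc m))) ((pderiv ^^ m) (?s ^ Suc m))" .
  have s: "[:1,0,-1:] = - ?s" by simp
  have minus_mult_smult: "- p * smult c q = - smult c (p * q)" for p q :: "real poly" and c by simp
  have "[:1,0,-1:] * pderiv (legendre (Suc m)) = - smult (1 / (2 ^ Suc m * fact (Suc m))) (?s * (pderiv ^^ Suc (Suc m)) (?s ^ Suc m))"
    unfolding s legendre_def pderiv_smult minus_mult_smult by (simp only: funpow.simps o_apply)
  also have "\<dots> = smult (real (Suc (Suc m))) ([:0,1:] * legendre (Suc m) - legendre (Suc (Suc m)))"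
    unfolding legendre_Suc_Rodrigues *
    by (simp add: mult.commute del: of_nat_Suc power_Suc funpow.simps mult_pCons_left mult_pCons_right fact_Suc)
  finally show ?thesis unfolding Suc .
qed

text \<open>Differentiating \<open>legendre_Suc_Rodrigues\<close> once more turns its leftover term
  into \<open>legendre\<close> itself. Together with the previous identity this yields the
  differential equation and the three-term recurrence.\<close>

lemma pderiv_legendre_Suc:
  "pderiv (legendre (Suc n)) = [:0,1:] * pderiv (legendre n) + smult (real (Suc n)) (legendre n)"
proof (cases n)
  case 0
  then show ?thesis by (simp add: pderiv_pCons)
next
  case (Suc m)
  have "smult (real (Suc m) / (2 ^ Suc m * fact (Suc m))) ((pderiv ^^ Suc m) ([:-1,0,1:] ^ Suc m)) = smult (real (Suc m)) (legendre (Suc m))"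
    unfolding legendre_def by simp
  moreover have "pderiv [:0,1::real:] = 1" by (simp add: pderiv_pCons)
  ultimately show ?thesis
    unfolding Suc legendre_Suc_Rodrigues pderiv_add pderiv_mult pderiv_smult poly_eq_poly_eq_iff[symmetric]
    by (simp add: fun_eq_iff algebra_simps del: power_Suc)
qed

lemma legendre_deriv_eq: "(1 - t\<^sup>2) * poly (pderiv (legendre n)) t = real (Suc n) * (t * poly (legendre n) t - poly (legendre (Suc n)) t)"
  using arg_cong[OF legendre_deriv_recurrence_poly[of n], of "\<lambda>p. poly p t"]
  by (simp add: algebra_simps power2_eq_square)

lemma legendre_Suc_deriv_eq: "(1 - t\<^sup>2) * poly (pderiv (legendre (Suc n))) t = real (Suc n) * (poly (legendre n) t - t * poly (legendre (Suc n)) t)"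
proof -
  have "(1 - t\<^sup>2) * poly (pderiv (legendre (Suc n))) t = t * ((1 - t\<^sup>2) * poly (pderiv (legendre n)) t) + (1 - t\<^sup>2) * real (Suc n) * poly (legendre n) t"
    unfolding pderiv_legendre_Suc by (simp add: algebra_simps)
  also have "\<dots> = real (Suc n) * (poly (legendre n) t - t * poly (legendre (Suc n)) t)"
    unfolding legendre_deriv_eq by algebra
  finally show ?thesis .
qed

text \<open>The derivative in degree n + 1 is expressed once through degree n + 2 and once through
  degree n; the two expressions are equated.\<close>

lemma legendre_three_term:
  "real (2 * n + 3) * (t * poly (legendre (Suc n)) t) = real (n + 2) * poly (legendre (Suc (Suc n))) t + real (n + 1) * poly (legendre n) t"
  using legendre_deriv_eq[of t "Suc n"] legendre_Suc_deriv_eq[of t n] by (simp add: algebra_simps)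

lemma poly_has_field_derivative_within [derivative_intros]:
  "(poly (p::real poly) has_field_derivative poly (pderiv p) t) (at t within S)"
  by (rule DERIV_subset[OF poly_DERIV]) auto

lemma legendre_ode_deriv:
  "((\<lambda>t. (1 - t\<^sup>2) * poly (pderiv (legendre n)) t) has_field_derivative - real n * real (Suc n) * poly (legendre n) t) (at t within S)"
proof -
  have "((\<lambda>t. (1 - t\<^sup>2) * poly (pderiv (legendre n)) t) has_field_derivative 
     real (Suc n) * (poly (legendre n) t + t * poly (pderiv (legendre n)) t - poly (pderiv (legendre (Suc n))) t)) (at t within S)"
    unfolding legendre_deriv_eq by (auto intro!: derivative_eq_intros)
  also have "real (Suc n) * (poly (legendre n) t + t * poly (pderiv (legendre n)) t - poly (pderiv (legendre (Suc n))) t) = - real n * real (Suc n) * poly (legendre n) t"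
    unfolding pderiv_legendre_Suc by (simp add: algebra_simps)
  finally show ?thesis .
qed

lemma poly_legendre_1 [simp]: "poly (legendre n) 1 = 1"
proof (induction n)
  case (Suc n)
  then show ?case using legendre_deriv_eq[of 1 n] by simp
qed simp

lemma legendre_minus: "poly (legendre n) (-t) = (-1) ^ n * poly (legendre n) t"
proof (induction n rule: less_induct)
  case (less n)
  consider "n = 0" | "n = 1" | k where "n = Suc (Suc k)" by (metis One_nat_def not0_implies_Suc)
  then show ?case
  proof cases
    case 3
    have "real (k+2) * poly (legendre n) (-t) = real (2*k+3) * ((-t) * poly (legendre (Suc k)) (-t)) - real (k+1) * poly (legendre k) (-t)"
      using legendre_three_term[of k "-t"] 3 by simp
    also have "\<dots> = (-1)^n * (real (2*k+3) * (t * poly (legendre (Suc k)) t) - real (k+1) * poly (legendre k) t)"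
      using less.IH[of "Suc k"] less.IH[of k] 3 by (simp add: algebra_simps)
    also have "\<dots> = real (k+2) * ((-1)^n * poly (legendre n) t)"
      unfolding legendre_three_term 3 by simp
    finally show ?thesis by (simp del: of_nat_add)
  qed simp_all
qed

section \<open>Normalised central binomial coefficients\<close>

lemma ncbinom_0 [simp]: "ncbinom 0 = 1" by (simp add: ncbinom_def)

lemma ncbinom_pos: "ncbinom m > 0" by (simp add: ncbinom_def)

lemma ncbinom_Suc: "ncbinom (Suc m) = ncbinom m * (2 * real m + 1) / (2 * real m + 2)"
proof -
  have c: "real (2 * n choose n) = fact (2*n) / (fact n * fact n)" for n
    by (simp add: binomial_fact mult_2)
  have f: "fact (2 * Suc m) = 2 * (real m + 1) * ((2 * real m + 1) * fact (2*m))" by (simp add: algebra_simps)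
  have g: "fact (Suc m) = (real m + 1) * fact m" "2 * real m + 2 = 2 * (real m + 1)" by simp_all
  have "1 / (4 * p) * (2 * r * (s * F) / ((r * f) * (r * f))) = 1 / p * (F / (f * f)) * s / (2 * r)"
    if "r \<noteq> 0" "f \<noteq> 0" "p \<noteq> 0" for p r s f F :: real
    using that by (simp add: divide_simps)
  from this[of "real m + 1" "fact m" "4 ^ m" "2 * real m + 1" "fact (2*m)"]
  show ?thesis unfolding ncbinom_def c f g power_Suc by simp
qed

text \<open>Decay of order m^(-1/2), the source of the summable majorant for the Legendre
  series.\<close>

lemma ncbinom_sq_le: "(ncbinom m)\<^sup>2 \<le> 1 / (2 * real m + 1)"
proof (induction m)
  case (Suc m)
  have "(ncbinom (Suc m))\<^sup>2 = (ncbinom m)\<^sup>2 * ((2 * real m + 1) / (2 * real m + 2))\<^sup>2"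
    by (simp add: ncbinom_Suc power_mult_distrib power_divide)
  also have "\<dots> \<le> 1 / (2 * real m + 1) * ((2 * real m + 1) / (2 * real m + 2))\<^sup>2"
    by (intro mult_right_mono Suc) auto
  also have "\<dots> = (2 * real m + 1) / (2 * real m + 2)\<^sup>2" by (simp add: divide_simps power2_eq_square add_nonneg_eq_0_iff)
  also have "\<dots> \<le> 1 / (2 * real (Suc m) + 1)" by (simp add: divide_le_eq le_divide_eq) (simp add: power2_eq_square algebra_simps)
  finally show ?case .
qed simp

text \<open>The matching lower bound, which forces divergence at the endpoints, both of the integral
  \<open>ellK 1\<close> and of the series in part (ii).\<close>

lemma ncbinom_sq_ge: "(ncbinom m)\<^sup>2 \<ge> 1 / (4 * real m + 1)"
proof (induction m)
  case (Suc m)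
  have "1 / (4 * real (Suc m) + 1) \<le> 1 / (4 * real m + 1) * ((2 * real m + 1) / (2 * real m + 2))\<^sup>2"
    by (simp add: divide_simps power2_eq_square) (simp add: algebra_simps)
  also have "\<dots> \<le> (ncbinom m)\<^sup>2 * ((2 * real m + 1) / (2 * real m + 2))\<^sup>2"
    by (intro mult_right_mono Suc) auto
  also have "\<dots> = (ncbinom (Suc m))\<^sup>2"
    by (simp add: ncbinom_Suc power_mult_distrib power_divide)
  finally show ?case .
qed simp

lemma legendre_even_0: "poly (legendre (2 * m)) 0 = (-1) ^ m * ncbinom m"
proof (induction m)
  case (Suc m)
  have "real (2*m+2) * poly (legendre (2 * Suc m)) 0 = - real (2*m+1) * ((-1) ^ m * ncbinom m)"
    using legendre_three_term[of "2*m" 0] Suc by (simp add: algebra_simps)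
  then show ?case unfolding ncbinom_Suc by (simp add: field_simps)
qed simp

lemma pderiv_legendre_even_0: "poly (pderiv (legendre (2 * m))) 0 = 0"
proof -
  have "poly (legendre (Suc (2*m))) 0 = 0" using legendre_minus[of "Suc (2*m)" 0] by simp
  then show ?thesis using legendre_deriv_eq[of 0 "2*m"] by simp
qed

section \<open>Orthogonality and norms on [0, 1]\<close>

lemma legendre_three_term':
  "real (2 * n + 1) * (t * poly (legendre n) t) = real (n + 1) * poly (legendre (Suc n)) t + real n * poly (legendre (n - 1)) t"
proof (cases n)
  case (Suc k)
  then show ?thesis using legendre_three_term[of k t] by (simp add: algebra_simps)
qed simp

text \<open>Sturm-Liouville argument: \<open>F\<close> is an antiderivative of c times the product,
  where c is the difference of the eigenvalues, doubled by the chain rule for 2x - 1. The factor 1 -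
  t^2 makes \<open>F\<close> vanish at both ends.\<close>

lemma legendre_orthogonal:
  assumes "n \<noteq> m"
  shows "((\<lambda>x. poly (legendre n) (2*x-1) * poly (legendre m) (2*x-1)) has_integral 0) {0..1::real}"
proof -
  define D where "D = (\<lambda>n t. (1 - t\<^sup>2) * poly (pderiv (legendre n)) t)"
  define F where "F = (\<lambda>x::real. D n (2*x-1) * poly (legendre m) (2*x-1) - D m (2*x-1) * poly (legendre n) (2*x-1))"
  define c where "c = 2 * (real m * real (Suc m) - real n * real (Suc n))"
  have c: "c \<noteq> 0"
  proof
    assume "c = 0"
    then have "(real m - real n) * (real m + real n + 1) = 0" by (simp add: c_def algebra_simps)
    then show False using assms by (auto simp: mult_eq_0_iff)
  qed
  have dD: "((\<lambda>x. D k (2*x-1)) has_field_derivative - (real k * real (Suc k) * poly (legendre k) (2*x-1)) * 2) (at x within S)" for k x S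
    unfolding D_def
    by (rule DERIV_chain2[where f = "\<lambda>t. (1 - t\<^sup>2) * poly (pderiv (legendre k)) t", OF legendre_ode_deriv[THEN DERIV_cong]])
       (auto intro!: derivative_eq_intros)
  have dP: "((\<lambda>x. poly (legendre k) (2*x-1)) has_field_derivative poly (pderiv (legendre k)) (2*x-1) * 2) (at x within S)" for k x S
    by (rule DERIV_chain2[OF poly_has_field_derivative_within]) (auto intro!: derivative_eq_intros)
  have "(F has_vector_derivative c * (poly (legendre n) (2*x-1) * poly (legendre m) (2*x-1))) (at x within {0..1})" for x
    unfolding has_real_derivative_iff_has_vector_derivative[symmetric] F_def
    by (rule derivative_eq_intros dD dP refl)+ (simp add: c_def D_def algebra_simps)
  then have "((\<lambda>x. c * (poly (legendre n) (2*x-1) * poly (legendre m) (2*x-1))) has_integral F 1 - F 0) {0..1}"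
    by (intro fundamental_theorem_of_calculus) auto
  moreover have "F 1 - F 0 = c * 0" by (simp add: F_def D_def)
  ultimately have "((\<lambda>x. c * (poly (legendre n) (2*x-1) * poly (legendre m) (2*x-1))) has_integral c * 0) {0..1}"
    by (simp only:)
  from has_integral_mult_right[OF this, of "1 / c"]
  have "((\<lambda>x. 1 / c * (c * (poly (legendre n) (2*x-1) * poly (legendre m) (2*x-1)))) has_integral 1 / c * (c * 0)) {0..1}" .
  moreover have "1 / c * (c * z) = z" for z using c by simp
  ultimately show ?thesis by (simp only:)
qed

text \<open>The integral of t times the product of the polynomials of degrees n and n + 1 is
  evaluated in two ways by the three-term recurrence; each time orthogonality removes one product,
  which links consecutive norms.\<close>

lemma legendre_norm:
  "((\<lambda>x. (poly (legendre n) (2*x-1))\<^sup>2) has_integral 1 / real (2*n+1)) {0..1::real}"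
proof (induction n)
  case 0
  show ?case using has_integral_const_real[of "1::real" 0 1] by simp
next
  case (Suc n)
  let ?p = "\<lambda>n x. poly (legendre n) (2*x-1)"
  have 1: "((\<lambda>x. real (n+2) * (?p (Suc (Suc n)) x * ?p n x) + real (n+1) * (?p n x)\<^sup>2) has_integral real (n+2) * 0 + real (n+1) * (1 / real (2*n+1))) {0..1}"
    by (intro has_integral_add has_integral_mult_right legendre_orthogonal Suc.IH) simp
  have 1: "((\<lambda>x. real (2*n+3) * ((2*x-1) * ?p (Suc n) x * ?p n x)) has_integral real (n+1) * (1 / real (2*n+1))) {0..1}"
  proof -
    have "real (n+2) * (?p (Suc (Suc n)) x * ?p n x) + real (n+1) * (?p n x)\<^sup>2 = real (2*n+3) * ((2*x-1) * ?p (Suc n) x * ?p n x)" for x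
    proof -
      have "real (n+2) * (?p (Suc (Suc n)) x * ?p n x) + real (n+1) * (?p n x)\<^sup>2
        = (real (n+2) * ?p (Suc (Suc n)) x + real (n+1) * ?p n x) * ?p n x"
        by (simp only: power2_eq_square distrib_right mult.assoc)
      also have "\<dots> = real (2*n+3) * ((2*x-1) * ?p (Suc n) x * ?p n x)"
        unfolding legendre_three_term[symmetric] by (simp only: mult.assoc)
      finally show ?thesis .
    qed
    then show ?thesis using 1 by simp
  qed
  have "((\<lambda>x. real (2*n+1) / real (2*n+3) * (real (2*n+3) * ((2*x-1) * ?p (Suc n) x * ?p n x)) - real n * (?p (n-1) x * ?p (Suc n) x))
     has_integral real (2*n+1) / real (2*n+3) * (real (n+1) * (1 / real (2*n+1))) - real n * 0) {0..1}"
    by (intro has_integral_diff has_integral_mult_right legendre_orthogonal 1) simp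
  then have "((\<lambda>x. 1 / real (n+1) * (real (2*n+1) / real (2*n+3) * (real (2*n+3) * ((2*x-1) * ?p (Suc n) x * ?p n x)) - real n * (?p (n-1) x * ?p (Suc n) x)))
     has_integral 1 / real (n+1) * (real (2*n+1) / real (2*n+3) * (real (n+1) * (1 / real (2*n+1))) - real n * 0)) {0..1}"
    by (rule has_integral_mult_right)
  moreover have "1 / real (n+1) * (real (2*n+1) / real (2*n+3) * (real (2*n+3) * ((2*x-1) * ?p (Suc n) x * ?p n x)) - real n * (?p (n-1) x * ?p (Suc n) x)) = (?p (Suc n) x)\<^sup>2" for x
  proof -
    have gen: "1 / A * (C / D * (D * (T * r * p)) - E * (y * r)) = 1 / A * ((C * (T * p) - E * y) * r)"
      if "D \<noteq> 0" for A C D E T r p y :: real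
      using that by (simp add: left_diff_distrib right_diff_distrib mult_ac)
    have "1 / real (n+1) * (real (2*n+1) / real (2*n+3) * (real (2*n+3) * ((2*x-1) * ?p (Suc n) x * ?p n x)) - real n * (?p (n-1) x * ?p (Suc n) x))
      = 1 / real (n+1) * ((real (2*n+1) * ((2*x-1) * ?p n x) - real n * ?p (n-1) x) * ?p (Suc n) x)"
      by (rule gen) simp
    also have "\<dots> = (?p (Suc n) x)\<^sup>2"
      unfolding legendre_three_term' by (simp add: power2_eq_square)
    finally show ?thesis .
  qed
  moreover have "1 / real (n+1) * (real (2*n+1) / real (2*n+3) * (real (n+1) * (1 / real (2*n+1))) - real n * 0) = 1 / real (2 * Suc n + 1)"
    by (simp add: divide_simps add_nonneg_eq_0_iff)
  ultimately show ?case by (simp only:)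
qed

text \<open>Sonin's method: with \<open>s = 1 - t\<^sup>2\<close>, the function \<open>y = s\<^sup>1\<^sup>/\<^sup>4 P\<^sub>n\<close> satisfies \<open>y'' + (V/s) y = 0\<close> in the
  angle variable, and the energy \<open>E = y\<^sup>2 + y'\<^sup>2 / (V/s)\<close> is monotone because \<open>V/s\<close> is.\<close>
lemma legendre_even_bound_nonneg:
  assumes t: "0 \<le> t" "t < 1"
  shows "sqrt (1 - t\<^sup>2) * (poly (legendre (2*m)) t)\<^sup>2 \<le> (ncbinom m)\<^sup>2"
proof -
  define n where "n = 2 * m"
  define N where "N = (real n + 1/2)\<^sup>2"
  define P where "P = poly (legendre n)"
  define P1 where "P1 = poly (pderiv (legendre n))"
  \<comment> \<open>With t = cos theta, \<open>Y\<close> is (1 - t^2)^(1/4) times the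
    theta-derivative of y, and \<open>V\<close> divided by 1 - t^2 is the coefficient N + 1 / (4 (1
    - t^2)) of the equation for y.\<close>
  define Y where "Y = (\<lambda>t. t * P t / 2 - (1 - t\<^sup>2) * P1 t)"
  define V where "V = (\<lambda>t. N * (1 - t\<^sup>2) + 1/4)"
  define E where "E = (\<lambda>t. sqrt (1 - t\<^sup>2) * ((P t)\<^sup>2 + (Y t)\<^sup>2 / V t))"
  have N: "N \<ge> 0" by (simp add: N_def)
  \<comment> \<open>The derivative of \<open>E\<close> in closed form, with r = sqrt (1 - t^2): once
    the equations for P' and Y' are inserted, only one term survives, and it has a fixed sign for t
    >= 0.\<close>
  have alg: "(-t/r) * (p\<^sup>2 + y\<^sup>2 / v) + r * (2 * p * p1 + (2 * y * y1 * v - y\<^sup>2 * (-2 * t * N)) / v\<^sup>2) = - (t * y\<^sup>2 / (2 * r * v\<^sup>2))"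
    if "r > 0" "v > 0" "v = N * r\<^sup>2 + 1/4" "y = t * p / 2 - r\<^sup>2 * p1" "y1 = v * p / r\<^sup>2 - t * y / (2 * r\<^sup>2)" for t r p y v p1 y1 :: real
  proof -
    have N': "N = (v - 1/4) / r\<^sup>2" using that(1,3) by (simp add: field_simps)
    have p1': "p1 = (t * p / 2 - y) / r\<^sup>2" using that(1,4) by (simp add: field_simps)
    show ?thesis unfolding that(5) N' p1' using that(1,2)
      by (simp add: field_simps power2_eq_square)
  qed
  have "E t \<le> E 0"
  proof (rule DERIV_nonpos_imp_nonincreasing[OF t(1)])
    fix x assume x: "0 \<le> x" "x \<le> t"
    then have "x < 1" using t by simp
    then have s: "1 - x\<^sup>2 > 0" using x(1) by (simp add: abs_square_less_1)
    then have V: "V x > 0" using N by (simp add: V_def add_nonneg_pos)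
    define r where "r = sqrt (1 - x\<^sup>2)"
    have r: "r > 0" "r\<^sup>2 = 1 - x\<^sup>2" using s by (simp_all add: r_def)
    have dP: "(P has_field_derivative P1 x) (at x)" unfolding P_def P1_def by (rule poly_has_field_derivative_within)
    have dY: "(Y has_field_derivative (V x * P x / r\<^sup>2 - x * Y x / (2 * r\<^sup>2))) (at x)"
    proof -
      have "(Y has_field_derivative ((P x + x * P1 x) / 2 + real n * real (Suc n) * P x)) (at x)"
        unfolding Y_def P1_def
        by (rule DERIV_cong[OF DERIV_diff[OF DERIV_cdivide[OF DERIV_mult[OF DERIV_ident dP]] legendre_ode_deriv]])
           (simp add: P_def P1_def algebra_simps)
      moreover have "(P x + x * P1 x) / 2 + real n * real (Suc n) * P x = V x * P x / r\<^sup>2 - x * Y x / (2 * r\<^sup>2)"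
      proof -
        have "s * (V x * P x / s - x * Y x / (2 * s)) = s * ((P x + x * P1 x) / 2 + real n * real (Suc n) * P x)"
          if "s = 1 - x\<^sup>2" "s > 0" for s
        proof -
          have "s * (V x * P x / s - x * Y x / (2 * s)) = V x * P x - x * Y x / 2"
            using that(2) by (simp add: right_diff_distrib)
          also have "\<dots> = s * ((P x + x * P1 x) / 2 + real n * real (Suc n) * P x)"
            unfolding V_def Y_def N_def that(1) by (simp add: power2_eq_square field_simps)
          finally show ?thesis .
        qed
        from this[of "r\<^sup>2"] show ?thesis using r s by auto
      qed
      ultimately show ?thesis by simp
    qed
    have dV: "(V has_field_derivative -2 * x * N) (at x)" unfolding V_def by (auto intro!: derivative_eq_intros)
    have dr: "((\<lambda>x. sqrt (1 - x\<^sup>2)) has_field_derivative - x / r) (at x)"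
      using s by (auto intro!: derivative_eq_intros simp: r_def field_simps)
    have "(E has_field_derivative (-x/r) * ((P x)\<^sup>2 + (Y x)\<^sup>2 / V x) + r * (2 * P x * P1 x + (2 * Y x * (V x * P x / r\<^sup>2 - x * Y x / (2 * r\<^sup>2)) * V x - (Y x)\<^sup>2 * (-2 * x * N)) / (V x)\<^sup>2)) (at x)"
      unfolding E_def
      by (rule DERIV_cong[OF DERIV_mult[OF dr DERIV_add[OF DERIV_power[OF dP, of 2] DERIV_divide[OF DERIV_power[OF dY, of 2] dV]]]])
         (use V in \<open>simp_all add: r_def[symmetric] power2_eq_square[of "V x"] mult_ac\<close>)
    moreover have "(-x/r) * ((P x)\<^sup>2 + (Y x)\<^sup>2 / V x) + r * (2 * P x * P1 x + (2 * Y x * (V x * P x / r\<^sup>2 - x * Y x / (2 * r\<^sup>2)) * V x - (Y x)\<^sup>2 * (-2 * x * N)) / (V x)\<^sup>2) = - (x * (Y x)\<^sup>2 / (2 * r * (V x)\<^sup>2))"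
      by (rule alg) (use r V in \<open>auto simp: V_def Y_def\<close>)
    moreover have "- (x * (Y x)\<^sup>2 / (2 * r * (V x)\<^sup>2)) \<le> 0" using x r by simp
    ultimately show "\<exists>y. (E has_field_derivative y) (at x) \<and> y \<le> 0" by metis
  qed
  \<comment> \<open>In even degree the derivative vanishes at 0, so \<open>Y 0\<close> is 0 and the
    energy is just the square of the value there.\<close>
  also have "E 0 = (ncbinom m)\<^sup>2"
    unfolding E_def Y_def P_def P1_def n_def by (simp add: legendre_even_0 pderiv_legendre_even_0 power_mult_distrib power_mult[symmetric])
  finally have "E t \<le> (ncbinom m)\<^sup>2" .
  moreover have "t\<^sup>2 \<le> 1" using t by (simp add: power_le_one)
  then have "sqrt (1 - t\<^sup>2) * (P t)\<^sup>2 \<le> E t"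
    unfolding E_def using N by (intro mult_left_mono) (auto simp: V_def)
  ultimately show ?thesis by (simp add: P_def n_def)
qed

lemma legendre_even_bound:
  assumes "\<bar>t\<bar> \<le> 1"
  shows "sqrt (1 - t\<^sup>2) * (poly (legendre (2*m)) t)\<^sup>2 \<le> (ncbinom m)\<^sup>2"
proof -
  have "poly (legendre (2*m)) \<bar>t\<bar> = poly (legendre (2*m)) t"
    using legendre_minus[of "2*m" t] by (auto simp: abs_if)
  then show ?thesis using legendre_even_bound_nonneg[of "\<bar>t\<bar>" m] assms
    by (cases "\<bar>t\<bar> = 1") (auto simp: abs_if split: if_splits)
qed

section \<open>Uniform convergence and vanishing moments\<close>

text \<open>Weierstrass approximation turns vanishing moments into \<open>\<integral> g\<^sup>2 = 0\<close>.\<close>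
lemma continuous_on_zero_moments_imp_zero:
  fixes g :: "real \<Rightarrow> real"
  assumes g: "continuous_on {0..1} g" and mom: "\<And>p. ((\<lambda>x. poly p x * g x) has_integral 0) {0..1}"
    and x: "x \<in> {0..1}"
  shows "g x = 0"
proof -
  have int_abs: "(\<lambda>x. \<bar>g x\<bar>) integrable_on {0..1}"
    by (intro integrable_continuous_interval continuous_intros g)
  have int_sq: "(\<lambda>x. (g x)\<^sup>2) integrable_on {0..1}"
    by (intro integrable_continuous_interval continuous_intros g)
  define I where "I = integral {0..1} (\<lambda>x. \<bar>g x\<bar>)"
  have I: "I \<ge> 0" unfolding I_def by (intro integral_nonneg int_abs) simp
  have le: "integral {0..1} (\<lambda>x. (g x)\<^sup>2) \<le> e * I" if e: "e > 0" for e
  proof -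
    obtain f where f: "real_polynomial_function f" "\<And>x. x \<in> {0..1} \<Longrightarrow> \<bar>g x - f x\<bar> < e"
      using Stone_Weierstrass_real_polynomial_function[of "{0..1}" g e] g e by auto
    then obtain c n where fc: "f = (\<lambda>x. \<Sum>i\<le>n. c i * x ^ i)"
      using real_polynomial_function_iff_sum by blast
    define p where "p = (\<Sum>i\<le>n. monom (c i) i)"
    have pf: "poly p x = f x" for x by (simp add: p_def fc poly_sum poly_monom)
    have "((\<lambda>x. (g x)\<^sup>2 - poly p x * g x) has_integral integral {0..1} (\<lambda>x. (g x)\<^sup>2) - 0) {0..1}"
      by (intro has_integral_diff mom integrable_integral int_sq)
    moreover have "((\<lambda>x. e * \<bar>g x\<bar>) has_integral e * I) {0..1}"
      unfolding I_def by (intro has_integral_mult_right integrable_integral int_abs)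
    moreover have "(g x)\<^sup>2 - poly p x * g x \<le> e * \<bar>g x\<bar>" if "x \<in> {0..1}" for x
    proof -
      have "(g x)\<^sup>2 - poly p x * g x = (g x - f x) * g x" by (simp add: pf power2_eq_square algebra_simps)
      also have "\<dots> \<le> \<bar>g x - f x\<bar> * \<bar>g x\<bar>" by (metis abs_ge_self abs_mult)
      also have "\<dots> \<le> e * \<bar>g x\<bar>" using f(2)[OF that] by (intro mult_right_mono) auto
      finally show ?thesis .
    qed
    ultimately have "integral {0..1} (\<lambda>x. (g x)\<^sup>2) - 0 \<le> e * I" by (rule has_integral_le)
    then show ?thesis by simp
  qed
  have "integral {0..1} (\<lambda>x. (g x)\<^sup>2) \<le> 0"
  proof (rule field_le_epsilon)
    fix e :: real assume "e > 0"
    \<comment> \<open>The denominator I + 1 also covers the case I = 0.\<close>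
    then have "integral {0..1} (\<lambda>x. (g x)\<^sup>2) \<le> e / (I + 1) * I" using I by (intro le) simp
    also have "\<dots> \<le> e" using I \<open>e > 0\<close> by (simp add: field_simps)
    finally show "integral {0..1} (\<lambda>x. (g x)\<^sup>2) \<le> 0 + e" by simp
  qed
  moreover have "integral {0..1} (\<lambda>x. (g x)\<^sup>2) \<ge> 0" by (intro integral_nonneg int_sq) simp
  ultimately have "integral {0..1} (\<lambda>x. (g x)\<^sup>2) = 0" by (rule antisym)
  then have 0: "((\<lambda>x. (g x)\<^sup>2) has_integral 0) (cbox 0 1)"
    using integrable_integral[OF int_sq] by simp
  have "continuous_on (cbox 0 1) (\<lambda>x. (g x)\<^sup>2)" using g by (simp add: continuous_intros)
  from has_integral_0_cbox_imp_0[OF this _ 0, of x] x have "(g x)\<^sup>2 = 0"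
    by simp
  then show ?thesis by simp
qed

lemma continuous_on_suminf_M_test:
  fixes f :: "nat \<Rightarrow> real \<Rightarrow> real"
  assumes "\<And>n. continuous_on A (f n)" "\<And>n x. x \<in> A \<Longrightarrow> \<bar>f n x\<bar> \<le> C n" "summable C"
  shows "continuous_on A (\<lambda>x. \<Sum>n. f n x)"
proof (rule uniform_limit_theorem)
  show "uniform_limit A (\<lambda>n x. \<Sum>i<n. f i x) (\<lambda>x. \<Sum>n. f n x) sequentially"
    using assms by (intro Weierstrass_m_test[of _ _ C]) auto
  show "\<forall>\<^sub>F n in sequentially. continuous_on A (\<lambda>x. \<Sum>i<n. f i x)"
    by (intro always_eventually allI continuous_on_sum assms(1))
qed simp

lemma has_integral_suminf_M_test:
  fixes f :: "nat \<Rightarrow> real \<Rightarrow> real"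
  assumes "\<And>n. continuous_on {u..v} (f n)" "\<And>n x. x \<in> {u..v} \<Longrightarrow> \<bar>f n x\<bar> \<le> C n" "summable C"
    and c: "\<And>n. (f n has_integral c n) {u..v}" and s: "c sums s"
  shows "((\<lambda>x. \<Sum>n. f n x) has_integral s) {u..v}"
proof -
  have "uniform_limit {u..v} (\<lambda>n x. \<Sum>i<n. f i x) (\<lambda>x. \<Sum>n. f n x) sequentially"
    using assms by (intro Weierstrass_m_test[of _ _ C]) auto
  moreover have "continuous_on {u..v} (\<lambda>x. \<Sum>i<n. f i x)" for n
    by (intro continuous_on_sum assms(1))
  ultimately obtain I J where I: "\<And>n. ((\<lambda>x. \<Sum>i<n. f i x) has_integral I n) {u..v}"
    and J: "((\<lambda>x. \<Sum>n. f n x) has_integral J) {u..v}" "I \<longlonglongrightarrow> J"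
    by (rule uniform_limit_integral[OF _ _ sequentially_bot]) blast
  have "I n = (\<Sum>i<n. c i)" for n
    by (rule has_integral_unique[OF I]) (intro has_integral_sum c, simp)
  then have "I = (\<lambda>n. \<Sum>i<n. c i)" by (rule ext)
  then have "c sums J" using J(2) by (simp add: sums_def)
  then show ?thesis using s J(1) sums_unique2 by blast
qed

section \<open>Moments of the product of hypergeometric functions\<close>

lemma rGamma_reflection_real: "rGamma a * rGamma (1 - a) = sin (pi * a) / (pi::real)"
proof -
  have "complex_of_real (rGamma a * rGamma (1 - a)) = complex_of_real (sin (pi * a) / pi)"
    using rGamma_reflection_complex[of "of_real a"]
    by (simp add: rGamma_complex_of_real[symmetric] sin_of_real[symmetric])
  then show ?thesis by (simp only: of_real_eq_iff)
qed

lemma summable_inverse_Suc_square: "summable (\<lambda>k. 1 / (real k + 1)\<^sup>2)"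
  using inverse_squares_sums by (simp add: sums_iff add.commute)

text \<open>The Beta value B(n + 1, k + 1), the integral of x^n (1 - x)^k over [0, 1].\<close>

definition nat_beta :: "nat \<Rightarrow> nat \<Rightarrow> real" where "nat_beta n k = fact n * fact k / fact (n + k + 1)"

lemma nat_beta_pos: "nat_beta n k > 0" by (simp add: nat_beta_def)

lemma nat_beta_le: "nat_beta n k \<le> fact n / (real k + 1)"
proof -
  have "fact (k + 1) \<le> (fact (n + k + 1) :: real)" by (intro fact_mono) simp
  then have "nat_beta n k \<le> fact n * fact k / fact (k + 1)"
    unfolding nat_beta_def by (intro divide_left_mono) auto
  also have "\<dots> = fact n / (real k + 1)" by (simp add: divide_simps)
  finally show ?thesis .
qed

locale hypergeometric_square =
  fixes a :: real
  assumes a_pos: "0 < a" and a_less_1: "a < 1"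
begin

definition q :: real where "q = a * (1 - a)"

definition b :: "nat \<Rightarrow> real" where
  "b k = pochhammer a k * pochhammer (1 - a) k / (fact k)\<^sup>2"

text \<open>By reflection this is 1 / (Gamma(a) Gamma(1 - a)). It is the limit of
  \<open>k * b k\<close> and measures the logarithmic singularity of \<open>u\<close> at 1.\<close>

definition \<beta> :: real where "\<beta> = sin (pi * a) / pi"

text \<open>The moments of \<open>u (1 - x)\<close>; those of \<open>W\<close> are
  \<open>\<mu>\<close> below. Both are introduced as series so that their recurrences can be proved
  by telescoping. The integrals are supplied by \<open>has_integral_M\<close> and
  \<open>has_integral_\<mu>\<close>.\<close>

definition M :: "nat \<Rightarrow> real" where "M n = (\<Sum>k. b k * nat_beta n k)"

definition \<mu> :: "nat \<Rightarrow> real" where "\<mu> n = (\<Sum>k. b k * M (n + k))"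

lemma q_pos: "q > 0" using a_pos a_less_1 by (simp add: q_def)

lemma q_le: "q \<le> 1/4"
proof -
  have "0 \<le> (a - 1/2)\<^sup>2" by simp
  then show ?thesis by (simp add: q_def power2_eq_square algebra_simps)
qed

lemma \<beta>_pos: "\<beta> > 0"
  using a_pos a_less_1 by (simp add: \<beta>_def sin_gt_zero)

lemma b_0 [simp]: "b 0 = 1" by (simp add: b_def)

lemma b_Suc_mult: "(real k + 1)\<^sup>2 * b (Suc k) = b k * ((real k)\<^sup>2 + real k + q)"
proof -
  have "b (Suc k) = pochhammer a k * pochhammer (1 - a) k * ((a + real k) * (1 - a + real k)) / ((real k + 1) * fact k)\<^sup>2"
    by (simp add: b_def pochhammer_Suc mult_ac)
  also have "\<dots> = b k * ((a + real k) * (1 - a + real k)) / (real k + 1)\<^sup>2"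
    by (simp add: b_def power_mult_distrib)
  also have "(a + real k) * (1 - a + real k) = (real k)\<^sup>2 + real k + q"
    by (simp add: q_def power2_eq_square algebra_simps)
  finally show ?thesis by (simp add: add_nonneg_eq_0_iff)
qed

lemma b_Suc: "b (Suc k) = b k * ((real k)\<^sup>2 + real k + q) / (real k + 1)\<^sup>2"
  using b_Suc_mult[of k] by (simp add: eq_divide_eq mult.commute add_nonneg_eq_0_iff)

lemma b_pos: "b k > 0"
  using a_pos a_less_1 by (simp add: b_def pochhammer_pos)

lemma b_le: "b k \<le> 1 / (real k + 1)"
proof (induction k)
  case (Suc k)
  have le: "((real k)\<^sup>2 + real k + q) * (real k + 2) \<le> (real k + 1) ^ 3"
  proof -
    have "q * (real k + 2) \<le> 1/4 * (real k + 2)" by (intro mult_right_mono q_le) simp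
    moreover have "(real k + 1) ^ 3 - ((real k)\<^sup>2 + real k + q) * (real k + 2) = real k + 1 - q * (real k + 2)"
      by (simp add: power2_eq_square power3_eq_cube algebra_simps)
    moreover have "real k + 1 - 1/4 * (real k + 2) \<ge> 0" by simp
    ultimately show ?thesis by linarith
  qed
  have "(real k + 1)\<^sup>2 * b (Suc k) \<le> 1 / (real k + 1) * ((real k)\<^sup>2 + real k + q)"
    unfolding b_Suc_mult using q_pos by (intro mult_right_mono Suc.IH) auto
  also have "\<dots> \<le> (real k + 1)\<^sup>2 * (1 / (real (Suc k) + 1))"
    using le by (simp add: divide_simps) (simp add: power2_eq_square power3_eq_cube algebra_simps)
  finally show ?case by (subst (asm) mult_le_cancel_left_pos) auto
qed simp

lemma b_le_1: "b k \<le> 1"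
  by (rule order_trans[OF b_le]) simp

lemma b_Suc_le: "b (Suc k) \<le> b k"
proof -
  have "(real k + 1)\<^sup>2 * b (Suc k) \<le> b k * (real k + 1)\<^sup>2"
    unfolding b_Suc_mult using q_le by (intro mult_left_mono less_imp_le[OF b_pos]) (simp add: power2_eq_square algebra_simps)
  then show ?thesis by (simp add: mult.commute)
qed

text \<open>Product of the limit formulas for the reciprocal Gamma function at a and 1 - a: the
  powers n^a and n^(1 - a) multiply to n. The factor n / (n + 1) adjusts the index shift in
  \<open>rGamma_series\<close>.\<close>

lemma k_b_tendsto: "(\<lambda>k. real k * b k) \<longlonglongrightarrow> \<beta>"
proof -
  have "(\<lambda>n. rGamma_series a n * rGamma_series (1 - a) n) \<longlonglongrightarrow> rGamma a * rGamma (1 - a)"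
    by (intro tendsto_mult rGamma_series_LIMSEQ)
  moreover have "(\<lambda>n. real n / (real n + 1)) \<longlonglongrightarrow> 1" by real_asymp
  ultimately have "(\<lambda>n. rGamma_series a n * rGamma_series (1 - a) n * (real n / (real n + 1))) \<longlonglongrightarrow> rGamma a * rGamma (1 - a) * 1"
    by (rule tendsto_mult)
  then have "(\<lambda>n. rGamma_series a n * rGamma_series (1 - a) n * (real n / (real n + 1))) \<longlonglongrightarrow> \<beta>"
    by (simp only: rGamma_reflection_real \<beta>_def mult_1_right)
  moreover have "\<forall>\<^sub>F n in sequentially. rGamma_series a n * rGamma_series (1 - a) n * (real n / (real n + 1)) = real (Suc n) * b (Suc n)"
    using eventually_gt_at_top[of 0]
  proof eventually_elim
    case (elim n)
    have "exp (a * ln (real n)) * exp ((1 - a) * ln (real n)) = real n"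
      using elim by (simp add: exp_add[symmetric] algebra_simps)
    then have "rGamma_series a n * rGamma_series (1 - a) n = pochhammer a (Suc n) * pochhammer (1 - a) (Suc n) / ((fact n)\<^sup>2 * real n)"
      by (simp add: rGamma_series_def power2_eq_square mult_ac)
    moreover have "real (Suc n) * b (Suc n) = pochhammer a (Suc n) * pochhammer (1 - a) (Suc n) / ((fact n)\<^sup>2 * (real n + 1))"
      by (simp add: b_def power2_eq_square add.commute)
    ultimately show ?case using elim by simp
  qed
  ultimately have "(\<lambda>n. real (Suc n) * b (Suc n)) \<longlonglongrightarrow> \<beta>"
    by (rule Lim_transform_eventually)
  then show ?thesis by (rule LIMSEQ_imp_Suc)
qed

lemma summable_M: "summable (\<lambda>k. b k * nat_beta n k)"
proof (rule summable_comparison_test')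
  show "summable (\<lambda>k. fact n * (1 / (real k + 1)\<^sup>2))"
    by (intro summable_mult summable_inverse_Suc_square)
  have "b k * nat_beta n k \<le> 1 / (real k + 1) * (fact n / (real k + 1))" for k
    by (intro mult_mono b_le nat_beta_le less_imp_le[OF b_pos] less_imp_le[OF nat_beta_pos]) auto
  then show "norm (b k * nat_beta n k) \<le> fact n * (1 / (real k + 1)\<^sup>2)" if "0 \<le> k" for k
    using b_pos[of k] nat_beta_pos[of n k] by (simp add: power2_eq_square)
qed

lemma M_sums: "(\<lambda>k. b k * nat_beta n k) sums M n"
  unfolding M_def by (rule summable_sums[OF summable_M])

lemma M_pos: "M n > 0"
  unfolding M_def by (intro suminf_pos summable_M) (simp add: b_pos nat_beta_pos)

text \<open>The summand \<open>q * (b k * nat_beta 0 k)\<close> is the increment of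
  \<open>k * b k\<close>, so the sum is the limit \<open>\<beta>\<close>.\<close>

lemma M_0: "q * M 0 = \<beta>"
proof -
  have "(\<Sum>k<n. q * (b k * nat_beta 0 k)) = real n * b n" for n
  proof (induction n)
    case (Suc n)
    have "(real n + 1) * ((real n + 1) * b (Suc n)) = (real n + 1) * (real n * b n + q * (b n * nat_beta 0 n))"
    proof -
      have "(real n + 1) * nat_beta 0 n = 1" by (simp add: nat_beta_def divide_simps)
      then have "(real n + 1) * (real n * b n + q * (b n * nat_beta 0 n)) = (real n + 1) * (real n * b n) + q * b n"
        by (simp add: distrib_left mult.left_commute)
      then show ?thesis using b_Suc_mult[of n] by (simp add: power2_eq_square algebra_simps)
    qed
    then have "(real n + 1) * b (Suc n) = real n * b n + q * (b n * nat_beta 0 n)"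
      by (subst (asm) mult_cancel_left) (simp add: add_nonneg_eq_0_iff)
    then show ?case using Suc by (simp add: add.commute)
  qed simp
  then have "(\<lambda>k. q * (b k * nat_beta 0 k)) sums \<beta>"
    unfolding sums_def using k_b_tendsto by simp
  then show ?thesis using sums_mult[OF M_sums[of 0], of q] sums_unique2 by blast
qed

text \<open>Series form of testing the self-adjoint equation (x (1 - x) f')' = q f, with f(x) = u(1
  - x), against x^(n + 1). The telescoping quantity \<open>G\<close> takes the place of the boundary
  term.\<close>

lemma M_Suc: "((real n + 1)\<^sup>2 + (real n + 1) + q) * M (Suc n) = (real n + 1)\<^sup>2 * M n"
proof -
  let ?n = "real n + 1"
  define G where "G k = real k * (?n + real k + 1) * b k * nat_beta (Suc n) k" for k
  have Bn: "?n * nat_beta n k = (?n + real k + 1) * nat_beta (Suc n) k" for k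
    by (simp add: nat_beta_def divide_simps add_nonneg_eq_0_iff)
  have BS: "(?n + real k + 2) * nat_beta (Suc n) (Suc k) = (real k + 1) * nat_beta (Suc n) k" for k
    by (simp add: nat_beta_def divide_simps add_nonneg_eq_0_iff)
  have G: "G (Suc k) - G k = (?n\<^sup>2 + ?n + q) * (b k * nat_beta (Suc n) k) - ?n\<^sup>2 * (b k * nat_beta n k)" for k
  proof -
    have "G (Suc k) = (real k + 1) * b (Suc k) * ((?n + real k + 2) * nat_beta (Suc n) (Suc k))"
      by (simp add: G_def algebra_simps)
    also have "\<dots> = ((real k + 1)\<^sup>2 * b (Suc k)) * nat_beta (Suc n) k"
      unfolding BS by (simp add: power2_eq_square)
    also have "\<dots> = b k * ((real k)\<^sup>2 + real k + q) * nat_beta (Suc n) k" unfolding b_Suc_mult ..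
    finally have 1: "G (Suc k) = \<dots>" .
    have 2: "?n\<^sup>2 * (b k * nat_beta n k) = ?n * b k * ((?n + real k + 1) * nat_beta (Suc n) k)"
      unfolding Bn[symmetric] by (simp add: power2_eq_square)
    show ?thesis unfolding 1 2 by (simp add: G_def power2_eq_square algebra_simps)
  qed
  have "G \<longlonglongrightarrow> 0"
  proof (rule tendsto_sandwich[of "\<lambda>_. 0"])
    show "\<forall>\<^sub>F k in sequentially. G k \<le> real k * b k * (fact (Suc n) / (real k + 1))"
    proof (intro always_eventually allI)
      fix k
      have "(?n + real k + 1) * nat_beta (Suc n) k = fact (Suc n) * fact k / fact (Suc n + k)"
        by (simp add: nat_beta_def divide_simps add_nonneg_eq_0_iff)
      also have "\<dots> \<le> fact (Suc n) * fact k / fact (k + 1)"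
        by (intro divide_left_mono fact_mono) auto
      also have "\<dots> = fact (Suc n) / (real k + 1)" by (simp add: divide_simps)
      finally have "real k * b k * ((?n + real k + 1) * nat_beta (Suc n) k) \<le> real k * b k * (fact (Suc n) / (real k + 1))"
        using b_pos[of k] by (intro mult_left_mono) auto
      then show "G k \<le> real k * b k * (fact (Suc n) / (real k + 1))" by (simp add: G_def mult_ac)
    qed
    have "(\<lambda>k. fact (Suc n) / (real k + 1)) \<longlonglongrightarrow> 0" by real_asymp
    then show "(\<lambda>k. real k * b k * (fact (Suc n) / (real k + 1))) \<longlonglongrightarrow> 0"
      using tendsto_mult[OF k_b_tendsto] by fastforce
  qed (use b_pos nat_beta_pos in \<open>auto simp: G_def less_imp_le\<close>)
  then have "(\<lambda>k. G (Suc k) - G k) sums (0 - G 0)" by (rule telescope_sums)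
  then have "(\<lambda>k. (?n\<^sup>2 + ?n + q) * (b k * nat_beta (Suc n) k) - ?n\<^sup>2 * (b k * nat_beta n k)) sums 0"
    unfolding G by (simp add: G_def)
  moreover have "(\<lambda>k. (?n\<^sup>2 + ?n + q) * (b k * nat_beta (Suc n) k) - ?n\<^sup>2 * (b k * nat_beta n k)) sums ((?n\<^sup>2 + ?n + q) * M (Suc n) - ?n\<^sup>2 * M n)"
    by (intro sums_diff sums_mult M_sums)
  ultimately show ?thesis using sums_unique2 by fastforce
qed

text \<open>The recurrences of \<open>b\<close> and \<open>M\<close> contain the same two factors in
  opposite positions, so this product does not depend on k; \<open>M_0\<close> gives its value. It
  determines the asymptotics of \<open>M\<close> and makes the series for \<open>\<mu> 0\<close>
  explicit.\<close>

lemma b_M: "((real k)\<^sup>2 + real k + q) * (b k * M k) = \<beta>"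
proof (induction k)
  case 0
  then show ?case using M_0 by simp
next
  case (Suc k)
  have "((real (Suc k))\<^sup>2 + real (Suc k) + q) * (b (Suc k) * M (Suc k)) = b (Suc k) * (((real k + 1)\<^sup>2 + (real k + 1) + q) * M (Suc k))"
    by (simp add: algebra_simps)
  also have "\<dots> = ((real k + 1)\<^sup>2 * b (Suc k)) * M k" unfolding M_Suc by simp
  finally show ?case using Suc.IH unfolding b_Suc_mult by (simp add: mult_ac)
qed

lemma n_M_tendsto: "(\<lambda>n. real n * M n) \<longlonglongrightarrow> 1"
proof -
  have "(\<lambda>n. \<beta> * ((real n)\<^sup>2 / ((real n)\<^sup>2 + real n + q)) / (real n * b n)) \<longlonglongrightarrow> \<beta> * 1 / \<beta>"
    by (intro tendsto_intros k_b_tendsto) (real_asymp | use \<beta>_pos in simp)+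
  then show ?thesis
  proof (rule Lim_transform_eventually[THEN tendsto_eq_rhs])
    show "\<forall>\<^sub>F n in sequentially. \<beta> * ((real n)\<^sup>2 / ((real n)\<^sup>2 + real n + q)) / (real n * b n) = real n * M n"
      using eventually_gt_at_top[of 0]
    proof eventually_elim
      case (elim n)
      have "(real n)\<^sup>2 + real n + q > 0" using q_pos by (simp add: add_nonneg_pos)
      then show ?case using elim b_pos[of n] unfolding b_M[of n, symmetric]
        by (simp add: divide_simps power2_eq_square)
    qed
  qed (use \<beta>_pos in simp)
qed

lemma M_Suc_le: "M (Suc n) \<le> M n"
proof -
  have "(real n + 1)\<^sup>2 * M (Suc n) \<le> ((real n + 1)\<^sup>2 + (real n + 1) + q) * M (Suc n)"
    using q_pos M_pos[of "Suc n"] by (intro mult_right_mono) auto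
  then show ?thesis unfolding M_Suc by (simp add: add_nonneg_eq_0_iff)
qed

lemma M_antimono: "M (n + k) \<le> M k"
  by (induction n) (auto intro: order_trans[OF M_Suc_le])

text \<open>Monotonicity of \<open>M\<close> reduces the claim to n = 0, where \<open>b_M\<close>
  makes the summand explicit; q <= 1/4 allows comparison with the inverse squares.\<close>

lemma summable_\<mu>: "summable (\<lambda>k. b k * M (n + k))"
proof (rule summable_comparison_test')
  show "summable (\<lambda>k. \<beta> / q * (1 / (real k + 1)\<^sup>2))"
    by (intro summable_mult summable_inverse_Suc_square)
  fix k :: nat
  have "q * (real k + 1)\<^sup>2 \<le> (real k)\<^sup>2 + real k + q"
  proof -
    have "q * ((real k)\<^sup>2 + 2 * real k) \<le> 1/4 * ((real k)\<^sup>2 + 2 * real k)" by (intro mult_right_mono q_le) auto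
    also have "\<dots> \<le> (real k)\<^sup>2 + real k" by simp
    finally show ?thesis by (simp add: power2_eq_square algebra_simps)
  qed
  then have "q * (real k + 1)\<^sup>2 * (b k * M k) \<le> \<beta>"
    unfolding b_M[of k, symmetric] using b_pos[of k] M_pos[of k] by (intro mult_right_mono) auto
  then have "b k * M k \<le> \<beta> / q * (1 / (real k + 1)\<^sup>2)"
    using q_pos by (simp add: field_simps)
  moreover have "b k * M (n + k) \<le> b k * M k"
    by (intro mult_left_mono M_antimono less_imp_le[OF b_pos])
  ultimately have "b k * M (n + k) \<le> \<beta> / q * (1 / (real k + 1)\<^sup>2)" by (rule order_trans[rotated])
  then show "norm (b k * M (n + k)) \<le> \<beta> / q * (1 / (real k + 1)\<^sup>2)"
    using b_pos[of k] M_pos[of "n+k"] by (simp only: real_norm_def abs_of_pos mult_pos_pos)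
qed

lemma \<mu>_sums: "(\<lambda>k. b k * M (n + k)) sums \<mu> n"
  unfolding \<mu>_def by (rule summable_sums[OF summable_\<mu>])

lemma \<mu>_0_sums: "(\<lambda>k. \<beta> / ((real k + a) * (real k + 1 - a))) sums \<mu> 0"
proof -
  have "b k * M (0 + k) = \<beta> / ((real k + a) * (real k + 1 - a))" for k
  proof -
    have "(real k)\<^sup>2 + real k + q = (real k + a) * (real k + 1 - a)"
      by (simp add: q_def power2_eq_square algebra_simps)
    moreover have "(real k)\<^sup>2 + real k + q > 0" using q_pos by (simp add: add_nonneg_pos)
    ultimately show ?thesis using b_M[of k] by (auto simp: eq_divide_eq mult.commute)
  qed
  then show ?thesis using \<mu>_sums[of 0] by simp
qed

text \<open>The certificate \<open>G\<close> is the discrete form of the boundary terms in the integration by parts which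
  shows that the third order operator annihilating products of solutions is skew-adjoint.\<close>
lemma \<mu>_recurrence:
  "real n ^ 3 * \<mu> (n - 1) - (2 * real n + 1) * ((real n)\<^sup>2 + real n + 2 * q) * \<mu> n
    + (real n + 1) * ((real n)\<^sup>2 + 2 * real n + 4 * q) * \<mu> (n + 1) = 0"
proof -
  define G where "G k = (real k)\<^sup>2 * b k * ((2 * real k + 3 * real n + 2) * M (n + k) - (2 * real k + 3 * real n) * M (n + k - 1))" for k
  define T where "T k = real n ^ 3 * (b k * M (n - 1 + k)) - (2 * real n + 1) * ((real n)\<^sup>2 + real n + 2 * q) * (b k * M (n + k))
    + (real n + 1) * ((real n)\<^sup>2 + 2 * real n + 4 * q) * (b k * M (n + 1 + k))" for k
  \<comment> \<open>The difference of the two sides is b (n - 2 k) times the sum of two instances of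
    \<open>M_Suc\<close>, each written with right-hand side zero.\<close>
  have alg: "n ^ 3 * (b * X) - (2 * n + 1) * (n\<^sup>2 + n + 2 * q) * (b * Y) + (n + 1) * (n\<^sup>2 + 2 * n + 4 * q) * (b * Z)
    = b * (k\<^sup>2 + k + q) * ((2 * k + 3 * n + 4) * Z - (2 * k + 3 * n + 2) * Y) - k\<^sup>2 * b * ((2 * k + 3 * n + 2) * Y - (2 * k + 3 * n) * X)"
    if X: "(n - 2 * k) * ((n + k)\<^sup>2 * X) = (n - 2 * k) * (((n + k)\<^sup>2 + (n + k) + q) * Y)"
     and Z: "((n + k + 1)\<^sup>2 + (n + k + 1) + q) * Z = (n + k + 1)\<^sup>2 * Y"
    for n k b X Y Z :: real
  proof -
    have "n ^ 3 * (b * X) - (2 * n + 1) * (n\<^sup>2 + n + 2 * q) * (b * Y) + (n + 1) * (n\<^sup>2 + 2 * n + 4 * q) * (b * Z)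
     - (b * (k\<^sup>2 + k + q) * ((2 * k + 3 * n + 4) * Z - (2 * k + 3 * n + 2) * Y) - k\<^sup>2 * b * ((2 * k + 3 * n + 2) * Y - (2 * k + 3 * n) * X))
     = b * ((n - 2 * k) * ((n + k)\<^sup>2 * X) - (n - 2 * k) * (((n + k)\<^sup>2 + (n + k) + q) * Y))
      + b * (n - 2 * k) * (((n + k + 1)\<^sup>2 + (n + k + 1) + q) * Z - (n + k + 1)\<^sup>2 * Y)"
      by (simp add: power2_eq_square power3_eq_cube algebra_simps)
    also have "\<dots> = 0" unfolding X Z by simp
    finally show ?thesis by simp
  qed
  have T: "T k = G (Suc k) - G k" for k
  proof -
    \<comment> \<open>The factor n - 2 k is kept because it vanishes for n = k = 0, the one case in
      which \<open>M (n + k)\<close> has no predecessor.\<close>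
    have X: "(real n - 2 * real k) * ((real n + real k)\<^sup>2 * M (n + k - 1)) = (real n - 2 * real k) * (((real n + real k)\<^sup>2 + (real n + real k) + q) * M (n + k))"
    proof (cases "n + k")
      case (Suc N)
      then have e: "real n + real k = real N + 1" by linarith
      show ?thesis unfolding e Suc using M_Suc[of N] by simp
    qed simp
    have Z: "((real n + real k + 1)\<^sup>2 + (real n + real k + 1) + q) * M (n + k + 1) = (real n + real k + 1)\<^sup>2 * M (n + k)"
      using M_Suc[of "n + k"] by simp
    \<comment> \<open>The two truncated subtractions differ only for n = 0, where n^3
      vanishes.\<close>
    have t: "real n ^ 3 * (b k * M (n - 1 + k)) = real n ^ 3 * (b k * M (n + k - 1))" by (cases n) auto
    have g: "G (Suc k) = ((real k + 1)\<^sup>2 * b (Suc k)) * ((2 * real k + 3 * real n + 4) * M (n + k + 1) - (2 * real k + 3 * real n + 2) * M (n + k))"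
      by (simp add: G_def algebra_simps)
    show ?thesis unfolding T_def t g b_Suc_mult using alg[OF X Z, of "b k"] by (simp add: G_def)
  qed
  have "G \<longlonglongrightarrow> 0"
  proof -
    define r where "r k = (real n + real k)" for k
    \<comment> \<open>The first two factors have the finite limits \<open>\<beta>\<close> and 1. In
      the last one, \<open>M_Suc\<close> has been used to express the predecessor, and the leading
      terms 2 - 2 cancel.\<close>
    have "(\<lambda>k. (real k * b k) * (real (k + n) * M (k + n)) * (real k / r k * ((2 * real k + 3 * real n + 2) - (2 * real k + 3 * real n) * ((r k)\<^sup>2 + r k + q) / (r k)\<^sup>2))) \<longlonglongrightarrow> \<beta> * 1 * 0"
      unfolding r_def by (intro tendsto_mult k_b_tendsto LIMSEQ_ignore_initial_segment[OF n_M_tendsto, of n]) real_asymp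
    moreover have "\<forall>\<^sub>F k in sequentially. (real k * b k) * (real (k + n) * M (k + n)) * (real k / r k * ((2 * real k + 3 * real n + 2) - (2 * real k + 3 * real n) * ((r k)\<^sup>2 + r k + q) / (r k)\<^sup>2)) = G k"
      using eventually_gt_at_top[of 0]
    proof eventually_elim
      case (elim k)
      then obtain N where N: "n + k = Suc N" by (metis add_is_0 not0_implies_Suc not_gr_zero)
      then have rN: "r k = real N + 1" unfolding r_def by linarith
      have r: "r k > 0" using rN by simp
      have "(r k)\<^sup>2 * M (n + k - 1) = ((r k)\<^sup>2 + r k + q) * M (n + k)"
        unfolding rN using M_Suc[of N] N by simp
      then have X: "M (n + k - 1) = ((r k)\<^sup>2 + r k + q) * M (n + k) / (r k)\<^sup>2" using r by (simp add: field_simps)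
      have e: "real (k + n) * M (k + n) = r k * M (n + k)" by (simp add: r_def add.commute)
      show ?case unfolding G_def X e using r by (simp add: divide_simps) (simp add: algebra_simps power2_eq_square)
    qed
    ultimately show ?thesis by (auto intro: Lim_transform_eventually)
  qed
  then have "(\<lambda>k. G (Suc k) - G k) sums (0 - G 0)" by (rule telescope_sums)
  then have "T sums 0" unfolding T[symmetric] by (simp add: G_def)
  moreover have "T sums (real n ^ 3 * \<mu> (n - 1) - (2 * real n + 1) * ((real n)\<^sup>2 + real n + 2 * q) * \<mu> n
    + (real n + 1) * ((real n)\<^sup>2 + 2 * real n + 4 * q) * \<mu> (n + 1))"
    unfolding T_def by (intro sums_add sums_diff sums_mult \<mu>_sums)
  ultimately show ?thesis using sums_unique2 by blast
qed

end

section \<open>Beta integrals and shifted Legendre polynomials\<close>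

lemma has_integral_suminf_nonneg:
  fixes f :: "nat \<Rightarrow> real \<Rightarrow> real"
  assumes f: "\<And>k. (f k has_integral c k) S" and pos: "\<And>k x. x \<in> S \<Longrightarrow> 0 \<le> f k x"
    and g: "\<And>x. x \<in> S \<Longrightarrow> (\<lambda>k. f k x) sums g x" and s: "c sums s"
  shows "(g has_integral s) S"
proof (rule has_integral_monotone_convergence_increasing)
  show "((\<lambda>x. \<Sum>k<n. f k x) has_integral (\<Sum>k<n. c k)) S" for n
    by (intro has_integral_sum f) simp
  show "(\<Sum>k<n. f k x) \<le> (\<Sum>k<Suc n. f k x)" if "x \<in> S" for n x
    using pos[OF that, of n] by simp
  show "(\<lambda>n. \<Sum>k<n. f k x) \<longlonglongrightarrow> g x" if "x \<in> S" for x
    using g[OF that] by (simp add: sums_def)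
  show "(\<lambda>n. \<Sum>k<n. c k) \<longlonglongrightarrow> s" using s by (simp add: sums_def)
qed

lemma has_integral_power_mult_power:
  "((\<lambda>x. x ^ n * (1 - x) ^ k) has_integral fact n * fact k / fact (n + k + 1)) {0<..<1::real}"
proof -
  have "((\<lambda>t. t powr (real (n+1) - 1) * (1 - t) powr (real (k+1) - 1)) has_integral Beta (real (n+1)) (real (k+1))) {0..1}"
    by (intro has_integral_Beta_real) auto
  then have "((\<lambda>t. t powr (real (n+1) - 1) * (1 - t) powr (real (k+1) - 1)) has_integral Beta (real (n+1)) (real (k+1))) {0<..<1}"
    by (simp add: has_integral_Icc_iff_Ioo)
  moreover have "Beta (real (n+1)) (real (k+1)) = fact n * fact k / fact (n + k + 1)"
    using Gamma_fact[of n, where 'a = real] Gamma_fact[of k, where 'a = real] Gamma_fact[of "n+k+1", where 'a = real]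
    by (simp add: Beta_def add_ac)
  ultimately have "((\<lambda>t. t powr (real (n+1) - 1) * (1 - t) powr (real (k+1) - 1)) has_integral fact n * fact k / fact (n + k + 1)) {0<..<1}"
    by (simp only:)
  \<comment> \<open>The open interval matters: at an endpoint 0 powr 0 is 0, whereas 0 ^ 0 is
    1.\<close>
  then show ?thesis by (rule has_integral_eq[rotated]) (auto simp: powr_realpow)
qed

definition shifted_legendre :: "nat \<Rightarrow> real poly" where
  "shifted_legendre n = pcompose (legendre n) [:-1, 2:]"

lemma poly_shifted_legendre: "poly (shifted_legendre n) x = poly (legendre n) (2 * x - 1)"
  by (simp add: shifted_legendre_def poly_pcompose algebra_simps)

lemma pderiv_shifted_legendre: "poly (pderiv (shifted_legendre n)) x = 2 * poly (pderiv (legendre n)) (2 * x - 1)"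
  by (simp add: shifted_legendre_def pderiv_pcompose pderiv_pCons poly_pcompose algebra_simps)

lemma quadratic_mult_pderiv_shifted_legendre:
  "[:0,1,-1:] * pderiv (shifted_legendre n) =
     smult (real n * (real n + 1) / (2 * (2 * real n + 1))) (shifted_legendre (n - 1) - shifted_legendre (n + 1))"
proof -
  have "x * (1 - x) * (2 * poly (pderiv (legendre n)) (2 * x - 1)) =
     real n * (real n + 1) / (2 * (2 * real n + 1)) * (poly (legendre (n - 1)) (2 * x - 1) - poly (legendre (n + 1)) (2 * x - 1))" for x
  proof -
    define t where "t = 2 * x - 1"
    define L where "L = (1 - t\<^sup>2) * poly (pderiv (legendre n)) t"
    have n: "2 * real n + 1 \<noteq> 0" by (simp add: add_nonneg_eq_0_iff)
    have "x * (1 - x) = (1 - t\<^sup>2) / 4" by (simp add: t_def power2_eq_square field_simps)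
    then have 1: "x * (1 - x) * (2 * poly (pderiv (legendre n)) t) = L / 2"
      by (simp add: L_def)
    have "(2 * real n + 1) * L = (real n + 1) * ((2 * real n + 1) * (t * poly (legendre n) t) - (2 * real n + 1) * poly (legendre (Suc n)) t)"
      unfolding L_def legendre_deriv_eq by (simp add: algebra_simps)
    also have "(2 * real n + 1) * (t * poly (legendre n) t) = (real n + 1) * poly (legendre (Suc n)) t + real n * poly (legendre (n - 1)) t"
      using legendre_three_term'[of n t] by (simp add: algebra_simps)
    finally have "(2 * real n + 1) * L = real n * (real n + 1) * (poly (legendre (n - 1)) t - poly (legendre (n + 1)) t)"
      by (simp add: algebra_simps)
    then have "L = real n * (real n + 1) * (poly (legendre (n - 1)) t - poly (legendre (n + 1)) t) / (2 * real n + 1)"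
      using n by (simp add: eq_divide_eq mult.commute)
    then show ?thesis unfolding t_def[symmetric] 1 by simp
  qed
  then show ?thesis unfolding poly_eq_poly_eq_iff[symmetric]
    by (simp add: fun_eq_iff poly_shifted_legendre pderiv_shifted_legendre algebra_simps)
qed

lemma shifted_legendre_ode:
  "pderiv ([:0,1,-1:] * pderiv (shifted_legendre n)) = smult (- (real n * (real n + 1))) (shifted_legendre n)"
proof -
  have "poly (pderiv ([:0,1,-1:] * pderiv (shifted_legendre n))) x = - (real n * (real n + 1)) * poly (legendre n) (2 * x - 1)" for x
  proof (rule DERIV_unique)
    show "(poly ([:0,1,-1:] * pderiv (shifted_legendre n)) has_field_derivative poly (pderiv ([:0,1,-1:] * pderiv (shifted_legendre n))) x) (at x)"
      by (rule poly_DERIV)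
    have "((\<lambda>x. 1/2 * ((1 - (2*x-1)\<^sup>2) * poly (pderiv (legendre n)) (2*x-1))) has_field_derivative 1/2 * ((- real n * real (Suc n) * poly (legendre n) (2*x-1)) * 2)) (at x)"
      by (rule DERIV_cmult, rule DERIV_chain2[where f = "\<lambda>t. (1 - t\<^sup>2) * poly (pderiv (legendre n)) t", OF legendre_ode_deriv])
         (auto intro!: derivative_eq_intros)
    moreover have "(\<lambda>x. 1/2 * ((1 - (2*x-1)\<^sup>2) * poly (pderiv (legendre n)) (2*x-1))) = poly ([:0,1,-1:] * pderiv (shifted_legendre n))"
      by (auto simp: fun_eq_iff pderiv_shifted_legendre power2_eq_square algebra_simps)
    ultimately show "(poly ([:0,1,-1:] * pderiv (shifted_legendre n)) has_field_derivative - (real n * (real n + 1)) * poly (legendre n) (2 * x - 1)) (at x)"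
      by (simp add: algebra_simps)
  qed
  then show ?thesis unfolding poly_eq_poly_eq_iff[symmetric]
    by (simp add: fun_eq_iff poly_shifted_legendre)
qed

lemma linear_mult_shifted_legendre:
  "[:-1,2:] * shifted_legendre n = smult (1 / (2 * real n + 1)) (smult (real n + 1) (shifted_legendre (n + 1)) + smult (real n) (shifted_legendre (n - 1)))"
proof -
  have n: "2 * real n + 1 \<noteq> 0" by (simp add: add_nonneg_eq_0_iff)
  have "t * poly (legendre n) t = 1 / (2 * real n + 1) * ((real n + 1) * poly (legendre (n + 1)) t + real n * poly (legendre (n - 1)) t)" for t
    using legendre_three_term'[of n t] n by (simp add: divide_simps) (simp add: algebra_simps)
  from this[of "2 * _ - 1"] show ?thesis unfolding poly_eq_poly_eq_iff[symmetric]
    by (simp add: fun_eq_iff poly_shifted_legendre algebra_simps)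
qed

section \<open>The moment functional of W and the recurrence for its Legendre coefficients\<close>

context hypergeometric_square
begin

definition u :: "real \<Rightarrow> real" where "u x = (\<Sum>k. b k * x ^ k)"

definition W :: "real \<Rightarrow> real" where "W x = u x * u (1 - x)"

lemma u_sums: "0 \<le> x \<Longrightarrow> x < 1 \<Longrightarrow> (\<lambda>k. b k * x ^ k) sums u x"
  unfolding u_def
proof (rule summable_sums, rule summable_comparison_test')
  assume x: "0 \<le> x" "x < 1"
  then show "summable (\<lambda>k. x ^ k)" by simp
  show "norm (b k * x ^ k) \<le> x ^ k" if "0 \<le> k" for k
    using b_pos[of k] b_le_1[of k] x by (simp add: abs_mult mult_left_le_one_le)
qed

lemma u_nonneg: "0 \<le> x \<Longrightarrow> x < 1 \<Longrightarrow> 0 \<le> u x"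
  using sums_le[OF _ sums_zero u_sums[of x]] b_pos by (simp add: less_imp_le)

lemma has_integral_M: "((\<lambda>x. x ^ n * u (1 - x)) has_integral M n) {0<..<1}"
proof (rule has_integral_suminf_nonneg[OF _ _ _ M_sums])
  show "((\<lambda>x. b k * (x ^ n * (1 - x) ^ k)) has_integral b k * nat_beta n k) {0<..<1}" for k
    unfolding nat_beta_def by (intro has_integral_mult_right has_integral_power_mult_power)
  show "0 \<le> b k * (x ^ n * (1 - x) ^ k)" if "x \<in> {0<..<1}" for k x
    using that b_pos[of k] by simp
  show "(\<lambda>k. b k * (x ^ n * (1 - x) ^ k)) sums (x ^ n * u (1 - x))" if "x \<in> {0<..<1}" for x
    using sums_mult[OF u_sums[of "1 - x"], of "x ^ n"] that by (simp add: mult_ac)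
qed

lemma has_integral_\<mu>: "((\<lambda>x. x ^ n * W x) has_integral \<mu> n) {0<..<1}"
proof (rule has_integral_suminf_nonneg[OF _ _ _ \<mu>_sums])
  show "((\<lambda>x. b k * (x ^ (n + k) * u (1 - x))) has_integral b k * M (n + k)) {0<..<1}" for k
    by (intro has_integral_mult_right has_integral_M)
  show "0 \<le> b k * (x ^ (n + k) * u (1 - x))" if "x \<in> {0<..<1}" for k x
    using that b_pos[of k] u_nonneg[of "1 - x"] by simp
  show "(\<lambda>k. b k * (x ^ (n + k) * u (1 - x))) sums (x ^ n * W x)" if "x \<in> {0<..<1}" for x
    using sums_mult[OF u_sums[of x], of "x ^ n * u (1 - x)"] that by (simp add: W_def power_add mult_ac)
qed

text \<open>Integration against \<open>W\<close>, encoded by moments so that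
  \<open>\<mu>_recurrence\<close> applies termwise. Since the degree is not additive, linearity is
  obtained from uniqueness of the integral.\<close>

definition \<Lambda> :: "real poly \<Rightarrow> real" where
  "\<Lambda> p = (\<Sum>i\<le>degree p. coeff p i * \<mu> i)"

lemma has_integral_\<Lambda>: "((\<lambda>x. poly p x * W x) has_integral \<Lambda> p) {0<..<1}"
proof -
  have "((\<lambda>x. \<Sum>i\<le>degree p. coeff p i * (x ^ i * W x)) has_integral \<Lambda> p) {0<..<1}"
    unfolding \<Lambda>_def by (intro has_integral_sum has_integral_mult_right has_integral_\<mu>) simp
  then show ?thesis by (simp add: poly_altdef sum_distrib_right sum_distrib_left mult_ac)
qed

lemma \<Lambda>_add: "\<Lambda> (p + r) = \<Lambda> p + \<Lambda> r"
  using has_integral_unique[OF has_integral_\<Lambda>[of "p + r"]] has_integral_add[OF has_integral_\<Lambda>[of p] has_integral_\<Lambda>[of r]]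
  by (simp add: distrib_right)

lemma \<Lambda>_smult: "\<Lambda> (smult c p) = c * \<Lambda> p"
  using has_integral_unique[OF has_integral_\<Lambda>[of "smult c p"]] has_integral_mult_right[OF has_integral_\<Lambda>[of p], of c]
  by (simp add: mult.assoc)

lemma \<Lambda>_diff: "\<Lambda> (p - r) = \<Lambda> p - \<Lambda> r"
  using has_integral_unique[OF has_integral_\<Lambda>[of "p - r"]] has_integral_diff[OF has_integral_\<Lambda>[of p] has_integral_\<Lambda>[of r]]
  by (simp add: left_diff_distrib)

lemma \<Lambda>_monom: "\<Lambda> (monom c n) = c * \<mu> n"
  using has_integral_unique[OF has_integral_\<Lambda>[of "monom c n"]] has_integral_mult_right[OF has_integral_\<mu>[of n], of c]
  by (simp add: poly_monom mult.assoc)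

lemma \<Lambda>_sum: "\<Lambda> (\<Sum>i\<in>I. p i) = (\<Sum>i\<in>I. \<Lambda> (p i))"
proof -
  have [simp]: "\<Lambda> 0 = 0" using \<Lambda>_smult[of 0 0] by simp
  show ?thesis by (induction I rule: infinite_finite_induct) (simp_all add: \<Lambda>_add)
qed

text \<open>Formal adjoint of the symmetric square of (x (1 - x) y')' = q y, the third order
  operator that annihilates all products of two solutions.\<close>

definition adjoint_op :: "real poly \<Rightarrow> real poly" where
  "adjoint_op p = smult (4 * q) ([:0,1,-1:] * pderiv p) - smult (2 * q) ([:-1,2:] * p)
     - pderiv ([:0,1,-1:] * pderiv ([:0,1,-1:] * pderiv p))"

lemma adjoint_op_add: "adjoint_op (p + r) = adjoint_op p + adjoint_op r"
  by (simp only: adjoint_op_def pderiv_add distrib_left smult_add_right add_diff_add)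

lemma adjoint_op_sum: "adjoint_op (\<Sum>i\<in>I. p i) = (\<Sum>i\<in>I. adjoint_op (p i))"
proof -
  have [simp]: "adjoint_op 0 = 0" by (simp add: adjoint_op_def)
  show ?thesis by (induction I rule: infinite_finite_induct) (simp_all add: adjoint_op_add)
qed

lemma adjoint_op_monom:
  "adjoint_op (monom c n) = monom (- c * real n ^ 3) (n - 1) + monom (c * (2 * real n + 1) * ((real n)\<^sup>2 + real n + 2 * q)) n
     - monom (c * (real n + 1) * ((real n)\<^sup>2 + 2 * real n + 4 * q)) (n + 1)"
proof -
  have X: "[:0,1,-1:] * pderiv (monom c n) = monom (c * real n) n - monom (c * real n) (n + 1)" for c :: real and n
  proof (cases n)
    case (Suc k)
    show ?thesis unfolding poly_eq_poly_eq_iff[symmetric] Suc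
      by (auto simp: fun_eq_iff poly_monom pderiv_monom algebra_simps)
  qed (simp add: monom_0 pderiv_pCons)
  have d: "pderiv (monom c n) = monom (c * real n) (n - 1)" for c :: real and n
    by (simp add: pderiv_monom mult.commute)
  show ?thesis
    unfolding adjoint_op_def X pderiv_diff right_diff_distrib unfolding d poly_eq_poly_eq_iff[symmetric]
    by (cases n) (auto simp: fun_eq_iff poly_monom algebra_simps power2_eq_square power3_eq_cube)
qed

text \<open>This is the weak form of the third order equation for \<open>W\<close>. On monomials it
  is exactly \<open>\<mu>_recurrence\<close>, so no boundary behaviour of \<open>W\<close>
  enters.\<close>

lemma \<Lambda>_adjoint_op: "\<Lambda> (adjoint_op p) = 0"
proof -
  have m: "\<Lambda> (adjoint_op (monom c n)) = 0" for c n
  proof -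
    have "\<Lambda> (adjoint_op (monom c n)) = - c * (real n ^ 3 * \<mu> (n - 1) - (2 * real n + 1) * ((real n)\<^sup>2 + real n + 2 * q) * \<mu> n
    + (real n + 1) * ((real n)\<^sup>2 + 2 * real n + 4 * q) * \<mu> (n + 1))"
      unfolding adjoint_op_monom \<Lambda>_add \<Lambda>_diff \<Lambda>_monom by (simp add: algebra_simps)
    then show ?thesis unfolding \<mu>_recurrence by simp
  qed
  have "\<Lambda> (adjoint_op (\<Sum>i\<le>degree p. monom (coeff p i) i)) = 0"
    unfolding adjoint_op_sum \<Lambda>_sum m by simp
  then show ?thesis by (simp add: poly_as_sum_of_monoms)
qed

definition w :: "nat \<Rightarrow> real" where "w n = \<Lambda> (shifted_legendre n)"

text \<open>Test the weak equation with the polynomial of degree n. Each of the three parts of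
  \<open>adjoint_op\<close> maps it to a combination of the degrees n - 1 and n + 1, so only two
  coefficients remain.\<close>

lemma w_recurrence:
  "(real n + 1)\<^sup>2 * (real n * (real n + 2) + 4 * q) * w (n + 1) = (real n)\<^sup>2 * ((real n)\<^sup>2 - 1 + 4 * q) * w (n - 1)"
proof -
  have n: "2 * real n + 1 \<noteq> 0" by (simp add: add_nonneg_eq_0_iff)
  define c where "c = real n * (real n + 1) / (2 * (2 * real n + 1))"
  define d where "d = 1 / (2 * real n + 1)"
  have cd: "c = real n * (real n + 1) * d / 2" by (simp add: c_def d_def)
  have d: "d \<noteq> 0" using n by (simp add: d_def)
  \<comment> \<open>Covers n = 0, where the truncated predecessor is 0 and not -1; both sides
    vanish.\<close>
  have n1: "real (n - 1) * (real (n - 1) + 1) * c = (real n - 1) * real n * c"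
    by (cases n) (simp_all add: c_def)
  have "0 = 4 * q * (c * (w (n - 1) - w (n + 1))) - 2 * q * (d * ((real n + 1) * w (n + 1) + real n * w (n - 1)))
     - c * (- (real (n - 1) * (real (n - 1) + 1)) * w (n - 1) - - (real (n + 1) * (real (n + 1) + 1)) * w (n + 1))"
  proof -
    have "pderiv ([:0,1,-1:] * pderiv (smult c (p - r))) = smult c (pderiv ([:0,1,-1:] * pderiv p) - pderiv ([:0,1,-1:] * pderiv r))" for p r :: "real poly"
      by (simp only: pderiv_smult pderiv_diff mult_smult_right right_diff_distrib)
    then show ?thesis
      using \<Lambda>_adjoint_op[of "shifted_legendre n"]
      unfolding adjoint_op_def quadratic_mult_pderiv_shifted_legendre[of n] c_def[symmetric] linear_mult_shifted_legendre d_def[symmetric]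
      by (simp only: shifted_legendre_ode \<Lambda>_diff \<Lambda>_smult \<Lambda>_add w_def)
  qed
  also have "\<dots> = 4 * q * (c * (w (n - 1) - w (n + 1))) - 2 * q * (d * ((real n + 1) * w (n + 1) + real n * w (n - 1)))
     + (real (n - 1) * (real (n - 1) + 1) * c) * w (n - 1) - c * ((real n + 1) * (real n + 2)) * w (n + 1)"
    by (simp add: algebra_simps)
  also have "\<dots> = d / 2 * ((real n)\<^sup>2 * ((real n)\<^sup>2 - 1 + 4 * q) * w (n - 1) - (real n + 1)\<^sup>2 * (real n * (real n + 2) + 4 * q) * w (n + 1))"
    unfolding n1 unfolding cd by (simp add: field_simps power2_eq_square)
  finally show ?thesis using d by simp
qed

text \<open>In Pochhammer symbols, (a)_m (1 - a)_m / ((a + 1/2)_m (3/2 - a)_m); by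
  \<open>R_eq\<close> it equals the Gamma quotient of part (i) divided by its value at m =
  0.\<close>

definition \<rho> :: "nat \<Rightarrow> real" where
  "\<rho> m = (\<Prod>j<m. ((real j)\<^sup>2 + real j + q) / ((real j)\<^sup>2 + 2 * real j + 3/4 + q))"

lemma w_0: "w 0 = \<mu> 0"
proof -
  have "shifted_legendre 0 = monom 1 0" by (simp add: shifted_legendre_def pcompose_1)
  then show ?thesis using \<Lambda>_monom[of 1 0] by (simp add: w_def)
qed

text \<open>The factor n^2 at n = 0 kills degree 1, and the recurrence propagates the zero because q
  > 0 keeps its leading factor nonzero. This reflects the symmetry of \<open>W\<close> under x -> 1
  - x.\<close>

lemma w_odd: "w (2 * m + 1) = 0"
proof (induction m)
  case 0
  then show ?case using w_recurrence[of 0] q_pos by simp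
next
  case (Suc m)
  have "(real (2*m+2) + 1)\<^sup>2 * (real (2*m+2) * (real (2*m+2) + 2) + 4 * q) * w (2*m+2 + 1) = 0"
    using w_recurrence[of "2*m+2"] Suc by simp
  moreover have "(real (2*m+2) + 1)\<^sup>2 * (real (2*m+2) * (real (2*m+2) + 2) + 4 * q) \<noteq> 0"
    using q_pos by (intro no_zero_divisors) (auto simp: add_nonneg_eq_0_iff)
  ultimately have "w (2*m+2+1) = 0" by (metis mult_eq_0_iff)
  then show ?case by simp
qed

text \<open>For n = 2 m + 1 the factors n (n + 2) + 4 q and n^2 - 1 + 4 q are four times the
  denominator and the numerator in \<open>\<rho>\<close>; the squares produce the binomial
  factor.\<close>

lemma w_even: "w (2 * m) = \<mu> 0 * (ncbinom m)\<^sup>2 * \<rho> m"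
proof (induction m)
  case 0
  then show ?case by (simp add: w_0 \<rho>_def)
next
  case (Suc m)
  have quot: "y' = y * (B / A)\<^sup>2 * (E / D)" if "A \<noteq> 0" "D > 0" "A\<^sup>2 * (4 * D) * y' = B\<^sup>2 * (4 * E) * y" for A B D E y y' :: real
    using that by (simp add: field_simps)
  have "w (2 * Suc m) = w (2 * m) * ((2 * real m + 1) / (2 * real m + 2))\<^sup>2 * (((real m)\<^sup>2 + real m + q) / ((real m)\<^sup>2 + 2 * real m + 3/4 + q))"
  proof (rule quot)
    show "(2 * real m + 2)\<^sup>2 * (4 * ((real m)\<^sup>2 + 2 * real m + 3/4 + q)) * w (2 * Suc m) = (2 * real m + 1)\<^sup>2 * (4 * ((real m)\<^sup>2 + real m + q)) * w (2 * m)"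
      using w_recurrence[of "2*m+1"] by (simp add: power2_eq_square algebra_simps)
    show "(real m)\<^sup>2 + 2 * real m + 3/4 + q > 0" using q_pos by (simp add: add_nonneg_pos)
  qed (simp add: add_nonneg_eq_0_iff)
  then show ?case unfolding Suc.IH ncbinom_Suc by (simp add: \<rho>_def power_mult_distrib power_divide)
qed

end

section \<open>The Legendre expansion\<close>

lemma ncbinom_cube_le: "ncbinom m ^ 3 \<le> real (Suc m) powr (-3/2)"
proof -
  have "(ncbinom m)\<^sup>2 \<le> 1 / (2 * real m + 1)" by (rule ncbinom_sq_le)
  also have "\<dots> \<le> 1 / real (Suc m)" by (simp add: divide_simps)
  also have "\<dots> = (real (Suc m) powr (-1/2))\<^sup>2"
    by (simp add: powr_power powr_minus divide_simps)
  finally have "ncbinom m \<le> real (Suc m) powr (-1/2)"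
    by (rule power2_le_imp_le) simp
  then have "ncbinom m ^ 3 \<le> (real (Suc m) powr (-1/2)) ^ 3"
    using ncbinom_pos[of m] by (intro power_mono) auto
  also have "\<dots> = real (Suc m) powr (-3/2)" by (simp add: powr_power)
  finally show ?thesis .
qed

lemma summable_ncbinom_cube: "summable (\<lambda>m. ncbinom m ^ 3)"
proof (rule summable_comparison_test')
  show "summable (\<lambda>m. real (Suc m) powr (-3/2))"
    using summable_Suc_iff[of "\<lambda>m. real m powr (-3/2)"] summable_real_powr_iff[of "-3/2"] by simp
  show "norm (ncbinom m ^ 3) \<le> real (Suc m) powr (-3/2)" if "0 \<le> m" for m
    using ncbinom_cube_le[of m] ncbinom_pos[of m] by simp
qed

text \<open>With t = 2 x - 1 the weight x (1 - x) is a quarter of 1 - t^2, which on [-1, 1] is at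
  most (1 - t^2)^(1/4), the weight in Sonin's bound.\<close>

lemma legendre_even_weighted_bound:
  assumes "x \<in> {0..1}"
  shows "\<bar>x * (1 - x) * poly (legendre (2*m)) (2 * x - 1)\<bar> \<le> ncbinom m"
proof -
  define t where "t = 2 * x - 1"
  define P where "P = poly (legendre (2*m)) t"
  have t: "\<bar>t\<bar> \<le> 1" using assms by (auto simp: t_def abs_le_iff)
  then have t2: "t\<^sup>2 \<le> 1" by (simp add: abs_square_le_1)
  have "((1 - t\<^sup>2) * P)\<^sup>2 = (1 - t\<^sup>2)\<^sup>2 * P\<^sup>2" by (simp add: power_mult_distrib)
  also have "(1 - t\<^sup>2)\<^sup>2 \<le> sqrt (1 - t\<^sup>2)"
  proof (rule real_le_rsqrt)
    have "((1 - t\<^sup>2)\<^sup>2)\<^sup>2 = (1 - t\<^sup>2) * (1 - t\<^sup>2) ^ 3" by (simp add: power2_eq_square power3_eq_cube)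
    also have "\<dots> \<le> (1 - t\<^sup>2) * 1" using t2 by (intro mult_left_mono power_le_one) auto
    finally show "((1 - t\<^sup>2)\<^sup>2)\<^sup>2 \<le> 1 - t\<^sup>2" by simp
  qed
  then have "(1 - t\<^sup>2)\<^sup>2 * P\<^sup>2 \<le> sqrt (1 - t\<^sup>2) * P\<^sup>2" by (intro mult_right_mono) auto
  also have "\<dots> \<le> (ncbinom m)\<^sup>2" unfolding P_def by (rule legendre_even_bound[OF t])
  finally have "\<bar>(1 - t\<^sup>2) * P\<bar> \<le> ncbinom m" using ncbinom_pos[of m] abs_le_square_iff[of "(1 - t\<^sup>2) * P" "ncbinom m"] by simp
  moreover have "x * (1 - x) = (1 - t\<^sup>2) / 4" by (simp add: t_def power2_eq_square field_simps)
  then have "x * (1 - x) * P = ((1 - t\<^sup>2) * P) / 4" by (simp only: times_divide_eq_left)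
  ultimately show ?thesis unfolding t_def[symmetric] P_def[symmetric] by linarith
qed

section \<open>Moments of the Legendre series and comparison with those of W\<close>

definition legendre_moment :: "nat \<Rightarrow> real poly \<Rightarrow> real" where
  "legendre_moment m p = integral {0..1} (\<lambda>x. poly (legendre (2*m)) (2 * x - 1) * poly p x)"

lemma has_integral_legendre_moment: "((\<lambda>x. poly (legendre (2*m)) (2 * x - 1) * poly p x) has_integral legendre_moment m p) {0..1}"
  unfolding legendre_moment_def by (intro integrable_integral integrable_continuous_interval continuous_intros)

lemma legendre_moment_add: "legendre_moment m (p + r) = legendre_moment m p + legendre_moment m r"
  using has_integral_unique[OF has_integral_legendre_moment[of m "p + r"]] has_integral_add[OF has_integral_legendre_moment[of m p] has_integral_legendre_moment[of m r]]
  by (simp add: distrib_left)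

lemma legendre_moment_smult: "legendre_moment m (smult c p) = c * legendre_moment m p"
  using has_integral_unique[OF has_integral_legendre_moment[of m "smult c p"]] has_integral_mult_right[OF has_integral_legendre_moment[of m p], of c]
  by (simp add: mult_ac)

lemma legendre_moment_shifted_legendre: "legendre_moment m (shifted_legendre n) = (if n = 2 * m then 1 / (4 * real m + 1) else 0)"
proof (cases "n = 2 * m")
  case True
  then show ?thesis using has_integral_unique[OF has_integral_legendre_moment[of m "shifted_legendre n"]] legendre_norm[of n]
    by (simp add: poly_shifted_legendre power2_eq_square)
next
  case False
  then show ?thesis using has_integral_unique[OF has_integral_legendre_moment[of m "shifted_legendre n"]] legendre_orthogonal[of "2*m" n]
    by (simp add: poly_shifted_legendre)
qed

context hypergeometric_square
begin

lemma b_tendsto_0: "b \<longlonglongrightarrow> 0"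
proof (rule tendsto_sandwich[of "\<lambda>_. 0"])
  show "(\<lambda>k. 1 / (real k + 1)) \<longlonglongrightarrow> 0" by real_asymp
qed (use b_le b_pos in \<open>auto intro!: always_eventually simp: less_imp_le\<close>)

text \<open>Taylor coefficients of (1 - x) u(x). They are absolutely summable because
  \<open>b\<close> decreases to 0.\<close>

definition d :: "nat \<Rightarrow> real" where "d k = (case k of 0 \<Rightarrow> 1 | Suc j \<Rightarrow> b (Suc j) - b j)"

text \<open>\<open>v\<close> is the continuous extension of \<open>(1 - x) u(x)\<close> to the singular endpoint \<open>x = 1\<close>.\<close>
definition v :: "real \<Rightarrow> real" where "v x = (\<Sum>k. d k * x ^ k)"

lemma summable_d: "summable (\<lambda>k. \<bar>d k\<bar>)"
proof -
  have "summable (\<lambda>k. b k - b (Suc k))"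
    using telescope_sums'[OF b_tendsto_0] by (rule sums_summable)
  then have "summable (\<lambda>k. \<bar>d (Suc k)\<bar>)"
    using b_Suc_le by (simp add: d_def abs_of_nonpos)
  then show ?thesis using summable_Suc_iff[of "\<lambda>k. \<bar>d k\<bar>"] by blast
qed

lemma continuous_on_v: "continuous_on {0..1} v"
  unfolding v_def
proof (rule continuous_on_suminf_M_test[OF _ _ summable_d])
  show "\<bar>d k * x ^ k\<bar> \<le> \<bar>d k\<bar>" if "x \<in> {0..1}" for k x
    using that by (simp add: abs_mult power_abs[symmetric] mult_left_le power_le_one)
qed (intro continuous_intros)

lemma v_eq: "0 \<le> x \<Longrightarrow> x < 1 \<Longrightarrow> v x = (1 - x) * u x"
proof -
  assume x: "0 \<le> x" "x < 1"
  have "(\<lambda>k. b (Suc k) * x ^ Suc k - x * (b k * x ^ k)) sums ((u x - 1) - x * u x)"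
    using u_sums[OF x] sums_Suc_iff[of "\<lambda>k. b k * x ^ k" "u x - 1"] by (intro sums_diff sums_mult) simp_all
  then have "(\<lambda>k. d (Suc k) * x ^ Suc k) sums ((u x - 1) - x * u x)"
    by (simp add: d_def algebra_simps)
  then have "(\<lambda>k. d k * x ^ k) sums ((u x - 1) - x * u x + d 0 * x ^ 0)"
    by (rule sums_Suc)
  then show ?thesis unfolding v_def by (simp add: sums_iff d_def algebra_simps)
qed

text \<open>The factor 4 m + 1 is the reciprocal of the squared norm in degree 2 m, so this is the
  Fourier-Legendre coefficient of \<open>W\<close>.\<close>

definition s :: "nat \<Rightarrow> real" where "s m = (4 * real m + 1) * w (2 * m)"

lemma \<mu>_0_pos: "\<mu> 0 > 0"
  unfolding \<mu>_def by (intro suminf_pos summable_\<mu>) (simp add: b_pos M_pos)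

text \<open>The decay 1 / (m + 1) compensates the growth of 4 m + 1 in \<open>s\<close>.\<close>

lemma \<rho>_bounds: "0 < \<rho> m \<and> \<rho> m \<le> 1 / (real m + 1)"
proof (induction m)
  case (Suc m)
  let ?A = "(real m)\<^sup>2 + real m + q" and ?B = "(real m)\<^sup>2 + 2 * real m + 3/4 + q"
  have pos: "?A > 0" "?B > 0" using q_pos by (simp_all add: add_nonneg_pos)
  have "?A * (real m + 2) \<le> (real m + 1) * ?B"
    using q_le by (simp add: power2_eq_square algebra_simps)
  then have "?A / ?B \<le> (real m + 1) / (real m + 2)" using pos
    by (simp only: pos_divide_le_eq times_divide_eq_left) (subst pos_le_divide_eq, auto)
  then have "\<rho> m * (?A / ?B) \<le> 1 / (real m + 1) * ((real m + 1) / (real m + 2))"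
    using Suc pos by (intro mult_mono) auto
  then show ?case using Suc pos by (simp add: \<rho>_def add.commute)
qed (simp add: \<rho>_def)

lemma weighted_term_bound:
  assumes "x \<in> {0..1}"
  shows "\<bar>s m * (x * (1 - x) * poly (legendre (2*m)) (2 * x - 1))\<bar> \<le> 4 * \<mu> 0 * ncbinom m ^ 3"
proof -
  have "\<bar>s m\<bar> = \<mu> 0 * (ncbinom m)\<^sup>2 * ((4 * real m + 1) * \<rho> m)"
    using \<mu>_0_pos \<rho>_bounds[of m] by (simp add: s_def w_even abs_mult)
  also have "(4 * real m + 1) * \<rho> m \<le> (4 * real m + 1) * (1 / (real m + 1))"
    using \<rho>_bounds[of m] by (intro mult_left_mono) auto
  also have "\<dots> \<le> 4" by (simp add: divide_simps)
  finally have "\<bar>s m\<bar> \<le> \<mu> 0 * (ncbinom m)\<^sup>2 * 4" using \<mu>_0_pos by (simp add: mult_left_mono)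
  then have "\<bar>s m\<bar> * \<bar>x * (1 - x) * poly (legendre (2*m)) (2 * x - 1)\<bar> \<le> (\<mu> 0 * (ncbinom m)\<^sup>2 * 4) * ncbinom m"
    using \<mu>_0_pos by (intro mult_mono legendre_even_weighted_bound assms) auto
  then show ?thesis by (simp add: abs_mult power2_eq_square power3_eq_cube mult_ac)
qed

text \<open>Says that integrating the Legendre series termwise against p gives the same value as
  integrating \<open>W\<close> against p.\<close>

definition legendre_expandable :: "real poly \<Rightarrow> bool" where "legendre_expandable p \<longleftrightarrow> (\<lambda>m. s m * legendre_moment m p) sums \<Lambda> p"

lemma legendre_expandable_add: "legendre_expandable p \<Longrightarrow> legendre_expandable r \<Longrightarrow> legendre_expandable (p + r)"
  unfolding legendre_expandable_def using sums_add[of "\<lambda>m. s m * legendre_moment m p" "\<Lambda> p" "\<lambda>m. s m * legendre_moment m r" "\<Lambda> r"]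
  by (simp add: legendre_moment_add \<Lambda>_add distrib_left)

lemma legendre_expandable_smult: "legendre_expandable p \<Longrightarrow> legendre_expandable (smult c p)"
  unfolding legendre_expandable_def using sums_mult[of "\<lambda>m. s m * legendre_moment m p" "\<Lambda> p" c]
  by (simp add: legendre_moment_smult \<Lambda>_smult mult_ac)

lemma legendre_expandable_shifted_legendre: "legendre_expandable (shifted_legendre n)"
proof (cases "even n")
  case True
  then obtain k where k: "n = 2 * k" by blast
  have "s m * legendre_moment m (shifted_legendre n) = (if m = k then w (2 * m) else 0)" for m
    using k by (auto simp: legendre_moment_shifted_legendre s_def add_nonneg_eq_0_iff)
  then show ?thesis unfolding legendre_expandable_def using sums_single[of k "\<lambda>m. w (2 * m)"] by (simp add: w_def k)
next
  case False
  then obtain k where k: "n = 2 * k + 1" by (rule oddE)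
  then have "n \<noteq> 2 * m" for m by presburger
  moreover have "\<Lambda> (shifted_legendre n) = 0" using w_odd[of k] k by (simp add: w_def)
  ultimately show ?thesis unfolding legendre_expandable_def by (simp add: legendre_moment_shifted_legendre)
qed

text \<open>Shifted Legendre polynomials span all polynomials. The induction runs over polynomials
  in 2 x - 1 times an arbitrary shifted Legendre polynomial, because the three-term recurrence
  changes k when a factor 2 x - 1 is absorbed.\<close>

lemma legendre_expandable_poly: "legendre_expandable p"
proof -
  have *: "legendre_expandable (pcompose r [:-1,2:] * shifted_legendre k)" for r k
  proof (induction r arbitrary: k)
    case 0
    have "legendre_expandable (0::real poly)" using legendre_expandable_smult[OF legendre_expandable_shifted_legendre[of 0], of 0] by simp
    then show ?case by simp
  next
    case (pCons c r)
    define R where "R = pcompose r [:-1,2::real:]"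
    have "pcompose (pCons c r) [:-1,2:] * shifted_legendre k = smult c (shifted_legendre k) + R * ([:-1,2:] * shifted_legendre k)"
      unfolding pcompose_pCons R_def[symmetric] by (simp only: distrib_right mult.assoc mult.left_commute mult_smult_left mult_1_left) simp
    also have "\<dots> = smult c (shifted_legendre k) + smult (1 / (2 * real k + 1))
        (smult (real k + 1) (R * shifted_legendre (k + 1)) + smult (real k) (R * shifted_legendre (k - 1)))"
      unfolding linear_mult_shifted_legendre by (simp only: mult_smult_right distrib_left)
    finally show ?case
      using pCons.IH[of "k+1"] pCons.IH[of "k-1"] by (simp add: legendre_expandable_add legendre_expandable_smult legendre_expandable_shifted_legendre R_def)
  qed
  have "shifted_legendre 0 = 1" by (simp add: shifted_legendre_def pcompose_1)
  \<comment> \<open>The inverse substitution x = (1 + t) / 2 writes p as a polynomial in t = 2 x -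
    1.\<close>
  moreover have "pcompose (pcompose p [:1/2,1/2:]) [:-1,2:] = p"
    by (simp add: pcompose_assoc[symmetric] pcompose_pCons pcompose_idR)
  ultimately show ?thesis using *[of "pcompose p [:1/2,1/2:]" 0] by simp
qed

text \<open>\<open>W\<close> is unbounded at the endpoints, so both sides are multiplied by x (1 -
  x). This yields two continuous functions on [0, 1] with equal moments; the weight is divided out
  again at interior points.\<close>

theorem W_expansion:
  assumes x: "0 < x" "x < 1"
  shows "(\<lambda>m. s m * poly (legendre (2*m)) (2 * x - 1)) sums W x"
proof -
  define e where "e m x = s m * (x * (1 - x) * poly (legendre (2*m)) (2 * x - 1))" for m x
  define C where "C m = 4 * \<mu> 0 * ncbinom m ^ 3" for m
  have C: "summable C" unfolding C_def by (intro summable_mult summable_ncbinom_cube)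
  have e_le: "\<bar>e m x\<bar> \<le> C m" if "x \<in> {0..1}" for m x
    using weighted_term_bound[OF that] by (simp add: e_def C_def)
  have e_cont: "continuous_on {0..1} (e m)" for m
    unfolding e_def by (intro continuous_intros)
  define g where "g = (\<lambda>x. v x * v (1 - x) - (\<Sum>m. e m x))"
  have v_cont: "continuous_on {0..1} (\<lambda>x. v (1 - x))"
    by (rule continuous_on_compose2[OF continuous_on_v]) (auto intro!: continuous_intros)
  have vv: "v y * v (1 - y) = y * (1 - y) * W y" if "0 < y" "y < 1" for y
    using that v_eq[of y] v_eq[of "1 - y"] by (simp add: W_def)
  have "g x = 0"
  proof (rule continuous_on_zero_moments_imp_zero[of g x])
    show "continuous_on {0..1} g"
      unfolding g_def
      by (intro continuous_intros continuous_on_v v_cont continuous_on_suminf_M_test[OF e_cont e_le C])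
    show "x \<in> {0..1}" using x by simp
    fix p :: "real poly"
    \<comment> \<open>The weight is moved onto the test polynomial, so that
      \<open>legendre_expandable_poly\<close> and \<open>has_integral_\<Lambda>\<close> apply to
      r.\<close>
    define r where "r = p * [:0,1,-1:]"
    have r: "poly r x = poly p x * (x * (1 - x))" for x by (simp add: r_def algebra_simps)
    have "((\<lambda>x. poly p x * (v x * v (1 - x))) has_integral \<Lambda> r) {0<..<1}"
      by (rule has_integral_eq[OF _ has_integral_\<Lambda>[of r]]) (simp add: vv r)
    then have 1: "((\<lambda>x. poly p x * (v x * v (1 - x))) has_integral \<Lambda> r) {0..1}"
      by (simp add: has_integral_Icc_iff_Ioo)
    obtain K where K: "\<And>x. x \<in> {0..1} \<Longrightarrow> \<bar>poly p x\<bar> \<le> K"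
    proof -
      have "compact (poly p ` {0..1})" by (intro compact_continuous_image continuous_intros) simp
      then have "bounded (poly p ` {0..1})" by (rule compact_imp_bounded)
      then obtain K where "\<forall>x\<in>{0..1}. \<bar>poly p x\<bar> \<le> K" by (auto simp: bounded_iff)
      then show ?thesis using that by blast
    qed
    have "((\<lambda>x. \<Sum>m. poly p x * e m x) has_integral \<Lambda> r) {0..1}"
    proof (rule has_integral_suminf_M_test)
      show "continuous_on {0..1} (\<lambda>x. poly p x * e m x)" for m by (intro continuous_intros e_cont)
      show "\<bar>poly p x * e m x\<bar> \<le> K * C m" if "x \<in> {0..1}" for m x
        using K[OF that] e_le[OF that, of m] by (simp add: abs_mult mult_mono')
      show "summable (\<lambda>m. K * C m)" by (intro summable_mult C)
      show "((\<lambda>x. poly p x * e m x) has_integral s m * legendre_moment m r) {0..1}" for m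
        using has_integral_mult_right[OF has_integral_legendre_moment[of m r], of "s m"] by (simp add: r e_def mult_ac)
      show "(\<lambda>m. s m * legendre_moment m r) sums \<Lambda> r" using legendre_expandable_poly[of r] by (simp add: legendre_expandable_def)
    qed
    then have 2: "((\<lambda>x. poly p x * (\<Sum>m. e m x)) has_integral \<Lambda> r) {0..1}"
    proof (rule has_integral_eq[rotated])
      fix x :: real assume "x \<in> {0..1}"
      then have "summable (\<lambda>m. e m x)" using e_le by (intro summable_comparison_test'[OF C, of 0]) auto
      then show "(\<Sum>m. poly p x * e m x) = poly p x * (\<Sum>m. e m x)" by (rule suminf_mult)
    qed
    show "((\<lambda>x. poly p x * g x) has_integral 0) {0..1}"
      using has_integral_diff[OF 1 2] by (simp add: g_def right_diff_distrib)
  qed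
  then have "(\<Sum>m. e m x) = x * (1 - x) * W x" using vv[OF x] by (simp add: g_def)
  moreover have "summable (\<lambda>m. e m x)" using e_le[of x] x by (intro summable_comparison_test'[OF C, of 0]) auto
  ultimately have "(\<lambda>m. e m x) sums (x * (1 - x) * W x)" by (simp add: sums_iff)
  then have "(\<lambda>m. 1 / (x * (1 - x)) * e m x) sums (1 / (x * (1 - x)) * (x * (1 - x) * W x))" by (rule sums_mult)
  then show ?thesis using x by (simp add: e_def)
qed

end

section \<open>Complete elliptic integrals\<close>

text \<open>Wallis' reduction: sin^(2k+1) cos vanishes at both ends, and its derivative relates
  consecutive even powers.\<close>

lemma sin_power_has_integral:
  "((\<lambda>t. sin t ^ (2 * k)) has_integral (pi / 2 * ncbinom k)) {0..pi/2}"
proof (induction k)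
  case 0
  show ?case using has_integral_const_real[of "1::real" 0 "pi/2"] by simp
next
  case (Suc k)
  have "((\<lambda>t. real (2*k+1) * sin t ^ (2*k) - real (2*k+2) * sin t ^ (2*k+2)) has_integral
      sin (pi/2) ^ (2*k+1) * cos (pi/2) - sin 0 ^ (2*k+1) * cos 0) {0..pi/2}"
  proof (rule fundamental_theorem_of_calculus)
    fix t :: real
    have "((\<lambda>t. sin t ^ (2*k+1) * cos t) has_real_derivative
       real (2*k+1) * (sin t ^ (2*k) * cos t) * cos t + sin t ^ (2*k+1) * (- sin t)) (at t within {0..pi/2})"
      by (rule has_field_derivative_at_within, rule DERIV_cong[OF DERIV_mult[OF DERIV_power[OF DERIV_sin] DERIV_cos]])
         (simp add: algebra_simps)
    also have "real (2*k+1) * (sin t ^ (2*k) * cos t) * cos t + sin t ^ (2*k+1) * (- sin t) =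
       real (2*k+1) * sin t ^ (2*k) * (cos t)\<^sup>2 - sin t ^ (2*k) * (sin t)\<^sup>2"
      by (simp add: power2_eq_square algebra_simps)
    also have "\<dots> = real (2*k+1) * sin t ^ (2*k) - real (2*k+2) * sin t ^ (2*k+2)"
      unfolding cos_squared_eq by (simp add: power2_eq_square algebra_simps)
    finally show "((\<lambda>t. sin t ^ (2*k+1) * cos t) has_vector_derivative
       real (2*k+1) * sin t ^ (2*k) - real (2*k+2) * sin t ^ (2*k+2)) (at t within {0..pi/2})"
      by (simp only: has_real_derivative_iff_has_vector_derivative)
  qed simp
  then have "((\<lambda>t. real (2*k+1) * sin t ^ (2*k) - real (2*k+2) * sin t ^ (2*k+2)) has_integral 0) {0..pi/2}"
    by simp
  from has_integral_mult_right[OF has_integral_diff[OF has_integral_mult_right[OF Suc.IH, of "real (2*k+1)"] this], of "1 / real (2*k+2)"]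
  have "((\<lambda>t. 1 / real (2*k+2) * (real (2*k+1) * sin t ^ (2*k) - (real (2*k+1) * sin t ^ (2*k) - real (2*k+2) * sin t ^ (2*k+2)))) has_integral
     1 / real (2*k+2) * (real (2*k+1) * (pi / 2 * ncbinom k) - 0)) {0..pi/2}" .
  moreover have "1 / real (2*k+2) * (real (2*k+1) * sin t ^ (2*k) - (real (2*k+1) * sin t ^ (2*k) - real (2*k+2) * sin t ^ (2*k+2))) = sin t ^ (2 * Suc k)" for t :: real
    by simp
  moreover have "1 / real (2*k+2) * (real (2*k+1) * (pi / 2 * ncbinom k) - 0) = pi / 2 * ncbinom (Suc k)"
    by (simp add: ncbinom_Suc add.commute mult_ac)
  ultimately show ?case by (simp only:)
qed

lemma ncbinom_gbinomial: "((-1/2) gchoose k) * (-1) ^ k = ncbinom k"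
proof (induction k)
  case (Suc k)
  have "((-1/2) gchoose Suc k) * (-1) ^ Suc k = (((-1/2) gchoose k) * (-1) ^ k) * ((1/2 + real k) / (real k + 1))"
    using gbinomial_mult_1[of "-1/2::real" k]
    by (simp add: gbinomial_Suc_rec field_simps) 
  then show ?case unfolding Suc.IH ncbinom_Suc by (simp add: divide_simps)
qed simp

lemma inverse_sqrt_sums:
  fixes z :: real assumes "\<bar>z\<bar> < 1"
  shows "(\<lambda>k. ncbinom k * z ^ k) sums (1 / sqrt (1 - z))"
proof -
  have "(\<lambda>k. ((-1/2) gchoose k) * (-z) ^ k) sums (1 + (-z)) powr (-1/2)"
    by (rule gen_binomial_real) (use assms in simp)
  moreover have "((-1/2) gchoose k) * (-z) ^ k = ncbinom k * z ^ k" for k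
    using ncbinom_gbinomial[of k] power_minus[of z k] by (metis mult.assoc)
  moreover have "(1 + (-z)) powr (-1/2) = 1 / sqrt (1 - z)"
  proof -
    have "(1 + (-z)) powr (-1/2) = (1 - z) powr (- (1/2))" by simp
    also have "\<dots> = inverse (sqrt (1 - z))"
      unfolding powr_minus using assms by (subst powr_half_sqrt) auto
    finally show ?thesis by (simp add: inverse_eq_divide)
  qed
  ultimately show ?thesis by (simp only:)
qed

text \<open>Away from the null set t = pi/2 the binomial series converges even for x = 1. All terms
  are nonnegative, so sum and integral may be exchanged in [0, \<infinity>], which keeps the
  divergent endpoint in the statement.\<close>

lemma ellK_suminf:
  assumes "0 \<le> x" "x \<le> 1"
  shows "ellK x = (\<Sum>k. ennreal (pi / 2 * (ncbinom k)\<^sup>2 * x ^ k))"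
proof -
  have "ellK x = (\<integral>\<^sup>+ t. (\<Sum>k. ennreal (ncbinom k * (x * (sin t)\<^sup>2) ^ k * indicator {0..pi/2} t)) \<partial>lborel)"
    unfolding ellK_def
  proof (rule nn_integral_cong_AE)
    have "AE t in lborel. t \<noteq> pi / 2" by (rule AE_lborel_singleton)
    then show "AE t in lborel. ennreal (1 / sqrt (1 - x * (sin t)\<^sup>2)) * indicator {0..pi/2} t
       = (\<Sum>k. ennreal (ncbinom k * (x * (sin t)\<^sup>2) ^ k * indicator {0..pi/2} t))"
    proof eventually_elim
      case (elim t)
      show ?case
      proof (cases "t \<in> {0..pi/2}")
        case True
        then have "0 \<le> sin t" "sin t < 1"
          using elim sin_monotone_2pi[of t "pi/2"] by (auto intro: sin_ge_zero)
        then have "(sin t)\<^sup>2 < 1" by (simp add: abs_square_less_1)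
        then have "x * (sin t)\<^sup>2 < 1" using assms by (smt (verit) mult_left_le_one_le zero_le_power2)
        then have "(\<lambda>k. ncbinom k * (x * (sin t)\<^sup>2) ^ k) sums (1 / sqrt (1 - x * (sin t)\<^sup>2))"
          using assms by (intro inverse_sqrt_sums) (simp add: abs_mult)
        then have "(\<Sum>k. ennreal (ncbinom k * (x * (sin t)\<^sup>2) ^ k)) = ennreal (1 / sqrt (1 - x * (sin t)\<^sup>2))"
          using assms ncbinom_pos by (intro suminf_ennreal_eq) (auto simp: less_imp_le)
        then show ?thesis using True by simp
      qed simp
    qed
  qed
  also have "\<dots> = (\<Sum>k. \<integral>\<^sup>+ t. ennreal (ncbinom k * (x * (sin t)\<^sup>2) ^ k * indicator {0..pi/2} t) \<partial>lborel)"
    by (intro nn_integral_suminf) measurable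
  also have "(\<lambda>k. \<integral>\<^sup>+ t. ennreal (ncbinom k * (x * (sin t)\<^sup>2) ^ k * indicator {0..pi/2} t) \<partial>lborel) = (\<lambda>k. ennreal (pi / 2 * (ncbinom k)\<^sup>2 * x ^ k))"
  proof
    fix k
    have "((\<lambda>t. ncbinom k * x ^ k * sin t ^ (2 * k)) has_integral ncbinom k * x ^ k * (pi / 2 * ncbinom k)) {0..pi/2}"
      by (intro has_integral_mult_right sin_power_has_integral)
    then have "((\<lambda>t. ncbinom k * (x * (sin t)\<^sup>2) ^ k) has_integral pi / 2 * (ncbinom k)\<^sup>2 * x ^ k) {0..pi/2}"
      by (simp add: power_mult_distrib power_mult power2_eq_square mult_ac)
    then have "(\<integral>\<^sup>+ t. ennreal (ncbinom k * (x * (sin t)\<^sup>2) ^ k) * indicator {0..pi/2} t \<partial>lborel) = ennreal (pi / 2 * (ncbinom k)\<^sup>2 * x ^ k)"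
      using assms ncbinom_pos[of k] by (intro nn_integral_has_integral_lebesgue') auto
    moreover have "ennreal (ncbinom k * (x * (sin t)\<^sup>2) ^ k * indicator {0..pi/2} t) = ennreal (ncbinom k * (x * (sin t)\<^sup>2) ^ k) * indicator {0..pi/2} t" for t
      by (simp split: split_indicator)
    ultimately show "(\<integral>\<^sup>+ t. ennreal (ncbinom k * (x * (sin t)\<^sup>2) ^ k * indicator {0..pi/2} t) \<partial>lborel) = ennreal (pi / 2 * (ncbinom k)\<^sup>2 * x ^ k)"
      by (simp only:)
  qed
  finally show ?thesis .
qed

text \<open>Group the inverse squares in pairs; the even ones contribute a quarter of the whole
  sum.\<close>

lemma inverse_odd_squares_sums: "(\<lambda>n. 1 / (2 * real n + 1)\<^sup>2) sums (pi\<^sup>2 / 8)"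
proof -
  have "(\<lambda>n. \<Sum>k\<in>{n*2..<n*2+2}. 1 / (real k + 1)\<^sup>2) sums (pi\<^sup>2 / 6)"
    using sums_group[OF inverse_squares_sums, of 2] by (simp add: add.commute)
  moreover have "(\<Sum>k\<in>{n*2..<n*2+2}. 1 / (real k + 1)\<^sup>2) = 1 / (2 * real n + 1)\<^sup>2 + 1/4 * (1 / (1 + real n)\<^sup>2)" for n
  proof -
    have "{n*2..<n*2+2} = {2*n, 2*n+1}" by auto
    moreover have "(real (2 * n + 1) + 1)\<^sup>2 = 4 * (1 + real n)\<^sup>2" by (simp add: power2_eq_square algebra_simps)
    ultimately show ?thesis by simp
  qed
  ultimately have "(\<lambda>n. 1 / (2 * real n + 1)\<^sup>2 + 1/4 * (1 / (1 + real n)\<^sup>2)) sums (pi\<^sup>2 / 6)" by (simp only:)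
  from sums_diff[OF this sums_mult[OF inverse_squares_sums, of "1/4"]]
  show ?thesis by (simp add: add.commute)
qed

section \<open>The case a = 1/2\<close>

interpretation half: hypergeometric_square "1/2"
  by unfold_locales auto

lemma half_q: "half.q = 1/4" by (simp add: half.q_def)

text \<open>At the extreme value q = 1/4 the quadratic is the perfect square (k + 1/2)^2; this is
  why both \<open>half.b\<close> and \<open>half.\<rho>\<close> are squares of
  \<open>ncbinom\<close>.\<close>

lemma half_quotient:
  "((real k)\<^sup>2 + real k + half.q) / (real k + 1)\<^sup>2 = ((2 * real k + 1) / (2 * real k + 2))\<^sup>2"
proof -
  have "(real k)\<^sup>2 + real k + half.q = (2 * real k + 1)\<^sup>2 / 4" by (simp add: half_q power2_eq_square field_simps)
  moreover have "(real k + 1)\<^sup>2 = (2 * real k + 2)\<^sup>2 / 4" by (simp add: power2_eq_square field_simps)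
  ultimately show ?thesis by (simp only: power_divide divide_divide_eq_left divide_divide_eq_right)
qed

lemma half_b: "half.b k = (ncbinom k)\<^sup>2"
proof (induction k)
  case (Suc k)
  have "half.b (Suc k) = half.b k * (((real k)\<^sup>2 + real k + half.q) / (real k + 1)\<^sup>2)"
    by (simp add: half.b_Suc)
  then show ?case unfolding half_quotient Suc.IH ncbinom_Suc by (simp add: power_mult_distrib power_divide)
qed simp

lemma half_\<rho>: "half.\<rho> m = (ncbinom m)\<^sup>2"
proof (induction m)
  case (Suc m)
  have "(real m)\<^sup>2 + 2 * real m + 3/4 + half.q = (real m + 1)\<^sup>2"
    by (simp add: half_q power2_eq_square algebra_simps)
  then have "half.\<rho> (Suc m) = half.\<rho> m * (((real m)\<^sup>2 + real m + half.q) / (real m + 1)\<^sup>2)"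
    by (simp add: half.\<rho>_def)
  then show ?case unfolding half_quotient Suc.IH ncbinom_Suc by (simp add: power_mult_distrib power_divide)
qed (simp add: half.\<rho>_def)

text \<open>Treated apart from \<open>\<mu>_0_eq\<close>, whose closed form is 0/0 at a = 1/2: the
  two poles in the partial fractions merge into inverse odd squares.\<close>

lemma half_\<mu>_0: "half.\<mu> 0 = pi / 2"
proof -
  have "(\<lambda>k. 4 / pi * (1 / (2 * real k + 1)\<^sup>2)) sums (4 / pi * (pi\<^sup>2 / 8))"
    by (intro sums_mult inverse_odd_squares_sums)
  moreover have "4 / pi * (1 / (2 * real k + 1)\<^sup>2) = half.\<beta> / ((real k + 1/2) * (real k + 1 - 1/2))" for k
  proof -
    have "(real k + 1/2) * (real k + 1 - 1/2) = (2 * real k + 1)\<^sup>2 / 4" by (simp add: power2_eq_square field_simps)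
    moreover have "half.\<beta> = 1 / pi" by (simp add: half.\<beta>_def)
    ultimately show ?thesis by (simp only: divide_divide_eq_left divide_divide_eq_right) simp
  qed
  ultimately have "half.\<mu> 0 = 4 / pi * (pi\<^sup>2 / 8)" using half.\<mu>_0_sums sums_unique2 by (simp only:) blast
  then show ?thesis by (simp add: power2_eq_square)
qed

lemma ellK_eq_u:
  assumes "0 \<le> x" "x < 1"
  shows "ellK x = ennreal (pi / 2 * half.u x)"
proof -
  have "(\<lambda>k. pi / 2 * (half.b k * x ^ k)) sums (pi / 2 * half.u x)"
    by (intro sums_mult half.u_sums assms)
  then have "(\<lambda>k. pi / 2 * (ncbinom k)\<^sup>2 * x ^ k) sums (pi / 2 * half.u x)" by (simp add: half_b mult_ac)
  then have "(\<Sum>k. ennreal (pi / 2 * (ncbinom k)\<^sup>2 * x ^ k)) = ennreal (pi / 2 * half.u x)"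
    using assms by (intro suminf_ennreal_eq) auto
  then show ?thesis using assms by (simp add: ellK_suminf)
qed

lemma not_summable_ncbinom_sq: "\<not> summable (\<lambda>k. (ncbinom k)\<^sup>2)"
proof
  assume "summable (\<lambda>k. (ncbinom k)\<^sup>2)"
  then have "summable (\<lambda>k. 1 / (4 * real k + 1))"
    by (rule summable_comparison_test'[where N = 0]) (use ncbinom_sq_ge in simp)
  then have "summable (\<lambda>k. 4 * (1 / (4 * real k + 1)))" by (rule summable_mult)
  then have "summable (\<lambda>k. 1 / real (Suc k))"
    by (rule summable_comparison_test'[where N = 0]) (simp add: divide_simps)
  then show False using not_summable_harmonic[where 'a = real] summable_Suc_iff[of "\<lambda>k. 1 / real k"]
    by (simp add: inverse_eq_divide)
qed

lemma ellK_1: "ellK 1 = \<infinity>"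
proof (rule ccontr)
  assume "ellK 1 \<noteq> \<infinity>"
  then have "(\<Sum>k. ennreal (pi / 2 * (ncbinom k)\<^sup>2)) \<noteq> top" by (simp add: ellK_suminf)
  then have "summable (\<lambda>k. pi / 2 * (ncbinom k)\<^sup>2)" by (intro summable_suminf_not_top) auto
  then show False using not_summable_ncbinom_sq by simp
qed

text \<open>In the interior this is \<open>W_expansion\<close> times (pi/2)^2. At the endpoints
  every Legendre value is 1, and both sides are infinite.\<close>

lemma ellK_product_sums:
  assumes x: "x \<in> {0..1}"
  shows "(\<lambda>m. ereal (pi ^ 3 / 8 * (ncbinom m ^ 4 * (4 * real m + 1) * poly (legendre (2 * m)) (2 * x - 1))))
     sums enn2ereal (ellK x * ellK (1 - x))"
proof (cases "0 < x \<and> x < 1")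
  case True
  have "(\<lambda>m. pi\<^sup>2 / 4 * (half.s m * poly (legendre (2*m)) (2 * x - 1))) sums (pi\<^sup>2 / 4 * half.W x)"
    using True by (intro sums_mult half.W_expansion) auto
  moreover have "pi\<^sup>2 / 4 * (half.s m * y) = pi ^ 3 / 8 * (ncbinom m ^ 4 * (4 * real m + 1) * y)" for m y
    unfolding half.s_def half.w_even half_\<mu>_0 half_\<rho>
    by (simp add: power2_eq_square power3_eq_cube power4_eq_xxxx)
  ultimately have "(\<lambda>m. pi ^ 3 / 8 * (ncbinom m ^ 4 * (4 * real m + 1) * poly (legendre (2 * m)) (2 * x - 1))) sums (pi\<^sup>2 / 4 * half.W x)"
    by (simp only:)
  moreover have "ellK x * ellK (1 - x) = ennreal (pi\<^sup>2 / 4 * half.W x)"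
  proof -
    have "half.u x \<ge> 0" "half.u (1 - x) \<ge> 0" using True by (auto intro: half.u_nonneg)
    then show ?thesis using True
      by (simp add: ellK_eq_u ennreal_mult[symmetric] half.W_def power2_eq_square mult_ac)
  qed
  moreover have "half.W x \<ge> 0" using True by (simp add: half.W_def half.u_nonneg)
  ultimately show ?thesis by (simp add: enn2ereal_ennreal sums_ereal)
next
  case False
  then have x01: "x = 0 \<or> x = 1" using x by auto
  define f where "f m = pi ^ 3 / 8 * (ncbinom m ^ 4 * (4 * real m + 1))" for m
  have f: "f m \<ge> 0" for m using ncbinom_pos[of m] by (simp add: f_def)
  have "poly (legendre (2 * m)) (2 * x - 1) = 1" for m
    using x01 legendre_minus[of "2*m" 1] by auto
  then have eq: "ereal (pi ^ 3 / 8 * (ncbinom m ^ 4 * (4 * real m + 1) * poly (legendre (2 * m)) (2 * x - 1))) = enn2ereal (ennreal (f m))" for m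
    using f[of m] by (simp add: f_def enn2ereal_ennreal)
  have "\<not> summable f"
  proof
    assume "summable f"
    then have "summable (\<lambda>m. 8 / pi ^ 3 * f m)" by (rule summable_mult)
    then have "summable (\<lambda>m. (ncbinom m)\<^sup>2)"
    proof (rule summable_comparison_test'[where N = 0])
      fix m
      \<comment> \<open>One of the two squares in the fourth power cancels the factor 4 m + 1, which
        leaves the divergent series of squares as a minorant.\<close>
      have "1 \<le> (4 * real m + 1) * (ncbinom m)\<^sup>2" using ncbinom_sq_ge[of m] by (simp add: field_simps)
      then have "(ncbinom m)\<^sup>2 * 1 \<le> (ncbinom m)\<^sup>2 * ((4 * real m + 1) * (ncbinom m)\<^sup>2)" by (intro mult_left_mono) auto
      moreover have "8 / pi ^ 3 * f m = (ncbinom m)\<^sup>2 * ((4 * real m + 1) * (ncbinom m)\<^sup>2)"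
        by (simp add: f_def power2_eq_square power4_eq_xxxx)
      ultimately show "norm ((ncbinom m)\<^sup>2) \<le> 8 / pi ^ 3 * f m"
        by simp
    qed
    then show False using not_summable_ncbinom_sq by simp
  qed
  then have "(\<Sum>m. ennreal (f m)) = top" using summable_suminf_not_top[of f] f by blast
  then have "(\<lambda>m. ennreal (f m)) sums top" using summable_sums[OF summableI, of "\<lambda>m. ennreal (f m)"] by simp
  moreover have "ellK x * ellK (1 - x) = top"
  proof -
    have "half.u 0 = 1" unfolding half.u_def by (subst suminf_finite[of "{0}"]) auto
    then have "ellK 0 = ennreal (pi / 2)" using ellK_eq_u[of 0] by simp
    then show ?thesis using x01 by (auto simp: ellK_1 ennreal_mult_eq_top_iff)
  qed
  ultimately show ?thesis unfolding eq by (simp only: sums_enn2ereal)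
qed

section \<open>The value at the midpoint\<close>

lemma Gamma_reflection_real: "Gamma a * Gamma (1 - a) = pi / sin (pi * a :: real)"
  using arg_cong[OF rGamma_reflection_real[of a], of inverse]
  by (simp add: rGamma_inverse_Gamma field_simps)

lemma Gamma_plus1_real: "x > 0 \<Longrightarrow> Gamma (x + 1) = x * Gamma (x :: real)"
  by (intro Gamma_plus1) (auto elim!: nonpos_Ints_cases)

lemma Gamma_legendre_duplication_real:
  fixes x :: real
  assumes "x > 0"
  shows "Gamma x * Gamma (x + 1/2) = exp ((1 - 2 * x) * ln 2) * sqrt pi * Gamma (2 * x)"
proof -
  have "complex_of_real (Gamma x * Gamma (x + 1/2)) = complex_of_real (exp ((1 - 2 * x) * ln 2) * sqrt pi * Gamma (2 * x))"
  proof -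
    have h: "complex_of_real y \<notin> \<int>\<^sub>\<le>\<^sub>0" if "y > 0" for y
    proof
      assume "complex_of_real y \<in> \<int>\<^sub>\<le>\<^sub>0"
      then obtain n where "complex_of_real y = of_int n" "n \<le> 0" by (auto elim!: nonpos_Ints_cases)
      moreover then have "y = of_int n" by (metis of_real_eq_iff of_real_of_int_eq)
      ultimately show False using that by simp
    qed
    have e: "complex_of_real (x + 1/2) = complex_of_real x + 1/2" by simp
    show ?thesis
      using Gamma_legendre_duplication[of "complex_of_real x"] h[of x] h[of "x + 1/2"] assms
      by (simp add: Gamma_complex_of_real[symmetric] exp_of_real[symmetric] e)
  qed
  then show ?thesis by (simp only: of_real_eq_iff)
qed

text \<open>Logarithmic derivative of the reflection formula on (0, 1), where all factors are
  positive.\<close>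

lemma Digamma_reflection_real:
  fixes a :: real
  assumes a: "0 < a" "a < 1"
  shows "Digamma (1 - a) - Digamma a = pi * cot (pi * a)"
proof -
  have "((\<lambda>x. ln_Gamma x + ln_Gamma (1 - x)) has_field_derivative Digamma a - Digamma (1 - a)) (at a)"
    using a by (auto intro!: derivative_eq_intros)
  moreover have "((\<lambda>x. ln pi - ln (sin (pi * x))) has_field_derivative - (pi * cot (pi * a))) (at a)"
    using a sin_gt_zero[of "pi * a"] by (auto intro!: derivative_eq_intros simp: cot_def field_simps)
  moreover have "\<forall>\<^sub>F x in nhds a. ln_Gamma x + ln_Gamma (1 - x) = ln pi - ln (sin (pi * x))"
  proof -
    have "\<forall>\<^sub>F x in nhds a. x \<in> {0<..<1}" using a by (intro eventually_nhds_in_open) auto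
    then show ?thesis
    proof eventually_elim
      case (elim x)
      then have "sin (pi * x) > 0" by (simp add: sin_gt_zero)
      then have "ln (Gamma x * Gamma (1 - x)) = ln pi - ln (sin (pi * x))"
        unfolding Gamma_reflection_real by (simp add: ln_div)
      moreover have "Gamma x > 0" "Gamma (1 - x) > 0" using elim by auto
      ultimately show ?case using elim by (simp add: ln_Gamma_real_pos ln_mult)
    qed
  qed
  ultimately have "Digamma a - Digamma (1 - a) = - (pi * cot (pi * a))"
    using DERIV_cong_ev[OF refl _ refl, of "\<lambda>x. ln_Gamma x + ln_Gamma (1 - x)" "\<lambda>x. ln pi - ln (sin (pi * x))" a] DERIV_unique by blast
  then show ?thesis by simp
qed

lemma powr_minus_sums:
  fixes z :: real
  assumes "\<bar>z\<bar> < 1"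
  shows "(\<lambda>k. pochhammer a k / fact k * z ^ k) sums (1 - z) powr (- a)"
proof -
  have "(\<lambda>k. ((- a) gchoose k) * (- z) ^ k) sums (1 + - z) powr (- a)"
    by (rule gen_binomial_real) (use assms in simp)
  moreover have "((- a) gchoose k) * (- z) ^ k = pochhammer a k / fact k * z ^ k" for k
  proof -
    have "((- a) gchoose k) * (- z) ^ k = pochhammer a k / fact k * z ^ k * ((- 1) ^ k * (- 1) ^ k)"
      unfolding gbinomial_pochhammer power_minus[of z k] by simp
    also have "(- 1) ^ k * (- 1) ^ k = (1::real)" by (simp flip: power_mult_distrib)
    finally show ?thesis by simp
  qed
  ultimately show ?thesis by simp
qed

text \<open>Companion of \<open>has_integral_suminf_nonneg\<close> for the case in which the
  integral is known and the sum is sought: the integral bounds the partial sums, so the series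
  converges and monotone convergence applies.\<close>

lemma has_integral_sums_nonneg:
  fixes f :: "nat \<Rightarrow> real \<Rightarrow> real"
  assumes f: "\<And>k. (f k has_integral c k) S" and pos: "\<And>k x. x \<in> S \<Longrightarrow> 0 \<le> f k x"
    and g: "\<And>x. x \<in> S \<Longrightarrow> (\<lambda>k. f k x) sums g x" and s: "(g has_integral s) S"
  shows "c sums s"
proof -
  have c: "c k \<ge> 0" for k using has_integral_nonneg[OF f pos] by blast
  have "(\<Sum>k<n. c k) \<le> s" for n
  proof (rule has_integral_le[OF _ s])
    show "((\<lambda>x. \<Sum>k<n. f k x) has_integral (\<Sum>k<n. c k)) S" by (intro has_integral_sum f) simp
    show "(\<Sum>k<n. f k x) \<le> g x" if "x \<in> S" for x
      using sum_le_suminf[of "\<lambda>k. f k x" "{..<n}"] g[OF that] pos[OF that] by (auto simp: sums_iff)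
  qed
  then have "(\<Sum>k\<le>n. c k) \<le> s" for n by (metis lessThan_Suc_atMost)
  then have "summable c" using c by (intro bounded_imp_summable[of c s])
  then have cs: "c sums suminf c" by (rule summable_sums)
  have "(g has_integral suminf c) S" by (rule has_integral_suminf_nonneg[OF f pos g cs])
  then show ?thesis using cs s has_integral_unique by blast
qed

section \<open>Evaluation of the zeroth moment and of u at 1/2\<close>

context hypergeometric_square
begin

text \<open>Partial fractions give the difference of two Digamma series, whose logarithmic terms
  cancel; reflection turns it into a cotangent.\<close>

lemma \<mu>_0_eq:
  assumes "a \<noteq> 1/2"
  shows "\<mu> 0 = cos (pi * a) / (1 - 2 * a)"
proof -
  have d: "(\<lambda>m. ln (real m) - (\<Sum>n<m. inverse (z + real n))) \<longlonglongrightarrow> Digamma z" if "z \<noteq> 0" for z :: real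
    using Digamma_LIMSEQ[of z] that by simp
  have "(\<lambda>m. (ln (real m) - (\<Sum>n<m. inverse ((1 - a) + real n))) - (ln (real m) - (\<Sum>n<m. inverse (a + real n)))) \<longlonglongrightarrow> Digamma (1 - a) - Digamma a"
    using a_pos a_less_1 by (intro tendsto_diff d) auto
  then have "(\<lambda>n. inverse (a + real n) - inverse ((1 - a) + real n)) sums (pi * cot (pi * a))"
    unfolding Digamma_reflection_real[OF a_pos a_less_1] by (simp add: sums_def sum_subtractf)
  from sums_mult[OF this, of "\<beta> / (1 - 2 * a)"]
  have "(\<lambda>n. \<beta> / (1 - 2 * a) * (inverse (a + real n) - inverse ((1 - a) + real n))) sums (\<beta> / (1 - 2 * a) * (pi * cot (pi * a)))" .
  moreover have "\<beta> / (1 - 2 * a) * (inverse (a + real n) - inverse ((1 - a) + real n)) = \<beta> / ((real n + a) * (real n + 1 - a))" for n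
  proof -
    have "a + real n > 0" "(1 - a) + real n > 0" using a_pos a_less_1 by auto
    then have "inverse (a + real n) - inverse ((1 - a) + real n) = (1 - 2 * a) / ((real n + a) * (real n + 1 - a))"
      by (simp add: field_simps)
    then show ?thesis using assms by simp
  qed
  ultimately have "\<mu> 0 = \<beta> / (1 - 2 * a) * (pi * cot (pi * a))" using \<mu>_0_sums sums_unique2 by (simp only:) blast
  also have "\<dots> = cos (pi * a) / (1 - 2 * a)"
    using a_pos a_less_1 sin_gt_zero[of "pi * a"] by (simp add: \<beta>_def cot_def)
  finally show ?thesis .
qed

text \<open>Euler's integral for \<open>u(1/2)\<close>; it is a Beta integral because \<open>s (1 - s/2) = (1 - (1 - s)\<^sup>2) / 2\<close>. Instead of
  substituting, both the integral and the Beta integral are expanded into series.\<close>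
lemma u_half_integral:
  "((\<lambda>s. s powr (- a) * (1 - s) powr (a - 1) * (1 - s / 2) powr (- a)) has_integral Gamma a * Gamma (1 - a) * u (1/2)) {0<..<1}"
proof (rule has_integral_suminf_nonneg)
  let ?f = "\<lambda>k s. pochhammer a k / fact k / 2 ^ k * (s powr ((1 - a + real k) - 1) * (1 - s) powr (a - 1))"
  show "(?f k has_integral pochhammer a k / fact k / 2 ^ k * Beta (1 - a + real k) a) {0<..<1}" for k
    using has_integral_Beta_real[of "1 - a + real k" a] a_pos a_less_1
    by (intro has_integral_mult_right) (simp add: has_integral_Icc_iff_Ioo)
  show "0 \<le> ?f k s" if "s \<in> {0<..<1}" for k s
    using a_pos by (simp add: pochhammer_nonneg)
  show "(\<lambda>k. ?f k s) sums (s powr (- a) * (1 - s) powr (a - 1) * (1 - s / 2) powr (- a))" if "s \<in> {0<..<1}" for s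
  proof -
    have "(\<lambda>k. s powr (- a) * (1 - s) powr (a - 1) * (pochhammer a k / fact k * (s / 2) ^ k)) sums (s powr (- a) * (1 - s) powr (a - 1) * (1 - s / 2) powr (- a))"
      using that by (intro sums_mult powr_minus_sums) auto
    moreover have "s powr ((1 - a + real k) - 1) = s powr (- a) * s ^ k" for k
      using that powr_add[of s "- a" "real k"] by (simp add: powr_realpow)
    ultimately show ?thesis by (simp add: power_divide mult_ac)
  qed
  have "(\<lambda>k. Gamma a * Gamma (1 - a) * (b k * (1/2) ^ k)) sums (Gamma a * Gamma (1 - a) * u (1/2))"
    by (intro sums_mult u_sums) auto
  moreover have "pochhammer a k / fact k / 2 ^ k * Beta (1 - a + real k) a = Gamma a * Gamma (1 - a) * (b k * (1/2) ^ k)" for k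
  proof -
    have "1 - a \<notin> \<int>\<^sub>\<le>\<^sub>0" using a_less_1 by (auto elim!: nonpos_Ints_cases)
    then have "Gamma (1 - a + real k) = pochhammer (1 - a) k * Gamma (1 - a)"
      using pochhammer_Gamma[of "1 - a" k] by (simp add: Gamma_eq_zero_iff)
    moreover have "Gamma (1 - a + real k + a) = fact k" using Gamma_fact[of k, where 'a = real] by (simp add: algebra_simps)
    ultimately show ?thesis unfolding Beta_def b_def by (simp add: power2_eq_square power_divide mult_ac)
  qed
  ultimately show "(\<lambda>k. pochhammer a k / fact k / 2 ^ k * Beta (1 - a + real k) a) sums (Gamma a * Gamma (1 - a) * u (1/2))"
    by (simp only:)
qed

text \<open>Expand (1 - y)^(-a) under the Beta integral. The trivial power with exponent 1 - 1 is
  written out so that each term has the shape of a Beta integrand.\<close>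

lemma Beta_half_sums: "(\<lambda>j. pochhammer a j / fact j * (1 / (a / 2 + real j))) sums Beta (a / 2) (1 - a)"
proof (rule has_integral_sums_nonneg)
  let ?f = "\<lambda>j y. pochhammer a j / fact j * (y powr ((a / 2 + real j) - 1) * (1 - y) powr (1 - 1))"
  show "((\<lambda>y. y powr (a / 2 - 1) * (1 - y) powr ((1 - a) - 1)) has_integral Beta (a / 2) (1 - a)) {0<..<1}"
    using has_integral_Beta_real[of "a / 2" "1 - a"] a_pos a_less_1 by (simp add: has_integral_Icc_iff_Ioo)
  show "(?f j has_integral pochhammer a j / fact j * (1 / (a / 2 + real j))) {0<..<1}" for j
  proof (rule has_integral_mult_right)
    have "Beta (a / 2 + real j) 1 = 1 / (a / 2 + real j)"
      using a_pos Gamma_plus1_real[of "a / 2 + real j"] less_imp_neq[OF Gamma_real_pos[of "a / 2 + real j"]]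
      by (simp add: Beta_def)
    then show "((\<lambda>y. y powr ((a / 2 + real j) - 1) * (1 - y) powr (1 - 1)) has_integral 1 / (a / 2 + real j)) {0<..<1}"
      using has_integral_Beta_real[of "a / 2 + real j" 1] a_pos by (simp add: has_integral_Icc_iff_Ioo)
  qed
  show "0 \<le> ?f j y" if "y \<in> {0<..<1}" for j y
    using a_pos by (simp add: pochhammer_nonneg)
  show "(\<lambda>j. ?f j y) sums (y powr (a / 2 - 1) * (1 - y) powr ((1 - a) - 1))" if "y \<in> {0<..<1}" for y
  proof -
    have "(\<lambda>j. y powr (a / 2 - 1) * (pochhammer a j / fact j * y ^ j)) sums (y powr (a / 2 - 1) * (1 - y) powr (- a))"
      using that by (intro sums_mult powr_minus_sums) auto
    moreover have "y powr ((a / 2 + real j) - 1) = y powr (a / 2 - 1) * y ^ j" for j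
      using that powr_add[of y "a / 2 - 1" "real j"] by (simp add: powr_realpow algebra_simps)
    ultimately show ?thesis using that by (simp add: mult_ac)
  qed
qed

text \<open>Expanding in powers of (1 - s)^2 leaves the integrals 1 / (a + 2 j), half the terms of
  \<open>Beta_half_sums\<close>; this stands for the substitution y = (1 - s)^2.\<close>

lemma Beta_half_integral:
  "((\<lambda>s. s powr (- a) * (1 - s) powr (a - 1) * (1 - s / 2) powr (- a)) has_integral 2 powr a * (Beta (a / 2) (1 - a) / 2)) {0<..<1}"
proof (rule has_integral_suminf_nonneg)
  let ?f = "\<lambda>j s. 2 powr a * (pochhammer a j / fact j) * (s powr (1 - 1) * (1 - s) powr ((a + 2 * real j) - 1))"
  show "(?f j has_integral 2 powr a * (pochhammer a j / fact j) * (1 / (a + 2 * real j))) {0<..<1}" for j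
  proof (rule has_integral_mult_right)
    have "Beta 1 (a + 2 * real j) = 1 / (a + 2 * real j)"
      using a_pos Gamma_plus1_real[of "a + 2 * real j"] less_imp_neq[OF Gamma_real_pos[of "a + 2 * real j"]]
      by (simp add: Beta_def add.commute[of 1])
    then show "((\<lambda>s. s powr (1 - 1) * (1 - s) powr ((a + 2 * real j) - 1)) has_integral 1 / (a + 2 * real j)) {0<..<1}"
      using has_integral_Beta_real[of 1 "a + 2 * real j"] a_pos by (simp add: has_integral_Icc_iff_Ioo)
  qed
  show "0 \<le> ?f j s" if "s \<in> {0<..<1}" for j s
    using a_pos by (simp add: pochhammer_nonneg)
  show "(\<lambda>j. ?f j s) sums (s powr (- a) * (1 - s) powr (a - 1) * (1 - s / 2) powr (- a))" if "s \<in> {0<..<1}" for s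
  proof -
    have s: "0 < s" "s < 1" using that by auto
    have "(1 - s)\<^sup>2 < 1" using s by (simp add: abs_square_less_1)
    then have "(\<lambda>j. 2 powr a * (1 - s) powr (a - 1) * (pochhammer a j / fact j * ((1 - s)\<^sup>2) ^ j)) sums (2 powr a * (1 - s) powr (a - 1) * (1 - (1 - s)\<^sup>2) powr (- a))"
      by (intro sums_mult powr_minus_sums) simp
    moreover have powr_j: "(1 - s) powr ((a + 2 * real j) - 1) = (1 - s) powr (a - 1) * ((1 - s)\<^sup>2) ^ j" for j
    proof -
      have "(1 - s) powr ((a + 2 * real j) - 1) = (1 - s) powr ((a - 1) + real (2 * j))" by (simp add: algebra_simps)
      also have "\<dots> = (1 - s) powr (a - 1) * (1 - s) ^ (2 * j)" unfolding powr_add using s by (subst powr_realpow) auto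
      finally show ?thesis by (simp add: power_mult)
    qed
    moreover have "2 powr a * (1 - (1 - s)\<^sup>2) powr (- a) = s powr (- a) * (1 - s / 2) powr (- a)"
    proof -
      have "1 - (1 - s)\<^sup>2 = 2 * (s * (1 - s / 2))" by (simp add: power2_eq_square algebra_simps)
      then have "(1 - (1 - s)\<^sup>2) powr (- a) = 2 powr (- a) * (s powr (- a) * (1 - s / 2) powr (- a))"
        using s by (simp add: powr_mult)
      moreover have "2 powr a * 2 powr (- a) = (1::real)" by (simp flip: powr_add)
      ultimately show ?thesis by (metis mult.assoc mult_1)
    qed
    then have "2 powr a * (1 - s) powr (a - 1) * (1 - (1 - s)\<^sup>2) powr (- a) = s powr (- a) * (1 - s) powr (a - 1) * (1 - s / 2) powr (- a)"
      by (metis mult.assoc mult.commute)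
    ultimately have "(\<lambda>j. 2 powr a * (1 - s) powr (a - 1) * (pochhammer a j / fact j * ((1 - s)\<^sup>2) ^ j)) sums (s powr (- a) * (1 - s) powr (a - 1) * (1 - s / 2) powr (- a))"
      by (simp only:)
    moreover have "2 powr a * (1 - s) powr (a - 1) * (pochhammer a j / fact j * ((1 - s)\<^sup>2) ^ j) = ?f j s" for j
      unfolding powr_j using s by simp
    ultimately show ?thesis by (simp only:)
  qed
  have "(\<lambda>j. 2 powr a * (1/2 * (pochhammer a j / fact j * (1 / (a / 2 + real j))))) sums (2 powr a * (1/2 * Beta (a / 2) (1 - a)))"
    by (intro sums_mult Beta_half_sums)
  moreover have "1 / 2 * (1 / (a / 2 + real j)) = 1 / (a + 2 * real j)" for j
    using a_pos by (simp add: field_simps)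
  ultimately show "(\<lambda>j. 2 powr a * (pochhammer a j / fact j) * (1 / (a + 2 * real j))) sums (2 powr a * (Beta (a / 2) (1 - a) / 2))"
    by (simp add: mult_ac)
qed

text \<open>Bailey's summation with lower parameter 1. The two evaluations of Euler's integral are
  equated, then simplified by reflection at a and a/2, the double angle formula, and duplication at
  (1 - a)/2.\<close>

lemma u_half: "u (1/2) = cos (pi * a / 2) / sqrt pi * Gamma ((1 - a) / 2) / Gamma (1 - a / 2)"
proof -
  have 1: "Gamma a * Gamma (1 - a) * u (1/2) = 2 powr a * (Beta (a / 2) (1 - a) / 2)"
    using has_integral_unique[OF u_half_integral Beta_half_integral] .
  have "Gamma ((1 - a) / 2) * Gamma ((1 - a) / 2 + 1/2) = exp ((1 - 2 * ((1 - a) / 2)) * ln 2) * sqrt pi * Gamma (2 * ((1 - a) / 2))"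
    using a_less_1 by (intro Gamma_legendre_duplication_real) simp
  moreover have "(1 - a) / 2 + 1/2 = 1 - a / 2" "1 - 2 * ((1 - a) / 2) = a" "2 * ((1 - a) / 2) = 1 - a" by (simp_all add: field_simps)
  ultimately have dup: "Gamma ((1 - a) / 2) * Gamma (1 - a / 2) = 2 powr a * sqrt pi * Gamma (1 - a)"
    by (simp only: powr_def) simp
  have r1: "Gamma a * Gamma (1 - a) = pi / (2 * sin (pi * a / 2) * cos (pi * a / 2))"
    unfolding Gamma_reflection_real using sin_double[of "pi * a / 2"] by simp
  have r2: "Gamma (a / 2) * Gamma (1 - a / 2) = pi / sin (pi * a / 2)"
    using Gamma_reflection_real[of "a / 2"] by simp
  have pos: "Gamma (1 - a / 2) > 0" "Gamma (1 - a) > 0" "sin (pi * a / 2) > 0" "cos (pi * a / 2) > 0"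
    using a_pos a_less_1 by (auto intro!: sin_gt_zero cos_gt_zero)
  define S where "S = sin (pi * a / 2)"
  define C where "C = cos (pi * a / 2)"
  define G where "G = Gamma (1 - a / 2)"
  define H where "H = Gamma ((1 - a) / 2)"
  have B: "Beta (a / 2) (1 - a) = Gamma (a / 2) * Gamma (1 - a) / G"
    by (simp add: Beta_def G_def)
  have g2: "Gamma (a / 2) = pi / (S * G)" using r2 pos by (simp add: S_def G_def field_simps)
  have "2 powr a * (Gamma (1 - a)) = H * G / sqrt pi" using dup by (simp add: H_def G_def field_simps)
  then have "2 powr a * (Beta (a / 2) (1 - a) / 2) = (pi / (S * G)) * (H * G / sqrt pi) / (2 * G)"
  proof -
    assume h: "2 powr a * Gamma (1 - a) = H * G / sqrt pi"
    have "2 powr a * (Beta (a / 2) (1 - a) / 2) = Gamma (a / 2) * (2 powr a * Gamma (1 - a)) / (2 * G)"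
      unfolding B by (simp add: mult_ac)
    then show ?thesis unfolding h g2 .
  qed
  then have "pi / (2 * S * C) * u (1/2) = (pi / (S * G)) * (H * G / sqrt pi) / (2 * G)"
    using 1 unfolding r1 S_def C_def by simp
  then have "u (1/2) = C / sqrt pi * H / G"
    using pos unfolding S_def[symmetric] C_def[symmetric] G_def[symmetric] by (simp add: field_simps)
  then show ?thesis by (simp add: C_def H_def G_def)
qed

text \<open>The Gamma quotient in \<open>Gamma_term\<close> at \<nu> = -a.\<close>

definition R :: "nat \<Rightarrow> real" where
  "R m = Gamma (real m + a) * Gamma (real m + 1 - a) / (Gamma (real m + a + 1/2) * Gamma (real m + 3/2 - a))"

lemma R_eq: "R m = R 0 * \<rho> m"
proof (induction m)
  case (Suc m)
  have e: "real (Suc m) + a = (real m + a) + 1" "real (Suc m) + 1 - a = (real m + 1 - a) + 1"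
    "real (Suc m) + a + 1/2 = (real m + a + 1/2) + 1" "real (Suc m) + 3/2 - a = (real m + 3/2 - a) + 1" by simp_all
  have "R (Suc m) = ((real m + a) * Gamma (real m + a) * ((real m + 1 - a) * Gamma (real m + 1 - a))) /
     (((real m + a + 1/2) * Gamma (real m + a + 1/2)) * ((real m + 3/2 - a) * Gamma (real m + 3/2 - a)))"
    unfolding R_def e using a_pos a_less_1
      Gamma_plus1_real[of "real m + a"] Gamma_plus1_real[of "real m + 1 - a"]
      Gamma_plus1_real[of "real m + a + 1/2"] Gamma_plus1_real[of "real m + 3/2 - a"]
    by (simp only: e(3)[unfolded e(1)])
  also have "\<dots> = R m * (((real m + a) * (real m + 1 - a)) / ((real m + a + 1/2) * (real m + 3/2 - a)))"
    unfolding R_def by (simp only: times_divide_times_eq mult_ac)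
  also have "(real m + a) * (real m + 1 - a) = (real m)\<^sup>2 + real m + q"
    by (simp add: q_def power2_eq_square algebra_simps)
  also have "(real m + a + 1/2) * (real m + 3/2 - a) = (real m)\<^sup>2 + 2 * real m + 3/4 + q"
    by (simp add: q_def power2_eq_square field_simps)
  finally show ?case unfolding Suc.IH by (simp add: \<rho>_def)
qed (simp add: \<rho>_def)

text \<open>The expansion of \<open>W\<close> at 1/2, where both factors of \<open>W\<close>
  coincide, scaled by -2 / sin (pi a) to turn \<open>\<mu> 0\<close> into -R 0. The bound a < 1/2
  keeps 1/2 - a and cos (pi a) positive.\<close>

lemma Gamma_quotient_sums:
  assumes "a < 1/2"
  shows "(\<lambda>m. ncbinom m ^ 3 * (-1) ^ (m + 1) * (R m * (4 * real m + 1))) sums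
    (- cot (pi * a / 2) * (Gamma ((1 - a) / 2))\<^sup>2 / (pi * (Gamma (1 - a / 2))\<^sup>2))"
proof -
  define G where "G = Gamma (1 - a / 2)"
  define H where "H = Gamma ((1 - a) / 2)"
  define S where "S = sin (pi * a / 2)"
  define C where "C = cos (pi * a / 2)"
  have pos: "G > 0" "S > 0" "C > 0" "cos (pi * a) > 0" "sin (pi * a) > 0"
    unfolding G_def S_def C_def using a_pos assms by (auto intro!: sin_gt_zero cos_gt_zero)
  have "Gamma (3/2 - a) = (1/2 - a) * Gamma (1/2 - a)"
    using Gamma_plus1_real[of "1/2 - a"] assms by (simp add: add.commute diff_add_eq)
  moreover have "Gamma (a + 1/2) * Gamma (1/2 - a) = pi / cos (pi * a)"
    using Gamma_reflection_real[of "a + 1/2"] sin_add[of "pi * a" "pi / 2"] by (simp add: algebra_simps)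
  ultimately have "Gamma (a + 1/2) * Gamma (3/2 - a) = (1/2 - a) * (pi / cos (pi * a))" by (metis mult.left_commute)
  then have "R 0 = (pi / sin (pi * a)) / ((1/2 - a) * (pi / cos (pi * a)))"
    by (simp add: R_def Gamma_reflection_real[symmetric])
  also have "\<dots> = \<mu> 0 * (2 / sin (pi * a))"
  proof -
    have "(pi / y) / (h * (pi / c)) = c / (2 * h) * (2 / y)" if "h > 0" "y > 0" "c > 0" for h y c :: real
      using that by simp
    from this[of "1/2 - a" "sin (pi * a)" "cos (pi * a)"] show ?thesis
      using \<mu>_0_eq assms pos by (simp add: right_diff_distrib)
  qed
  finally have R0: "R 0 = \<mu> 0 * (2 / sin (pi * a))" .
  have "(\<lambda>m. - (2 / sin (pi * a)) * (s m * poly (legendre (2*m)) (2 * (1/2) - 1))) sums (- (2 / sin (pi * a)) * W (1/2))"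
    by (intro sums_mult W_expansion) auto
  moreover have "- (2 / sin (pi * a)) * (s m * poly (legendre (2*m)) (2 * (1/2) - 1)) = ncbinom m ^ 3 * (-1) ^ (m + 1) * (R m * (4 * real m + 1))" for m
    unfolding R_eq[of m] R0 s_def w_even
    by (simp add: legendre_even_0 power2_eq_square power3_eq_cube)
  moreover have "- (2 / sin (pi * a)) * W (1/2) = - cot (pi * a / 2) * H\<^sup>2 / (pi * G\<^sup>2)"
  proof -
    have "W (1/2) = C\<^sup>2 / pi * H\<^sup>2 / G\<^sup>2"
    proof -
      have "W (1/2) = (u (1/2))\<^sup>2" by (simp add: W_def power2_eq_square)
      then show ?thesis unfolding u_half C_def H_def G_def by (simp add: power_mult_distrib power_divide)
    qed
    moreover have "sin (pi * a) = 2 * S * C" using sin_double[of "pi * a / 2"] by (simp add: S_def C_def)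
    moreover have "cot (pi * a / 2) = C / S" by (simp add: cot_def C_def S_def)
    ultimately show ?thesis using pos by (simp add: field_simps power2_eq_square)
  qed
  ultimately show ?thesis unfolding G_def H_def by (simp only:)
qed

end

section \<open>Analytic continuation\<close>

text \<open>The denominators enter through the entire function \<open>rGamma\<close>, so
  half-integers are regular points and only integers are singular.\<close>

definition Gamma_quotient :: "complex \<Rightarrow> nat \<Rightarrow> complex" where
  "Gamma_quotient \<nu> m = Gamma (of_nat m - \<nu>) * Gamma (of_nat m + \<nu> + 1) *
     (rGamma (of_nat m - \<nu> + 1/2) * rGamma (of_nat m + \<nu> + 3/2))"

lemma Gamma_term_eq:
  "Gamma_term \<nu> m = of_real (ncbinom m ^ 3 * (-1) ^ (m + 1) * (4 * real m + 1)) * Gamma_quotient \<nu> m"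
proof -
  have "x * g * (g1 * g2 * n / (g3 * g4)) = x * g * n * (g1 * g2 * (inverse g3 * inverse g4))"
    for x g n g1 g2 g3 g4 :: complex by (simp add: divide_inverse)
  moreover have "of_real (ncbinom m ^ 3 * (-1) ^ (m + 1) * (4 * real m + 1)) = complex_of_real (ncbinom m) ^ 3 * (-1) ^ (m + 1) * (4 * of_nat m + 1)"
    by simp
  ultimately show ?thesis unfolding Gamma_term_def Gamma_quotient_def rGamma_inverse_Gamma by (simp only:)
qed

lemma not_Ints_shift:
  assumes "(\<nu>::complex) \<notin> \<int>"
  shows "of_nat m - \<nu> \<notin> \<int>\<^sub>\<le>\<^sub>0" "of_nat m + \<nu> + 1 \<notin> \<int>\<^sub>\<le>\<^sub>0"
proof -
  have "of_nat m - \<nu> \<notin> \<int>" using assms Ints_diff[of "of_nat m" "of_nat m - \<nu>"] by auto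
  then show "of_nat m - \<nu> \<notin> \<int>\<^sub>\<le>\<^sub>0" using nonpos_Ints_subset_Ints by blast
  have "of_nat m + \<nu> + 1 \<notin> \<int>" using assms Ints_diff[of "of_nat m + \<nu> + 1" "of_nat (m + 1)"] by auto
  then show "of_nat m + \<nu> + 1 \<notin> \<int>\<^sub>\<le>\<^sub>0" using nonpos_Ints_subset_Ints by blast
qed

text \<open>Kept in product form because the left factor can vanish at half-integers.\<close>

lemma Gamma_quotient_Suc:
  assumes "\<nu> \<notin> \<int>"
  shows "(of_real ((real m)\<^sup>2 + 2 * real m + 3/4) - (\<nu>\<^sup>2 + \<nu>)) * Gamma_quotient \<nu> (Suc m) =
    (of_real ((real m)\<^sup>2 + real m) - (\<nu>\<^sup>2 + \<nu>)) * Gamma_quotient \<nu> m"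
proof -
  define x1 x2 x3 x4 where "x1 = of_nat m - \<nu>" and "x2 = of_nat m + \<nu> + 1" and "x3 = of_nat m - \<nu> + 1/2" and "x4 = of_nat m + \<nu> + 3/2"
  have e: "of_nat (Suc m) - \<nu> = x1 + 1" "of_nat (Suc m) + \<nu> + 1 = x2 + 1"
    "of_nat (Suc m) - \<nu> + 1/2 = x3 + 1" "of_nat (Suc m) + \<nu> + 3/2 = x4 + 1"
    by (simp_all add: x1_def x2_def x3_def x4_def)
  have G: "Gamma (x1 + 1) = x1 * Gamma x1" "Gamma (x2 + 1) = x2 * Gamma x2"
    unfolding x1_def x2_def by (rule Gamma_plus1, rule not_Ints_shift[OF assms])+
  have "of_real ((real m)\<^sup>2 + 2 * real m + 3/4) - (\<nu>\<^sup>2 + \<nu>) = x3 * x4"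
    by (simp add: x3_def x4_def power2_eq_square field_simps)
  moreover have "of_real ((real m)\<^sup>2 + real m) - (\<nu>\<^sup>2 + \<nu>) = x1 * x2"
    by (simp add: x1_def x2_def power2_eq_square algebra_simps)
  moreover have "x3 * x4 * Gamma_quotient \<nu> (Suc m) = x1 * Gamma x1 * (x2 * Gamma x2) * ((x3 * rGamma (x3 + 1)) * (x4 * rGamma (x4 + 1)))"
    unfolding Gamma_quotient_def e(3,4) unfolding e(1,2) G by (simp add: mult_ac)
  moreover have "x1 * Gamma x1 * (x2 * Gamma x2) * ((x3 * rGamma (x3 + 1)) * (x4 * rGamma (x4 + 1))) = x1 * x2 * Gamma_quotient \<nu> m"
    unfolding rGamma_plus1 Gamma_quotient_def x3_def[symmetric] x4_def[symmetric] unfolding x1_def[symmetric] x2_def[symmetric] by (simp add: mult_ac)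
  ultimately show ?thesis by (simp only:)
qed

section \<open>Bounds locally uniform in the parameter\<close>

lemma norm_le_norm_add:
  fixes x d :: complex
  assumes "0 \<le> Re (x * cnj d)"
  shows "norm x \<le> norm (x + d)"
proof (rule power2_le_imp_le)
  have "(norm (x + d))\<^sup>2 = (norm x)\<^sup>2 + 2 * Re (x * cnj d) + (norm d)\<^sup>2"
    unfolding cmod_power2 by (simp add: power2_eq_square algebra_simps)
  then show "(norm x)\<^sup>2 \<le> (norm (x + d))\<^sup>2" using assms zero_le_power2[of "norm d"] by linarith
qed simp

text \<open>Makes (m + 1) times the norm of \<open>Gamma_quotient\<close> eventually nonincreasing,
  from an index that depends only on a bound K for \<nu>^2 + \<nu>.\<close>

lemma norm_ratio_bound:
  fixes z :: complex
  assumes z: "norm z \<le> K" and K: "1 \<le> K" and m: "4 * K \<le> real m"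
  shows "(real m + 2) * norm (of_real ((real m)\<^sup>2 + real m) - z) \<le> (real m + 1) * norm (of_real ((real m)\<^sup>2 + 2 * real m + 3/4) - z)"
    and "of_real ((real m)\<^sup>2 + 2 * real m + 3/4) - z \<noteq> 0"
proof -
  define x where "x = of_real (real m + 2) * (of_real ((real m)\<^sup>2 + real m) - z)"
  \<comment> \<open>The difference of the two products being compared; for m >= 4 K it makes at most
    a right angle with x, so adding it cannot shorten x.\<close>
  define d where "d = of_real (3/4 * (real m + 1)) + z"
  have re: "\<bar>Re z\<bar> \<le> K" "\<bar>Im z\<bar> \<le> K" using z abs_Re_le_cmod[of z] abs_Im_le_cmod[of z] by linarith+
  have m1: "K \<le> real m" "1 \<le> real m" using m K by linarith+
  have mm: "4 * K \<le> (real m)\<^sup>2"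
  proof -
    have "real m * 1 \<le> real m * real m" using m1 by (intro mult_left_mono) auto
    then show ?thesis using m by (simp add: power2_eq_square)
  qed
  have "K * K \<le> ((real m)\<^sup>2 + real m - Re z) * (3/4 * (real m + 1) + Re z)"
  proof (rule mult_mono)
    show "K \<le> (real m)\<^sup>2 + real m - Re z" using re mm m1 by linarith
    show "K \<le> 3/4 * (real m + 1) + Re z" using re m K by (simp add: abs_le_iff field_simps)
  qed (use re mm m1 K in linarith)+
  moreover have "(Im z)\<^sup>2 \<le> K * K" using re(2) K by (metis abs_le_square_iff abs_of_nonneg power2_eq_square zero_le_one order_trans)
  ultimately have 0: "0 \<le> ((real m)\<^sup>2 + real m - Re z) * (3/4 * (real m + 1) + Re z) - (Im z)\<^sup>2" by linarith
  have "Re (x * cnj d) = (real m + 2) * (((real m)\<^sup>2 + real m - Re z) * (3/4 * (real m + 1) + Re z) - (Im z)\<^sup>2)"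
    unfolding x_def d_def by (simp add: power2_eq_square field_simps)
  then have "0 \<le> Re (x * cnj d)" using 0 by (simp only:) (intro mult_nonneg_nonneg, auto)
  then have "norm x \<le> norm (x + d)" by (rule norm_le_norm_add)
  also have "x + d = of_real (real m + 1) * (of_real ((real m)\<^sup>2 + 2 * real m + 3/4) - z)"
    unfolding x_def d_def by (simp add: power2_eq_square field_simps)
  finally have "norm (complex_of_real (real m + 2)) * norm (of_real ((real m)\<^sup>2 + real m) - z) \<le> norm (complex_of_real (real m + 1)) * norm (of_real ((real m)\<^sup>2 + 2 * real m + 3/4) - z)"
    unfolding x_def norm_mult .
  then show "(real m + 2) * norm (of_real ((real m)\<^sup>2 + real m) - z) \<le> (real m + 1) * norm (of_real ((real m)\<^sup>2 + 2 * real m + 3/4) - z)"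
    unfolding norm_of_real by simp
  show "of_real ((real m)\<^sup>2 + 2 * real m + 3/4) - z \<noteq> 0"
  proof
    assume "of_real ((real m)\<^sup>2 + 2 * real m + 3/4) - z = 0"
    then have "Re z = (real m)\<^sup>2 + 2 * real m + 3/4" by (metis Re_complex_of_real eq_iff_diff_eq_0)
    then show False using re mm K m1 by linarith
  qed
qed

lemma open_compl_Ints: "open (- \<int> :: complex set)"
  using closed_Ints by (simp add: open_Compl)

lemma Gamma_quotient_holomorphic: "(\<lambda>\<nu>. Gamma_quotient \<nu> m) holomorphic_on - \<int>"
  unfolding Gamma_quotient_def using not_Ints_shift by (intro holomorphic_intros) auto

text \<open>Compactness bounds the quotient at one index m0 chosen for the whole ball, and
  \<open>norm_ratio_bound\<close> carries the bound to all later indices. The gained 1 / (m + 1)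
  absorbs the factor 4 m + 1.\<close>

lemma Gamma_term_locally_bounded:
  assumes "cball x r \<subseteq> - \<int>"
  obtains C where "\<forall>\<^sub>F m in sequentially. \<forall>\<nu>\<in>cball x r. norm (Gamma_term \<nu> m) \<le> C * ncbinom m ^ 3"
proof -
  have "bounded ((\<lambda>\<nu>::complex. \<nu>\<^sup>2 + \<nu>) ` cball x r)"
    by (intro compact_imp_bounded compact_continuous_image continuous_intros) simp
  then obtain K0 where K0: "\<forall>\<nu>\<in>cball x r. norm (\<nu>\<^sup>2 + \<nu>) \<le> K0"
    by (auto simp: bounded_iff)
  define K where "K = max 1 K0"
  have K: "1 \<le> K" "\<And>\<nu>. \<nu> \<in> cball x r \<Longrightarrow> norm (\<nu>\<^sup>2 + \<nu>) \<le> K" using K0 by (auto simp: K_def le_max_iff_disj)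
  obtain m0 :: nat where m0: "4 * K \<le> real m0" using real_arch_simple by blast
  have "continuous_on (cball x r) (\<lambda>\<nu>. Gamma_quotient \<nu> m0)"
    using holomorphic_on_imp_continuous_on[OF Gamma_quotient_holomorphic] assms continuous_on_subset by blast
  then have "bounded ((\<lambda>\<nu>. Gamma_quotient \<nu> m0) ` cball x r)"
    by (intro compact_imp_bounded compact_continuous_image) auto
  then obtain A where A: "\<forall>\<nu>\<in>cball x r. norm (Gamma_quotient \<nu> m0) \<le> A"
    by (auto simp: bounded_iff)
  have bound: "(real m + 1) * norm (Gamma_quotient \<nu> m) \<le> (real m0 + 1) * A" if \<nu>: "\<nu> \<in> cball x r" and "m0 \<le> m" for \<nu> m
    using \<open>m0 \<le> m\<close>
  proof (induction m rule: dec_induct)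
    case base
    show ?case using A \<nu> by (intro mult_left_mono) auto
  next
    case (step m)
    have m: "4 * K \<le> real m" using m0 step(1) by linarith
    have \<nu>': "\<nu> \<notin> \<int>" using \<nu> assms by auto
    define p where "p = norm (of_real ((real m)\<^sup>2 + real m) - (\<nu>\<^sup>2 + \<nu>))"
    define t where "t = norm (of_real ((real m)\<^sup>2 + 2 * real m + 3/4) - (\<nu>\<^sup>2 + \<nu>))"
    have pt: "(real m + 2) * p \<le> (real m + 1) * t" "t > 0"
      using norm_ratio_bound[OF K(2)[OF \<nu>] K(1) m] by (simp_all add: p_def t_def)
    have rec: "t * norm (Gamma_quotient \<nu> (Suc m)) = p * norm (Gamma_quotient \<nu> m)"
      using Gamma_quotient_Suc[OF \<nu>', of m] unfolding p_def t_def by (simp only: norm_mult[symmetric])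
    have "t * ((real m + 2) * norm (Gamma_quotient \<nu> (Suc m))) = ((real m + 2) * p) * norm (Gamma_quotient \<nu> m)"
      using rec by (simp add: mult_ac)
    also have "\<dots> \<le> ((real m + 1) * t) * norm (Gamma_quotient \<nu> m)" by (intro mult_right_mono pt) simp
    finally have "(real m + 2) * norm (Gamma_quotient \<nu> (Suc m)) \<le> (real m + 1) * norm (Gamma_quotient \<nu> m)"
      using pt(2) by (simp add: mult_ac)
    then show ?case using step.IH by (simp add: add_ac)
  qed
  have "norm (Gamma_term \<nu> m) \<le> 4 * ((real m0 + 1) * A) * ncbinom m ^ 3" if "\<nu> \<in> cball x r" "m0 \<le> m" for \<nu> m
  proof -
    have "norm (Gamma_term \<nu> m) = ncbinom m ^ 3 * ((4 * real m + 1) * norm (Gamma_quotient \<nu> m))"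
      unfolding Gamma_term_eq norm_mult norm_of_real using ncbinom_pos[of m] by (simp add: abs_mult power_abs)
    also have "\<dots> \<le> ncbinom m ^ 3 * (4 * ((real m + 1) * norm (Gamma_quotient \<nu> m)))"
      using ncbinom_pos[of m] by (intro mult_left_mono) (auto simp: algebra_simps)
    also have "\<dots> \<le> ncbinom m ^ 3 * (4 * ((real m0 + 1) * A))"
      using ncbinom_pos[of m] bound[OF that] by (intro mult_left_mono) auto
    finally show ?thesis by (simp add: mult_ac)
  qed
  then have "\<forall>\<^sub>F m in sequentially. \<forall>\<nu>\<in>cball x r. norm (Gamma_term \<nu> m) \<le> 4 * ((real m0 + 1) * A) * ncbinom m ^ 3"
    using eventually_sequentially by blast
  then show ?thesis by (rule that)
qed

lemma summable_Gamma_term: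
  assumes "\<nu> \<notin> \<int>"
  shows "summable (Gamma_term \<nu>)"
proof -
  \<comment> \<open>A ball of radius 0 is a single point, so the uniform bound serves
    pointwise.\<close>
  obtain C where "\<forall>\<^sub>F m in sequentially. \<forall>\<mu>\<in>cball \<nu> 0. norm (Gamma_term \<mu> m) \<le> C * ncbinom m ^ 3"
    using Gamma_term_locally_bounded[of \<nu> 0] assms by auto
  then have "\<forall>\<^sub>F m in sequentially. norm (Gamma_term \<nu> m) \<le> C * ncbinom m ^ 3" by simp
  then show ?thesis
    by (rule summable_comparison_test_ev) (intro summable_mult summable_ncbinom_cube)
qed

lemma suminf_Gamma_term_holomorphic: "(\<lambda>\<nu>. \<Sum>m. Gamma_term \<nu> m) holomorphic_on - \<int>"
proof (rule holomorphic_uniform_sequence[OF open_compl_Ints])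
  show "(\<lambda>\<nu>. \<Sum>m<n. Gamma_term \<nu> m) holomorphic_on - \<int>" for n
    unfolding Gamma_term_eq by (intro holomorphic_intros Gamma_quotient_holomorphic)
  fix x :: complex assume "x \<in> - \<int>"
  then obtain r where r: "r > 0" "cball x r \<subseteq> - \<int>"
    using open_compl_Ints open_contains_cball by blast
  obtain C where "\<forall>\<^sub>F m in sequentially. \<forall>\<nu>\<in>cball x r. norm (Gamma_term \<nu> m) \<le> C * ncbinom m ^ 3"
    using Gamma_term_locally_bounded[OF r(2)] .
  then have "uniform_limit (cball x r) (\<lambda>n \<nu>. \<Sum>m<n. Gamma_term \<nu> m) (\<lambda>\<nu>. \<Sum>m. Gamma_term \<nu> m) sequentially"
    by (rule Weierstrass_m_test_ev) (intro summable_mult summable_ncbinom_cube)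
  then show "\<exists>d>0. cball x d \<subseteq> - \<int> \<and> uniform_limit (cball x d) (\<lambda>n \<nu>. \<Sum>m<n. Gamma_term \<nu> m) (\<lambda>\<nu>. \<Sum>m. Gamma_term \<nu> m) sequentially"
    using r by blast
qed

section \<open>The closed form as a meromorphic function\<close>

lemma cot_Gamma_eq:
  "cot_Gamma \<nu> = cos (of_real pi * \<nu> / 2) / sin (of_real pi * \<nu> / 2) * (Gamma ((1 + \<nu>) / 2))\<^sup>2 * (rGamma ((2 + \<nu>) / 2))\<^sup>2 / of_real pi"
proof -
  have "t * g / (p * h\<^sup>2) = t * g * (inverse h)\<^sup>2 / p" for t g p h :: complex
    by (simp add: field_simps)
  then show ?thesis unfolding cot_Gamma_def cot_def rGamma_inverse_Gamma by (simp only:)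
qed

lemma sin_half_pi_eq_0_imp_Ints:
  assumes "sin (of_real pi * \<nu> / 2 :: complex) = 0"
  shows "\<exists>n. \<nu> = 2 * of_int n"
proof -
  obtain n where "of_real pi * \<nu> / 2 = of_real (of_int n * pi)" using assms unfolding sin_eq_0 by blast
  then have "\<nu> = 2 * of_int n" by (simp add: field_simps)
  then show ?thesis ..
qed

lemma half_shift_nonpos_Ints:
  assumes "(1 + \<nu>) / 2 \<in> (\<int>\<^sub>\<le>\<^sub>0 :: complex set)"
  obtains n where "\<nu> = of_int (2 * n - 1)" "n \<le> 0"
proof -
  from assms obtain n where "(1 + \<nu>) / 2 = of_int n" "n \<le> 0" by (auto elim!: nonpos_Ints_cases)
  then have "\<nu> = of_int (2 * n - 1)" by (simp add: field_simps)
  then show ?thesis using that \<open>n \<le> 0\<close> by blast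
qed

lemma cot_Gamma_holomorphic: "cot_Gamma holomorphic_on - \<int>"
proof -
  have "sin (of_real pi * \<nu> / 2) \<noteq> 0" if "\<nu> \<in> - \<int>" for \<nu> :: complex
    using sin_half_pi_eq_0_imp_Ints[of \<nu>] that by auto
  moreover have "(1 + \<nu>) / 2 \<notin> \<int>\<^sub>\<le>\<^sub>0" if "\<nu> \<in> - \<int>" for \<nu> :: complex
    using that by (auto elim!: half_shift_nonpos_Ints)
  ultimately have "(\<lambda>\<nu>. cos (of_real pi * \<nu> / 2) / sin (of_real pi * \<nu> / 2) * (Gamma ((1 + \<nu>) / 2))\<^sup>2 * (rGamma ((2 + \<nu>) / 2))\<^sup>2 / of_real pi) holomorphic_on - \<int>"
    by (intro holomorphic_intros) auto
  then show ?thesis unfolding cot_Gamma_eq[abs_def] .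
qed

lemma Gamma_term_sums_real:
  assumes a: "0 < a" "a < 1/2"
  shows "Gamma_term (- of_real a) sums cot_Gamma (- of_real a)"
proof -
  interpret hypergeometric_square a using a by unfold_locales auto
  have "Gamma_term (- of_real a) m = of_real (ncbinom m ^ 3 * (-1) ^ (m + 1) * (R m * (4 * real m + 1)))" for m
  proof -
    have G: "Gamma (of_nat m - - complex_of_real a) = of_real (Gamma (real m + a))"
      "Gamma (of_nat m + - complex_of_real a + 1) = of_real (Gamma (real m + 1 - a))"
      "Gamma (of_nat m - - complex_of_real a + 1/2) = of_real (Gamma (real m + a + 1/2))"
      "Gamma (of_nat m + - complex_of_real a + 3/2) = of_real (Gamma (real m + 3/2 - a))"
      unfolding Gamma_complex_of_real[symmetric] by (rule arg_cong[where f = Gamma], simp)+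
    show ?thesis unfolding Gamma_term_def G by (simp add: R_def)
  qed
  moreover have "cot_Gamma (- of_real a) = of_real (- cot (pi * a / 2) * (Gamma ((1 - a) / 2))\<^sup>2 / (pi * (Gamma (1 - a / 2))\<^sup>2))"
  proof -
    have e: "of_real pi * (- complex_of_real a) / 2 = of_real (- (pi * a / 2))" "(1 + - complex_of_real a) / 2 = of_real ((1 - a) / 2)"
      "(2 + - complex_of_real a) / 2 = of_real (1 - a / 2)"
      by simp_all
    show ?thesis unfolding cot_Gamma_def e Gamma_complex_of_real cot_of_real[symmetric] by (simp add: cot_def)
  qed
  moreover have "(\<lambda>m. Gamma_term (- of_real a) m) = Gamma_term (- of_real a)" by (rule refl)
  ultimately show ?thesis using sums_of_real[OF Gamma_quotient_sums[OF a(2)], where 'a = complex] by presburger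
qed

text \<open>Identity theorem: both sides are holomorphic off the integers and agree on the segment
  between -1/2 and 0, in which -1/4 serves as accumulation point.\<close>

lemma Gamma_term_sums:
  assumes "\<nu> \<notin> \<int>"
  shows "Gamma_term \<nu> sums cot_Gamma \<nu>"
proof -
  define U where "U = complex_of_real ` {-1/2<..<0}"
  have U: "\<nu> \<notin> \<int>" if u: "\<nu> \<in> U" for \<nu>
  proof
    assume "\<nu> \<in> \<int>"
    then obtain n where n: "\<nu> = of_int n" by (rule Ints_cases)
    obtain y where y: "\<nu> = of_real y" "-1/2 < y" "y < 0" using u by (auto simp: U_def)
    then have "y = of_int n" using n by (metis of_real_eq_iff of_real_of_int_eq)
    then have "real_of_int (-1) < real_of_int n" "real_of_int n < real_of_int 0" using y by simp_all
    then have "-1 < n" "n < 0" by (simp_all only: of_int_less_iff)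
    then show False by simp
  qed
  have "(\<Sum>m. Gamma_term \<nu> m) - cot_Gamma \<nu> = 0"
  proof (rule analytic_continuation[where f = "\<lambda>\<nu>. (\<Sum>m. Gamma_term \<nu> m) - cot_Gamma \<nu>"])
    show "(\<lambda>\<nu>. (\<Sum>m. Gamma_term \<nu> m) - cot_Gamma \<nu>) holomorphic_on - \<int>"
      by (intro holomorphic_intros suminf_Gamma_term_holomorphic cot_Gamma_holomorphic)
    show "open (- \<int> :: complex set)" by (rule open_compl_Ints)
    \<comment> \<open>Removing a countable closed set leaves the plane connected, so the segment
      determines the function everywhere off the integers.\<close>
    have "countable (\<int> :: complex set)" unfolding Ints_def by simp
    then show "connected (- \<int> :: complex set)"
      using connected_open_diff_countable[of "UNIV :: complex set" "\<int>"] by (simp add: Compl_eq_Diff_UNIV connected_UNIV)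
    show "U \<subseteq> - \<int>" using U by auto
    have x: "of_real (-1/4) \<in> U" unfolding U_def by (intro imageI) auto
    then show "of_real (-1/4) \<in> - (\<int> :: complex set)" using U by auto
    show "(of_real (-1/4) :: complex) islimpt U"
      unfolding islimpt_approachable
    proof (intro allI impI)
      fix e :: real assume e: "e > 0"
      \<comment> \<open>A shift of at most 1/8 stays inside the segment.\<close>
      define y where "y = -1/4 + min (e/2) (1/8)"
      have "y \<in> {-1/2<..<0}" "y \<noteq> -1/4" "\<bar>y - (-1/4)\<bar> < e" using e by (auto simp: y_def min_def)
      then have "complex_of_real y \<in> U" "complex_of_real y \<noteq> of_real (-1/4)" "dist (complex_of_real y) (of_real (-1/4)) < e"
        by (auto simp only: U_def of_real_eq_iff dist_of_real dist_real_def intro: imageI)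
      then show "\<exists>x'\<in>U. x' \<noteq> of_real (-1/4) \<and> dist x' (of_real (-1/4)) < e" by blast
    qed
    show "(\<Sum>m. Gamma_term z m) - cot_Gamma z = 0" if u: "z \<in> U" for z
    proof -
      obtain y where y: "z = of_real y" "-1/2 < y" "y < 0" using u by (auto simp: U_def)
      then show ?thesis using Gamma_term_sums_real[of "- y"] by (simp add: sums_iff)
    qed
    show "\<nu> \<in> - \<int>" using assms by simp
  qed
  then show ?thesis using summable_Gamma_term[OF assms] by (simp add: sums_iff)
qed

lemma cot_Gamma_tendsto:
  assumes \<nu>: "\<nu> \<in> \<int>" "\<nu> \<notin> {1 - 2 * of_nat n | n::nat. n \<ge> 1} \<union> {2 * of_nat n | n::nat. True}"
  shows "\<exists>c. (cot_Gamma \<longlongrightarrow> c) (at \<nu>) \<and> (0 < Re \<nu> \<longrightarrow> c = cot_Gamma \<nu>)"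
proof -
  obtain k where k: "\<nu> = of_int k" using \<nu>(1) by (rule Ints_cases)
  have odd_pos: "odd k" if "k \<ge> 0"
  proof
    assume "even k"
    then obtain j where j: "k = 2 * j" by blast
    then have "\<nu> = 2 * of_nat (nat j)" using that k by (simp add: of_nat_nat)
    then show False using \<nu>(2) by blast
  qed
  have even_neg: "even k" if "k < 0"
  proof (rule ccontr)
    assume "odd k"
    then obtain j where j: "k = 2 * j + 1" by (rule oddE)
    then have "\<nu> = 1 - 2 * of_nat (nat (- j))" "nat (- j) \<ge> 1" using that k by (simp_all add: nat_le_iff)
    then show False using \<nu>(2) by blast
  qed
  have c1: "(1 + \<nu>) / 2 \<notin> \<int>\<^sub>\<le>\<^sub>0"
  proof
    assume "(1 + \<nu>) / 2 \<in> \<int>\<^sub>\<le>\<^sub>0"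
    then obtain n where "\<nu> = of_int (2 * n - 1)" "n \<le> 0" by (rule half_shift_nonpos_Ints)
    then have "k = 2 * n - 1" "k < 0" using k by (simp_all only: of_int_eq_iff)
    then show False using even_neg by simp
  qed
  show ?thesis
  proof (cases "k \<ge> 0")
    case True
    have "sin (of_real pi * \<nu> / 2) \<noteq> 0"
    proof
      assume "sin (of_real pi * \<nu> / 2) = 0"
      then obtain n where "\<nu> = 2 * of_int n" using sin_half_pi_eq_0_imp_Ints by blast
      then have "k = 2 * n" using k by (metis of_int_eq_iff of_int_mult of_int_numeral)
      then show False using odd_pos[OF True] by simp
    qed
    then have "isCont cot_Gamma \<nu>"
      unfolding cot_Gamma_eq[abs_def] using c1 by (intro continuous_intros) auto
    then show ?thesis unfolding isCont_def by blast
  next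
    case False
    \<comment> \<open>Reflection writes one of the two factors rGamma((2 + \<mu>)/2) as -sin(pi
      \<mu>/2) Gamma(-\<mu>/2) / pi, which cancels the sine in the denominator of the
      cotangent.\<close>
    define h where "h \<mu> = - (cos (of_real pi * \<mu> / 2) * Gamma (- \<mu> / 2) * rGamma ((2 + \<mu>) / 2) * (Gamma ((1 + \<mu>) / 2))\<^sup>2 / (of_real pi)\<^sup>2)" for \<mu> :: complex
    have c2: "- \<nu> / 2 \<notin> \<int>\<^sub>\<le>\<^sub>0"
    proof
      assume "- \<nu> / 2 \<in> \<int>\<^sub>\<le>\<^sub>0"
      then obtain n where "- \<nu> / 2 = of_int n" "n \<le> 0" by (auto elim!: nonpos_Ints_cases)
      then have "k = - 2 * n" using k by (metis add.inverse_inverse divide_eq_eq_numeral1(1) minus_equation_iff mult.commute mult_minus_right of_int_eq_iff of_int_minus of_int_mult of_int_numeral zero_neq_numeral)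
      then show False using False \<open>n \<le> 0\<close> by simp
    qed
    have "isCont h \<nu>" unfolding h_def using c1 c2 by (intro continuous_intros) auto
    then have "(h \<longlongrightarrow> h \<nu>) (at \<nu>)" by (simp add: isCont_def)
    moreover have "\<forall>\<^sub>F \<mu> in at \<nu>. h \<mu> = cot_Gamma \<mu>"
    proof -
      have "\<forall>\<^sub>F \<mu> in at \<nu>. \<mu> \<in> - (\<int> - {\<nu>}) - {\<nu>}"
        by (intro eventually_at_in_open open_Compl closed_subset_Ints) auto
      then show ?thesis
      proof eventually_elim
        case (elim \<mu>)
        then have \<mu>: "\<mu> \<notin> \<int>" by auto
        then have s: "sin (of_real pi * \<mu> / 2) \<noteq> 0" using sin_half_pi_eq_0_imp_Ints[of \<mu>] by auto
        have "- \<mu> / 2 \<notin> \<int>\<^sub>\<le>\<^sub>0"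
        proof
          assume "- \<mu> / 2 \<in> \<int>\<^sub>\<le>\<^sub>0"
          then obtain n where "- \<mu> / 2 = of_int n" by (auto elim!: nonpos_Ints_cases)
          then have "- \<mu> = of_int (2 * n)" by (simp add: field_simps)
          then have "\<mu> = - of_int (2 * n)" by (metis add.inverse_inverse)
          then show False using \<mu> by auto
        qed
        then have g: "rGamma (- \<mu> / 2) * Gamma (- \<mu> / 2) = 1" by (simp add: rGamma_inverse_Gamma Gamma_eq_zero_iff)
        have e: "1 - (- \<mu> / 2) = (2 + \<mu>) / 2" by (simp add: field_simps)
        have "rGamma (- \<mu> / 2) * rGamma ((2 + \<mu>) / 2) = sin (of_real pi * (- \<mu> / 2)) / of_real pi"
          using rGamma_reflection_complex[of "- \<mu> / 2"] unfolding e .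
        then have "rGamma (- \<mu> / 2) * rGamma ((2 + \<mu>) / 2) = - sin (of_real pi * \<mu> / 2) / of_real pi"
          by simp
        then have r: "rGamma ((2 + \<mu>) / 2) = - sin (of_real pi * \<mu> / 2) / of_real pi * Gamma (- \<mu> / 2)"
          using g by (metis mult.assoc mult.commute mult_1)
        show ?case unfolding h_def cot_Gamma_eq power2_eq_square[of "rGamma ((2 + \<mu>) / 2)"]
          by (subst (2) r) (use s in \<open>simp add: power2_eq_square mult_ac\<close>)
      qed
    qed
    ultimately have "(cot_Gamma \<longlongrightarrow> h \<nu>) (at \<nu>)" by (rule Lim_transform_eventually)
    moreover have "\<not> 0 < Re \<nu>" using False k by simp
    ultimately show ?thesis by blast
  qed
qed

text \<open>A punctured neighbourhood of an integer contains no other integer, so there the sum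
  coincides with \<open>cot_Gamma\<close> and inherits its limit.\<close>

lemma suminf_Gamma_term_tendsto:
  assumes "\<nu> \<in> \<int>" "(cot_Gamma \<longlongrightarrow> c) (at \<nu>)"
  shows "((\<lambda>\<mu>. \<Sum>m. Gamma_term \<mu> m) \<longlongrightarrow> c) (at \<nu>)"
proof -
  have "\<forall>\<^sub>F \<mu> in at \<nu>. \<mu> \<in> - (\<int> - {\<nu>}) - {\<nu>}"
    by (intro eventually_at_in_open open_Compl closed_subset_Ints) auto
  then have "\<forall>\<^sub>F \<mu> in at \<nu>. cot_Gamma \<mu> = (\<Sum>m. Gamma_term \<mu> m)"
  proof eventually_elim
    case (elim \<mu>)
    then show ?case using Gamma_term_sums[of \<mu>] by (simp add: sums_iff)
  qed
  then show ?thesis by (rule Lim_transform_eventually[OF assms(2)])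
qed

theorem theorem2p2:
  shows
    "(\<forall>\<nu>::complex.
        \<nu> \<notin> {1 - 2 * of_nat n | n::nat. n \<ge> 1} \<union> {2 * of_nat n | n::nat. True} \<longrightarrow>
          (\<nu> \<notin> \<int> \<longrightarrow> Gamma_term \<nu> sums cot_Gamma \<nu>) \<and>
          (\<nu> \<in> \<int> \<longrightarrow>
             (\<exists>c. (cot_Gamma \<longlongrightarrow> c) (at \<nu>) \<and>
                  (0 < Re \<nu> \<longrightarrow> c = cot_Gamma \<nu>) \<and>
                  ((\<lambda>\<mu>. \<Sum>m. Gamma_term \<mu> m) \<longlongrightarrow> c) (at \<nu>))))
     \<and>
     (\<forall>x::real. x \<in> {0..1} \<longrightarrow>
        (\<lambda>m. ereal (pi ^ 3 / 8 *
               (ncbinom m ^ 4 * (4 * real m + 1) * poly (legendre (2 * m)) (2 * x - 1))))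
        sums enn2ereal (ellK x * ellK (1 - x)))"
proof (intro conjI allI impI)
  fix \<nu> :: complex
  assume \<nu>: "\<nu> \<notin> {1 - 2 * of_nat n | n::nat. n \<ge> 1} \<union> {2 * of_nat n | n::nat. True}"
  show "Gamma_term \<nu> sums cot_Gamma \<nu>" if "\<nu> \<notin> \<int>"
    using that by (rule Gamma_term_sums)
  show "\<exists>c. (cot_Gamma \<longlongrightarrow> c) (at \<nu>) \<and> (0 < Re \<nu> \<longrightarrow> c = cot_Gamma \<nu>) \<and>
      ((\<lambda>\<mu>. \<Sum>m. Gamma_term \<mu> m) \<longlongrightarrow> c) (at \<nu>)" if "\<nu> \<in> \<int>"
    using cot_Gamma_tendsto[OF that \<nu>] suminf_Gamma_term_tendsto[OF that] by blast
qed (rule ellK_product_sums)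

end
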